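(* Let $P$ be a polynomial of degree $\lambda\ge 1$ with $\mathrm{Re}\,P(ix)=0$ for all $x\in\mathbb{R}$, let $r>\frac12$ and $0<\varepsilon\le 1$. Let $u$ be the exact solution of the equation $$\partial_t u+\mathcal{L}_{\varepsilon,\lambda}u+\varepsilon\mathcal{L}_\varepsilon(u^2)=0\quad\text{on }\mathbb{T},$$ and let $u^n$ be the Lie splitting approximation with step size $\tau$ at time $t_n=n\tau$, defined by $$u^{n+1}=e^{-\tau\mathcal{L}_{\varepsilon,\lambda}}\big(u^n-\tau\varepsilon\mathcal{L}_\varepsilon (u^n)^2\big),\qquad u^0=u(0).$$ Then the following regularized convergence holds (of interest in the regularizing regime $\varepsilon=\mathcal{O}(1)$): $$\|u(t_n)-u^n\|_r\le \tau\,\frac1\varepsilon\, c\Big(\sup_{0\le t\le t_n}\|u(t)\|_{r-2+\lambda}\Big),$$ where $c(\cdot)$ denotes a constant depending on the indicated quantity.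
   Context: $\mathbb{T}=[-\pi,\pi]$ with periodic boundary conditions. For $s\in\mathbb{R}$, $\|\cdot\|_s$ is the standard $H^s(\mathbb{T})$ norm, $\|f\|_s^2=\sum_{k\in\mathbb{Z}}(1+|k|)^{2s}|\hat f_k|^2$. The operators are the Fourier multipliers $\mathcal{L}_\varepsilon=\frac{\partial_x}{1-\varepsilon\partial_x^2}$ with symbol $\frac{ik}{1+\varepsilon k^2}$, $\mathcal{L}_{\varepsilon,\lambda}=\frac{P(\partial_x)}{1-\varepsilon\partial_x^2}$ with symbol $\frac{P(ik)}{1+\varepsilon k^2}$, and $e^{t\mathcal{L}_{\varepsilon,\lambda}}$ with symbol $e^{tP(ik)/(1+\varepsilon k^2)}$, $k\in\mathbb{Z}$. The equation is the (generalised) Benjamin--Bona--Mahony equation; its exact solution satisfies $u(t_n+\tau)=e^{-\tau\mathcal{L}_{\varepsilon,\lambda}}u(t_n)-\varepsilon\mathcal{L}_\varepsilon\int_0^\tau e^{-(\tau-s)\mathcal{L}_{\varepsilon,\lambda}}u^2(t_n+s)\,ds$.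
   Formalization: The constant c may also depend on P, r and a final time T ≥ t_n (a bound uniform in time is false); for λ=1 and 1/2<r<1 the solution is measured in L² instead of H^{r-1}, where the stated bound fails. *)

theory Defs
  imports "HOL-Analysis.Analysis" "HOL-Computational_Algebra.Polynomial"
begin

(* Functions on the torus are functions real => complex of which only the restriction to
   [-pi, pi] matters, up to null sets; periodicity enters through the Fourier coefficients. *)

abbreviation torus :: "real measure" where
  "torus \<equiv> lebesgue_on {-pi..pi}"

definition fourier_coeff :: "(real \<Rightarrow> complex) \<Rightarrow> int \<Rightarrow> complex" where
  "fourier_coeff f k =
     complex_of_real (1 / (2 * pi)) * integral\<^sup>L torus (\<lambda>x. f x * cis (- (of_int k * x)))"

definition square_integrable :: "(real \<Rightarrow> complex) \<Rightarrow> bool" where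
  "square_integrable f \<longleftrightarrow>
     f \<in> borel_measurable torus \<and> integrable torus (\<lambda>x. (cmod (f x))\<^sup>2)"

(* For s \<ge> 0 this is H^s.  (For s < 0 it would only be the part of H^s inside L^2; negative
   exponents are not used.) *)
definition sobolev :: "real \<Rightarrow> (real \<Rightarrow> complex) set" where
  "sobolev s = {f. square_integrable f \<and>
     (\<lambda>k::int. (1 + \<bar>of_int k\<bar>) powr (2 * s) * (cmod (fourier_coeff f k))\<^sup>2) summable_on UNIV}"

(* Meaningful only for f \<in> sobolev s: infsum is 0 on non-summable families. *)
definition sobolev_norm :: "real \<Rightarrow> (real \<Rightarrow> complex) \<Rightarrow> real" where
  "sobolev_norm s f =
     sqrt (\<Sum>\<^sub>\<infinity>k::int. (1 + \<bar>of_int k\<bar>) powr (2 * s) * (cmod (fourier_coeff f k))\<^sup>2)"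

definition symbol_L :: "real \<Rightarrow> int \<Rightarrow> complex" where
  "symbol_L eps k = \<i> * of_int k / complex_of_real (1 + eps * (of_int k)\<^sup>2)"

definition symbol_LP :: "complex poly \<Rightarrow> real \<Rightarrow> int \<Rightarrow> complex" where
  "symbol_LP P eps k = poly P (\<i> * of_int k) / complex_of_real (1 + eps * (of_int k)\<^sup>2)"

(* g = m(D) f.  A relation rather than an operator, because g is an L^2 function determined
   by its Fourier coefficients only up to null sets. *)
definition is_multiplier_image ::
    "(int \<Rightarrow> complex) \<Rightarrow> (real \<Rightarrow> complex) \<Rightarrow> (real \<Rightarrow> complex) \<Rightarrow> bool" where
  "is_multiplier_image m f g \<longleftrightarrow>
     square_integrable g \<and> (\<forall>k. fourier_coeff g k = m k * fourier_coeff f k)"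

(* The equation holds for every Fourier mode, i.e. in the sense of periodic distributions in x;
   every strong or mild solution in C([0,T]; H^s) satisfies this.  For s \<ge> 0 the square of
   u(t) is integrable, so its Fourier coefficients are defined. *)
definition exact_solution ::
    "complex poly \<Rightarrow> real \<Rightarrow> real \<Rightarrow> real \<Rightarrow> (real \<Rightarrow> real \<Rightarrow> complex) \<Rightarrow> bool" where
  "exact_solution P eps s T u \<longleftrightarrow>
     (\<forall>t\<in>{0..T}. u t \<in> sobolev s) \<and>
     (\<forall>t\<in>{0..T}. \<forall>k.
        ((\<lambda>t'. fourier_coeff (u t') k) has_vector_derivative
           - (symbol_LP P eps k * fourier_coeff (u t) k)
           - complex_of_real eps * (symbol_L eps k * fourier_coeff (\<lambda>x. (u t x)\<^sup>2) k))
         (at t within {0..T}))"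

(* g is L_eps (f^2), and f' = exp (- tau L_{eps,P}) (f - tau eps g) *)
definition lie_step ::
    "complex poly \<Rightarrow> real \<Rightarrow> real \<Rightarrow> (real \<Rightarrow> complex) \<Rightarrow> (real \<Rightarrow> complex) \<Rightarrow> bool" where
  "lie_step P eps tau f f' \<longleftrightarrow>
     (\<exists>g. is_multiplier_image (symbol_L eps) (\<lambda>x. (f x)\<^sup>2) g \<and>
          is_multiplier_image (\<lambda>k. exp (- complex_of_real tau * symbol_LP P eps k))
            (\<lambda>x. f x - complex_of_real (tau * eps) * g x) f')"

definition lie_splitting ::
    "complex poly \<Rightarrow> real \<Rightarrow> real \<Rightarrow> (real \<Rightarrow> complex) \<Rightarrow> (nat \<Rightarrow> real \<Rightarrow> complex) \<Rightarrow> bool" where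
  "lie_splitting P eps tau u0 v \<longleftrightarrow> v 0 = u0 \<and> (\<forall>n. lie_step P eps tau (v n) (v (Suc n)))"

(* The regularity in which the exact solution is measured.  It is r - 2 + lam, except for
   lam = 1 and r < 1, where that number is negative: there the square of u(t) need not be
   defined for u(t) in H^(r-1), and no error bound in terms of the H^(r-1) norm alone holds,
   so the L^2 norm is used. *)
definition solution_regularity :: "real \<Rightarrow> nat \<Rightarrow> real" where
  "solution_regularity r lam = max 0 (r - 2 + real lam)"

end

theory Submission
  imports Defs
begin

text \<open>
The operator \<open>\<epsilon> L\<^sub>\<epsilon>\<close> gains one derivative uniformly in \<open>\<epsilon>\<close>, and the symbol of
\<open>L\<^sub>\<epsilon>\<^sub>,\<^sub>\<lambda>\<close> is at most $C \varepsilon^{-1} \langle k\rangle^{\lambda-2}$. Put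
$s = \max(0, r-1)$. Measured in \<open>H\<^sup>r\<close>, the local error is controlled by the increment of \<open>u\<^sup>2\<close>
in \<open>H\<^sup>s\<close>, which factors as the sum of two values of \<open>u\<close>, in \<open>H\<^sup>s\<close>, times the increment of
\<open>u\<close>; so the velocity \<open>\<partial>\<^sub>t u\<close> has to be a multiplier of \<open>H\<^sup>s\<close> with norm $O(1/\varepsilon)$.
For its linear part this is the embedding of \<open>H\<^sup>r\<close> into a weighted Wiener algebra. The nonlinear part
\<open>\<epsilon> L\<^sub>\<epsilon> u\<^sup>2\<close> is borderline: for \<open>s > 0\<close> a Schur test applies, and for \<open>s = 0\<close> it is, up to
a remainder of size $1/\varepsilon$ in the Wiener algebra, an antiderivative of an integrable function,
hence bounded, which is expressed through Hilbert's inequality.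

Stability needs an a priori bound of \<open>u\<^sup>n\<close> in \<open>H\<^sup>s\<close>. While $\tau/\varepsilon$ is small it follows
from the convergence estimate itself. Otherwise $\varepsilon \lesssim \tau$, and interpolation gives
$\|\varepsilon L_\varepsilon (v^2)\|_s \lesssim \varepsilon^{1/8} \|v\|_s^2$; one step then increases the norm
only by $O(\tau^{9/8})$, which cannot blow up before time \<open>T\<close>.
\<close>


section \<open>Fourier coefficients on the torus\<close>

text \<open>For r \<le> 3/2 the space H^s is not an algebra, and for lam = 1 the solution is
  controlled in H^s only, so the two factors of the increment of u^2 cannot be treated alike. More
  is demanded of the difference of two functions than of their sum: it is either an element of H^r
  or an increment in time, and both kinds act as multipliers of H^s. The factor 1/eps may enter
  through the local error alone. In the stability constant it would become exp(T/eps) by Gronwall,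
  but \<open>c\<close> is fixed before eps, tau and n. Stability therefore uses only the derivative
  gained uniformly in eps, and pays for it with the a priori bound of u^n. No smallness of tau/eps
  is assumed, so a bootstrap from the error estimate cannot supply this bound in all cases; this
  forces the second regime. All estimates concern finite sums of Fourier coefficients. Mode-wise
  derivatives combined with duality replace Duhamel integrals with values in H^r, so no continuity
  or measurability of u in time with values in a function space has to be established.\<close>

lemma measure_torus: "measure torus (space torus) = 2 * pi"
  by (simp add: measure_restrict_space)

lemma square_integrable_imp_integrable:
  assumes "square_integrable f" shows "integrable torus f"
proof (rule Bochner_Integration.integrable_bound)
  show "integrable torus (\<lambda>x. (cmod (f x))\<^sup>2 + 1)" "f \<in> borel_measurable torus"
    using assms by (simp_all add: square_integrable_def)
  show "AE x in torus. norm (f x) \<le> norm ((cmod (f x))\<^sup>2 + 1)"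
  proof (rule AE_I2)
    fix x
    have "2 * cmod (f x) * 1 \<le> (cmod (f x))\<^sup>2 + 1\<^sup>2" by (rule sum_squares_bound)
    then have "cmod (f x) \<le> (cmod (f x))\<^sup>2 + 1"
      using norm_ge_zero[of "f x"] unfolding power_one by linarith
    then show "norm (f x) \<le> norm ((cmod (f x))\<^sup>2 + 1)" by simp
  qed
qed

lemma square_integrable_mult:
  assumes "square_integrable f" "square_integrable g"
  shows "integrable torus (\<lambda>x. f x * g x)"
proof (rule Bochner_Integration.integrable_bound)
  show "integrable torus (\<lambda>x. (cmod (f x))\<^sup>2 + (cmod (g x))\<^sup>2)"
    using assms by (simp add: square_integrable_def)
  show "(\<lambda>x. f x * g x) \<in> borel_measurable torus"
    using assms by (auto simp add: square_integrable_def)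
  show "AE x in torus. norm (f x * g x) \<le> norm ((cmod (f x))\<^sup>2 + (cmod (g x))\<^sup>2)"
  proof (rule AE_I2)
    fix x
    have "2 * (cmod (f x) * cmod (g x)) \<le> (cmod (f x))\<^sup>2 + (cmod (g x))\<^sup>2"
      using sum_squares_bound[of "cmod (f x)" "cmod (g x)"] by simp
    moreover have "0 \<le> cmod (f x) * cmod (g x)" by simp
    ultimately have "cmod (f x) * cmod (g x) \<le> (cmod (f x))\<^sup>2 + (cmod (g x))\<^sup>2" by linarith
    then show "norm (f x * g x) \<le> norm ((cmod (f x))\<^sup>2 + (cmod (g x))\<^sup>2)"
      by (simp add: norm_mult)
  qed
qed

lemma square_integrable_lincomb:
  assumes "square_integrable f" "square_integrable g"
  shows "square_integrable (\<lambda>x. a * f x + b * g x)"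
proof -
  have m: "(\<lambda>x. a * f x + b * g x) \<in> borel_measurable torus"
    using assms by (auto simp add: square_integrable_def)
  have "integrable torus (\<lambda>x. (cmod (a * f x + b * g x))\<^sup>2)"
  proof (rule Bochner_Integration.integrable_bound)
    show "integrable torus (\<lambda>x. 2 * (cmod a)\<^sup>2 * (cmod (f x))\<^sup>2 + 2 * (cmod b)\<^sup>2 * (cmod (g x))\<^sup>2)"
      using assms by (simp add: square_integrable_def)
    show "(\<lambda>x. (cmod (a * f x + b * g x))\<^sup>2) \<in> borel_measurable torus"
      using m by simp
    show "AE x in torus. norm ((cmod (a * f x + b * g x))\<^sup>2) \<le> 
      norm (2 * (cmod a)\<^sup>2 * (cmod (f x))\<^sup>2 + 2 * (cmod b)\<^sup>2 * (cmod (g x))\<^sup>2)"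
    proof (rule AE_I2)
      fix x
      have "(cmod (a * f x + b * g x))\<^sup>2 \<le> (cmod (a * f x) + cmod (b * g x))\<^sup>2"
        by (intro power_mono norm_triangle_ineq) simp
      also have "\<dots> \<le> 2 * (cmod (a * f x))\<^sup>2 + 2 * (cmod (b * g x))\<^sup>2"
        using sum_squares_bound[of "cmod (a * f x)" "cmod (b * g x)"] by (simp add: power2_sum)
      finally show "norm ((cmod (a * f x + b * g x))\<^sup>2) \<le> 
      norm (2 * (cmod a)\<^sup>2 * (cmod (f x))\<^sup>2 + 2 * (cmod b)\<^sup>2 * (cmod (g x))\<^sup>2)"
        by (simp add: norm_mult power_mult_distrib)
    qed
  qed
  then show ?thesis using m by (simp add: square_integrable_def)
qed

lemma square_integrable_add: "square_integrable f \<Longrightarrow> square_integrable g \<Longrightarrow> square_integrable (\<lambda>x. f x + g x)"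
  using square_integrable_lincomb[of f g 1 1] by simp

lemma square_integrable_diff: "square_integrable f \<Longrightarrow> square_integrable g \<Longrightarrow> square_integrable (\<lambda>x. f x - g x)"
  using square_integrable_lincomb[of f g 1 "-1"] by simp

lemma bounded_square_integrable_mult:
  assumes B: "B \<in> borel_measurable torus" "\<And>x. x \<in> {-pi..pi} \<Longrightarrow> cmod (B x) \<le> K" 
    and f: "square_integrable f"
  shows "square_integrable (\<lambda>x. B x * f x)"
    "integral\<^sup>L torus (\<lambda>x. (cmod (B x * f x))\<^sup>2) \<le> K\<^sup>2 * integral\<^sup>L torus (\<lambda>x. (cmod (f x))\<^sup>2)"
proof -
  have m: "(\<lambda>x. B x * f x) \<in> borel_measurable torus"
    using assms by (auto simp add: square_integrable_def)
  have le: "(cmod (B x * f x))\<^sup>2 \<le> K\<^sup>2 * (cmod (f x))\<^sup>2" if "x \<in> {-pi..pi}" for x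
    using B(2)[OF that] by (simp add: norm_mult power_mult_distrib mult_right_mono power_mono)
  have i: "integrable torus (\<lambda>x. K\<^sup>2 * (cmod (f x))\<^sup>2)"
    using f by (simp add: square_integrable_def)
  have "integrable torus (\<lambda>x. (cmod (B x * f x))\<^sup>2)"
  proof (rule Bochner_Integration.integrable_bound[OF i])
    show "(\<lambda>x. (cmod (B x * f x))\<^sup>2) \<in> borel_measurable torus"
      using m by simp
    show "AE x in torus. norm ((cmod (B x * f x))\<^sup>2) \<le> norm (K\<^sup>2 * (cmod (f x))\<^sup>2)"
      using le by (intro AE_I2) simp
  qed
  then show "square_integrable (\<lambda>x. B x * f x)"
    "integral\<^sup>L torus (\<lambda>x. (cmod (B x * f x))\<^sup>2) \<le> K\<^sup>2 * integral\<^sup>L torus (\<lambda>x. (cmod (f x))\<^sup>2)"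
    using m le i integral_mono[OF _ i, of "\<lambda>x. (cmod (B x * f x))\<^sup>2"] by (auto simp add: square_integrable_def)
qed

lemma continuous_measurable_torus:
  "continuous_on {-pi..pi} f \<Longrightarrow> f \<in> borel_measurable torus"
  by (rule continuous_imp_measurable_on_sets_lebesgue) simp_all

lemma square_integrable_1: "square_integrable (\<lambda>x. 1)"
  by (simp add: square_integrable_def)

lemma bounded_square_integrable:
  assumes B: "B \<in> borel_measurable torus" "\<And>x. x \<in> {-pi..pi} \<Longrightarrow> cmod (B x) \<le> K" 
  shows "square_integrable B"
  using bounded_square_integrable_mult(1)[OF B square_integrable_1] by simp

lemma cis_measurable_torus: "(\<lambda>x. cis (c * x)) \<in> borel_measurable torus"
  by (intro continuous_measurable_torus continuous_intros)

lemma integrable_mult_cis: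
  assumes "integrable torus f"
  shows "integrable torus (\<lambda>x. f x * cis (c * x))"
  by (rule Bochner_Integration.integrable_bound[OF assms])
   (use assms in \<open>auto intro!: borel_measurable_times cis_measurable_torus simp: norm_mult\<close>)

text \<open>Moves the sign onto the frequency, which gives the integrand the shape
  \<open>f x * cis (c * x)\<close> of \<open>integrable_mult_cis\<close>.\<close>

lemma fourier_coeff_alt:
  "fourier_coeff f k = complex_of_real (1 / (2 * pi)) * integral\<^sup>L torus (\<lambda>x. f x * cis (- of_int k * x))"
  by (simp add: fourier_coeff_def)

lemma fourier_coeff_lincomb:
  assumes "integrable torus f" "integrable torus g"
  shows "fourier_coeff (\<lambda>x. a * f x + b * g x) k = a * fourier_coeff f k + b * fourier_coeff g k"
proof -
  have "integral\<^sup>L torus (\<lambda>x. (a * f x + b * g x) * cis (- of_int k * x)) =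
     integral\<^sup>L torus (\<lambda>x. a * (f x * cis (- of_int k * x)) + b * (g x * cis (- of_int k * x)))"
    by (simp add: algebra_simps)
  also have "\<dots> = a * integral\<^sup>L torus (\<lambda>x. f x * cis (- of_int k * x)) + b * integral\<^sup>L torus (\<lambda>x. g x * cis (- of_int k * x))"
    by (subst Bochner_Integration.integral_add)
       (intro integrable_mult_right integrable_mult_cis assms | simp only: Bochner_Integration.integral_mult_right_zero)+
  finally show ?thesis by (simp only: fourier_coeff_alt) (simp add: algebra_simps)
qed

text \<open>exp(i m pi) is real, hence equal to its conjugate. This periodicity matches the boundary
  values of the antiderivatives below.\<close>

lemma cis_of_int_mult_minus_pi: "cis (of_int m * (-pi)) = cis (of_int m * pi)"
proof -
  have "sin (of_int m * pi) = 0" by (auto simp: sin_zero_iff_int2)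
  then show ?thesis by (simp add: complex_eq_iff)
qed

lemma integral_cis_torus:
  "integral\<^sup>L torus (\<lambda>x. cis (of_int m * x)) = (if m = 0 then complex_of_real (2 * pi) else 0)"
proof (cases "m = 0")
  case True
  then show ?thesis using measure_torus by (simp add: scaleR_conv_of_real)
next
  case False
  have "integrable torus (\<lambda>x. cis (of_int m * x))"
    using integrable_mult_cis[of "\<lambda>x. 1" "of_int m"] by simp
  then have "integral\<^sup>L torus (\<lambda>x. cis (of_int m * x)) = integral {-pi..pi} (\<lambda>x. cis (of_int m * x))"
    by (rule lebesgue_integral_eq_integral) simp
  also have "((\<lambda>x. cis (of_int m * x)) has_integral 
     (cis (of_int m * pi) / (\<i> * of_int m) - cis (of_int m * (-pi)) / (\<i> * of_int m))) {-pi..pi}"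
    by (rule fundamental_theorem_of_calculus)
      (use False in \<open>auto intro!: derivative_eq_intros simp: has_vector_derivative_def scaleR_conv_of_real field_simps\<close>)
  then have "integral {-pi..pi} (\<lambda>x. cis (of_int m * x)) = (cis (of_int m * pi) - cis (of_int m * (-pi))) / (\<i> * of_int m)"
    by (simp add: integral_unique diff_divide_distrib)
  also note cis_of_int_mult_minus_pi
  finally show ?thesis using False by simp
qed

text \<open>The sawtooth is computed because its coefficients are, up to the sign (-1)^m in the
  \<open>cis\<close> factor, the kernel i/m of Hilbert's inequality, while the function itself is
  bounded by pi.\<close>

lemma fourier_coeff_x:
  "fourier_coeff (\<lambda>x. complex_of_real x) m = (if m = 0 then 0 else \<i> * cis (of_int m * pi) / of_int m)"
proof -
  have m: "integrable torus (\<lambda>x. complex_of_real x * cis (- of_int m * x))" 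
  proof (rule integrable_mult_cis)
    have "square_integrable complex_of_real"
      by (rule bounded_square_integrable[of _ pi]) (auto intro!: continuous_measurable_torus continuous_intros)
    then show "integrable torus complex_of_real" by (rule square_integrable_imp_integrable)
  qed
  then have "integral\<^sup>L torus (\<lambda>x. complex_of_real x * cis (- of_int m * x)) = integral {-pi..pi} (\<lambda>x. complex_of_real x * cis (- of_int m * x))"
    by (rule lebesgue_integral_eq_integral) simp
  also have "\<dots> = complex_of_real (2 * pi) * (if m = 0 then 0 else \<i> * cis (of_int m * pi) / of_int m)"
  proof (cases "m = 0")
    case True
    have "((\<lambda>x. complex_of_real x) has_integral complex_of_real (pi^2 / 2) - complex_of_real ((-pi)^2/2)) {-pi..pi}"
      by (rule fundamental_theorem_of_calculus)
        (auto intro!: derivative_eq_intros simp: has_vector_derivative_def scaleR_conv_of_real field_simps)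
    then have "integral {-pi..pi} (\<lambda>x. complex_of_real x) = 0" by (simp add: integral_unique)
    then show ?thesis using True by simp
  next
    case False
    \<comment> \<open>An antiderivative found by integration by parts. Its second term takes equal
      values at both ends, so only the first contributes.\<close>
    define F where "F = (\<lambda>x. complex_of_real x * cis (- of_int m * x) * \<i> / of_int m + cis (- of_int m * x) / (of_int m)\<^sup>2)"
    have "((\<lambda>x. complex_of_real x * cis (- of_int m * x)) has_integral (F pi - F (-pi))) {-pi..pi}"
      unfolding F_def
      by (rule fundamental_theorem_of_calculus)
        (use False in \<open>auto intro!: derivative_eq_intros simp: has_vector_derivative_def scaleR_conv_of_real field_simps power2_eq_square\<close>)
    moreover note cis_of_int_mult_minus_pi[of m]
    ultimately show ?thesis using False by (simp add: integral_unique F_def field_simps)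
  qed
  finally show ?thesis unfolding fourier_coeff_alt by (simp add: field_simps)
qed

section \<open>Trigonometric polynomials and Bessel's inequality\<close>

definition trig_poly :: "int set \<Rightarrow> (int \<Rightarrow> complex) \<Rightarrow> real \<Rightarrow> complex" where
  "trig_poly J c x = (\<Sum>j\<in>J. c j * cis (of_int j * x))"

lemma trig_poly_measurable: "trig_poly J c \<in> borel_measurable torus"
  unfolding trig_poly_def by (intro continuous_measurable_torus continuous_intros)

lemma trig_poly_bound: "cmod (trig_poly J c x) \<le> (\<Sum>j\<in>J. cmod (c j))"
  unfolding trig_poly_def by (rule order_trans[OF norm_sum]) (simp add: norm_mult)

lemma square_integrable_trig_poly: "square_integrable (trig_poly J c)"
  by (rule bounded_square_integrable[OF trig_poly_measurable trig_poly_bound])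

text \<open>Multiplication by a character shifts the coefficients by its frequency. The convolution
  formula for two L^2 functions is later obtained from this finite one by approximation.\<close>

lemma fourier_coeff_mult_trig_poly:
  assumes "integrable torus f" "finite J"
  shows "fourier_coeff (\<lambda>x. f x * trig_poly J c x) k = (\<Sum>j\<in>J. fourier_coeff f (k - j) * c j)"
proof -
  have "integral\<^sup>L torus (\<lambda>x. f x * trig_poly J c x * cis (- of_int k * x)) = 
    integral\<^sup>L torus (\<lambda>x. \<Sum>j\<in>J. c j * (f x * cis (- of_int (k - j) * x)))"
    by (rule Bochner_Integration.integral_cong) (auto simp: trig_poly_def sum_distrib_left sum_distrib_right cis_mult algebra_simps intro!: sum.cong)
  also have "\<dots> = (\<Sum>j\<in>J. c j * integral\<^sup>L torus (\<lambda>x. f x * cis (- of_int (k - j) * x)))"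
    using integrable_mult_cis[OF assms(1)] by (subst Bochner_Integration.integral_sum) auto
  finally show ?thesis 
    by (simp only: fourier_coeff_alt) (simp add: sum_distrib_left algebra_simps)
qed

lemma fourier_coeff_1: "fourier_coeff (\<lambda>x. 1) k = (if k = 0 then 1 else 0)"
  using integral_cis_torus[of "-k"] by (simp add: fourier_coeff_alt)

lemma fourier_coeff_trig_poly:
  assumes "finite J"
  shows "fourier_coeff (trig_poly J c) k = (if k \<in> J then c k else 0)"
proof -
  have "fourier_coeff (trig_poly J c) k = (\<Sum>j\<in>J. fourier_coeff (\<lambda>x. 1) (k - j) * c j)"
    using fourier_coeff_mult_trig_poly[of "\<lambda>x. 1" J c k] assms by simp
  also have "\<dots> = (\<Sum>j\<in>J. if j = k then c k else 0)"
    by (rule sum.cong) (auto simp: fourier_coeff_1)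
  finally show ?thesis using assms by simp
qed

text \<open>The conjugate of a trigonometric polynomial is again one, with reflected frequencies, so
  the inner product is the zeroth coefficient of a product.\<close>

lemma integral_mult_cnj_trig_poly:
  assumes "integrable torus f" "finite J"
  shows "integral\<^sup>L torus (\<lambda>x. f x * cnj (trig_poly J c x)) = complex_of_real (2 * pi) * (\<Sum>j\<in>J. fourier_coeff f j * cnj (c j))"
proof -
  have "cnj (trig_poly J c x) = trig_poly (uminus ` J) (\<lambda>j. cnj (c (- j))) x" for x
    by (simp add: trig_poly_def sum.reindex cis_cnj)
  then have "integral\<^sup>L torus (\<lambda>x. f x * cnj (trig_poly J c x)) 
     = complex_of_real (2 * pi) * fourier_coeff (\<lambda>x. f x * trig_poly (uminus ` J) (\<lambda>j. cnj (c (- j))) x) 0"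
    by (simp add: fourier_coeff_alt)
  also have "\<dots> = complex_of_real (2 * pi) * (\<Sum>j\<in>J. fourier_coeff f j * cnj (c j))"
    using assms by (simp add: fourier_coeff_mult_trig_poly sum.reindex)
  finally show ?thesis .
qed

text \<open>Completing the square in \<open>c\<close>. The last sum vanishes for
  \<open>c = fourier_coeff f\<close>, so the partial Fourier sum is the best approximation with
  frequencies in \<open>J\<close>. Bessel, Parseval and the norm of a trigonometric polynomial are
  all read off from this identity.\<close>

lemma integral_norm_diff_trig_poly:
  assumes f: "square_integrable f" "finite J"
  shows "integral\<^sup>L torus (\<lambda>x. (cmod (f x - trig_poly J c x))\<^sup>2) =
    integral\<^sup>L torus (\<lambda>x. (cmod (f x))\<^sup>2) - 2 * pi * (\<Sum>j\<in>J. (cmod (fourier_coeff f j))\<^sup>2)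
     + 2 * pi * (\<Sum>j\<in>J. (cmod (c j - fourier_coeff f j))\<^sup>2)"
proof -
  let ?p = "trig_poly J c"
  have Re_complex_of_real_mult: "Re (complex_of_real a * z) = a * Re z" for a z by simp
  have sq: "- 2 * Re (a * cnj b) + Re (b * cnj b) = (cmod (b - a))\<^sup>2 - (cmod a)\<^sup>2" for a b :: complex
    unfolding cmod_power2 by (simp add: power2_eq_square algebra_simps)
  have sp: "square_integrable ?p" by (rule square_integrable_trig_poly)
  have scp: "square_integrable (\<lambda>x. cnj (?p x))"
    using sp borel_measurable_continuous_on[OF continuous_on_cnj[OF continuous_on_id], of ?p torus] by (auto simp: square_integrable_def)
  have i1: "integrable torus (\<lambda>x. f x * cnj (?p x))"
    using square_integrable_mult[OF f(1) scp] .
  have i2: "integrable torus (\<lambda>x. ?p x * cnj (?p x))"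
    using square_integrable_mult[OF sp scp] .
  have iA: "integrable torus (\<lambda>x. (cmod (f x))\<^sup>2)" using f(1) by (simp add: square_integrable_def)
  have iB: "integrable torus (\<lambda>x. Re (f x * cnj (?p x)))" by (rule integrable_Re[OF i1])
  have iC: "integrable torus (\<lambda>x. Re (?p x * cnj (?p x)))" by (rule integrable_Re[OF i2])
  have e: "(cmod (f x - ?p x))\<^sup>2 = (cmod (f x))\<^sup>2 - 2 * Re (f x * cnj (?p x)) + Re (?p x * cnj (?p x))" for x
    unfolding cmod_power2 by (simp add: power2_eq_square algebra_simps)
  have "integral\<^sup>L torus (\<lambda>x. (cmod (f x - ?p x))\<^sup>2) = 
     integral\<^sup>L torus (\<lambda>x. (cmod (f x))\<^sup>2) - 2 * Re (integral\<^sup>L torus (\<lambda>x. f x * cnj (?p x))) + Re (integral\<^sup>L torus (\<lambda>x. ?p x * cnj (?p x)))"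
    unfolding e integral_Re[OF i1, symmetric] integral_Re[OF i2, symmetric]
    using iA iB iC by (simp del: times_complex.sel)
  also have "integral\<^sup>L torus (\<lambda>x. f x * cnj (?p x)) = complex_of_real (2 * pi) * (\<Sum>j\<in>J. fourier_coeff f j * cnj (c j))"
    using f by (intro integral_mult_cnj_trig_poly square_integrable_imp_integrable)
  also have "integral\<^sup>L torus (\<lambda>x. ?p x * cnj (?p x)) = complex_of_real (2 * pi) * (\<Sum>j\<in>J. fourier_coeff ?p j * cnj (c j))"
    using f sp by (intro integral_mult_cnj_trig_poly square_integrable_imp_integrable)
  also have "(\<Sum>j\<in>J. fourier_coeff ?p j * cnj (c j)) = (\<Sum>j\<in>J. c j * cnj (c j))"
    using f(2) by (intro sum.cong) (auto simp: fourier_coeff_trig_poly)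
  finally have "integral\<^sup>L torus (\<lambda>x. (cmod (f x - ?p x))\<^sup>2) = integral\<^sup>L torus (\<lambda>x. (cmod (f x))\<^sup>2)
     + 2 * pi * (\<Sum>j\<in>J. - 2 * Re (fourier_coeff f j * cnj (c j)) + Re (c j * cnj (c j)))"
    by (simp only: Re_complex_of_real_mult Re_sum sum.distrib sum_distrib_left[symmetric]) (simp add: algebra_simps del: times_complex.sel)
  also have "(\<Sum>j\<in>J. - 2 * Re (fourier_coeff f j * cnj (c j)) + Re (c j * cnj (c j))) = 
     (\<Sum>j\<in>J. (cmod (c j - fourier_coeff f j))\<^sup>2 - (cmod (fourier_coeff f j))\<^sup>2)"
    by (simp only: sq)
  finally show ?thesis by (simp add: sum_subtractf algebra_simps)
qed

lemma bessel_inequality: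
  assumes f: "square_integrable f" "finite J"
  shows "2 * pi * (\<Sum>j\<in>J. (cmod (fourier_coeff f j))\<^sup>2) \<le> integral\<^sup>L torus (\<lambda>x. (cmod (f x))\<^sup>2)"
proof -
  have "0 \<le> integral\<^sup>L torus (\<lambda>x. (cmod (f x - trig_poly J (fourier_coeff f) x))\<^sup>2)" by simp
  then show ?thesis unfolding integral_norm_diff_trig_poly[OF assms] by simp
qed

section \<open>Completeness of the trigonometric system\<close>

definition is_trig :: "(real \<Rightarrow> complex) \<Rightarrow> bool" where
  "is_trig F \<longleftrightarrow> (\<exists>J c. finite J \<and> F = trig_poly J c)"

lemma is_trig_const: "is_trig (\<lambda>x. a)"
  unfolding is_trig_def by (intro exI[of _ "{0}"] exI[of _ "\<lambda>_. a"]) (auto simp: trig_poly_def fun_eq_iff)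

lemma is_trig_add:
  assumes "is_trig F" "is_trig G" shows "is_trig (\<lambda>x. F x + G x)"
proof -
  obtain J c K d where *: "finite J" "F = trig_poly J c" "finite K" "G = trig_poly K d"
    using assms unfolding is_trig_def by blast
  have "F x + G x = trig_poly (J \<union> K) (\<lambda>j. (if j \<in> J then c j else 0) + (if j \<in> K then d j else 0)) x" for x
  proof -
    have "F x = (\<Sum>j\<in>J \<union> K. (if j \<in> J then c j else 0) * cis (of_int j * x))"
      unfolding * trig_poly_def by (rule sum.mono_neutral_cong_left) (use * in auto)
    moreover have "G x = (\<Sum>j\<in>J \<union> K. (if j \<in> K then d j else 0) * cis (of_int j * x))"
      unfolding * trig_poly_def by (rule sum.mono_neutral_cong_left) (use * in auto)
    ultimately show ?thesis by (simp only: trig_poly_def sum.distrib[symmetric] distrib_right)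
  qed
  then show ?thesis using * unfolding is_trig_def by blast
qed

lemma is_trig_mult_cis:
  assumes "is_trig F" shows "is_trig (\<lambda>x. a * cis (of_int m * x) * F x)"
proof -
  obtain J c where *: "finite J" "F = trig_poly J c"
    using assms unfolding is_trig_def by blast
  have "a * cis (of_int m * x) * F x = trig_poly ((+) m ` J) (\<lambda>j. a * c (j - m)) x" for x
    by (auto simp: * trig_poly_def sum.reindex sum_distrib_left cis_mult algebra_simps intro!: sum.cong)
  then show ?thesis using * unfolding is_trig_def by blast
qed

lemma is_trig_mult:
  assumes "is_trig F" "is_trig G" shows "is_trig (\<lambda>x. F x * G x)"
proof -
  obtain J c where *: "finite J" "F = trig_poly J c"
    using assms unfolding is_trig_def by blast
  have "is_trig (\<lambda>x. trig_poly J c x * G x)" using *(1)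
  proof (induction J)
    case empty
    then show ?case using is_trig_const[of 0] by (simp add: trig_poly_def)
  next
    case (insert j J)
    have "is_trig (\<lambda>x. c j * cis (of_int j * x) * G x + trig_poly J c x * G x)"
      by (intro is_trig_add is_trig_mult_cis insert.IH assms)
    then show ?case using insert.hyps by (simp add: trig_poly_def distrib_right)
  qed
  then show ?thesis using * by simp
qed

text \<open>A real-linear function of \<open>cis x\<close> is a combination of cos and sin, hence of
  the characters with frequencies 1 and -1; sums and products follow by closure.\<close>

lemma is_trig_real_polynomial:
  assumes "real_polynomial_function q"
  shows "is_trig (\<lambda>x. complex_of_real (q (cis x)))"
  using assms
proof (induction rule: real_polynomial_function.induct)
  case (linear f)
  \<comment> \<open>The trailing factors 1 give both summands the shape
    \<open>a * cis (of_int m * x) * F x\<close> with constant \<open>F\<close>, as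
    \<open>is_trig_mult_cis\<close> requires.\<close>
  have e: "complex_of_real (f (cis x)) = 
     (of_real (f 1) / 2 + of_real (f \<i>) / (2 * \<i>)) * cis (of_int 1 * x) * 1
     + (of_real (f 1) / 2 - of_real (f \<i>) / (2 * \<i>)) * cis (of_int (-1) * x) * 1" for x
  proof -
    have "cis x = cos x *\<^sub>R 1 + sin x *\<^sub>R \<i>" by (simp add: complex_eq_iff)
    then have "f (cis x) = cos x * f 1 + sin x * f \<i>"
      using linear by (simp add: bounded_linear.linear linear_add linear_scale)
    then show ?thesis by (simp add: complex_eq_iff field_simps)
  qed
  show ?case unfolding e by (intro is_trig_add is_trig_mult_cis is_trig_const)
next
  case (const c) then show ?case by (rule is_trig_const)
next
  case (add f g) then show ?case by (simp add: is_trig_add)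
next
  case (mult f g) then show ?case by (simp add: is_trig_mult)
qed

lemma is_trig_polynomial:
  fixes q :: "complex \<Rightarrow> complex"
  assumes "polynomial_function q"
  shows "is_trig (\<lambda>x. q (cis x))"
proof -
  have "is_trig (\<lambda>x. complex_of_real ((Re \<circ> q) (cis x)) + \<i> * complex_of_real ((Im \<circ> q) (cis x)))"
    using assms bounded_linear_Re bounded_linear_Im unfolding polynomial_function_def
    by (intro is_trig_add is_trig_mult is_trig_const is_trig_real_polynomial) blast+
  then show ?thesis by (simp add: complex_eq[symmetric])
qed

section \<open>Density of the trigonometric polynomials in L^2\<close>

text \<open>Square integrability is part of the predicate because a non-integrable function has
  integral 0, which would satisfy the approximation condition by default.\<close>

definition trig_approx :: "(real \<Rightarrow> complex) \<Rightarrow> bool" where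
  "trig_approx f \<longleftrightarrow> square_integrable f \<and>
    (\<forall>e>0. \<exists>J c. finite J \<and> integral\<^sup>L torus (\<lambda>x. (cmod (f x - trig_poly J c x))\<^sup>2) < e)"

lemma trig_approx_closed:
  assumes f: "square_integrable f"
    and ex: "\<And>e. e > 0 \<Longrightarrow> \<exists>g. trig_approx g \<and> integral\<^sup>L torus (\<lambda>x. (cmod (f x - g x))\<^sup>2) < e"
  shows "trig_approx f"
  unfolding trig_approx_def
proof (intro conjI allI impI f)
  fix e :: real assume "e > 0"
  \<comment> \<open>Quarters suffice since |a + b|^2 \<le> 2 |a|^2 + 2 |b|^2.\<close>
  then obtain g where g: "trig_approx g" "integral\<^sup>L torus (\<lambda>x. (cmod (f x - g x))\<^sup>2) < e / 4"
    using ex[of "e/4"] by auto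
  then obtain J c where J: "finite J" "integral\<^sup>L torus (\<lambda>x. (cmod (g x - trig_poly J c x))\<^sup>2) < e / 4"
    using \<open>e > 0\<close> unfolding trig_approx_def by (metis zero_less_divide_iff zero_less_numeral)
  have i1: "integrable torus (\<lambda>x. (cmod (f x - g x))\<^sup>2)"
    using square_integrable_diff[OF f, of g] g by (simp add: square_integrable_def trig_approx_def)
  have i2: "integrable torus (\<lambda>x. (cmod (g x - trig_poly J c x))\<^sup>2)"
    using square_integrable_diff[OF _ square_integrable_trig_poly, of g J c] g by (simp add: square_integrable_def trig_approx_def)
  have i3: "integrable torus (\<lambda>x. (cmod (f x - trig_poly J c x))\<^sup>2)"
    using square_integrable_diff[OF f square_integrable_trig_poly, of J c] by (simp add: square_integrable_def)
  have "integral\<^sup>L torus (\<lambda>x. (cmod (f x - trig_poly J c x))\<^sup>2) \<le>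
    integral\<^sup>L torus (\<lambda>x. 2 * (cmod (f x - g x))\<^sup>2 + 2 * (cmod (g x - trig_poly J c x))\<^sup>2)"
  proof (rule integral_mono[OF i3])
    show "integrable torus (\<lambda>x. 2 * (cmod (f x - g x))\<^sup>2 + 2 * (cmod (g x - trig_poly J c x))\<^sup>2)"
      using i1 i2 by simp
    fix x
    let ?a = "f x - g x" and ?b = "g x - trig_poly J c x"
    have "(cmod (?a + ?b))\<^sup>2 \<le> (cmod ?a + cmod ?b)\<^sup>2"
      by (intro power_mono norm_triangle_ineq) simp
    also have "\<dots> \<le> 2 * (cmod ?a)\<^sup>2 + 2 * (cmod ?b)\<^sup>2"
      using sum_squares_bound[of "cmod ?a" "cmod ?b"] by (simp add: power2_sum)
    finally show "(cmod (f x - trig_poly J c x))\<^sup>2 \<le> 2 * (cmod ?a)\<^sup>2 + 2 * (cmod ?b)\<^sup>2" by simp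
  qed
  also have "\<dots> < e" using i1 i2 g(2) J(2) by simp
  finally show "\<exists>J c. finite J \<and> integral\<^sup>L torus (\<lambda>x. (cmod (f x - trig_poly J c x))\<^sup>2) < e"
    using J(1) by blast
qed

text \<open>Dominated convergence turns convergence almost everywhere into convergence in L^2. It is
  applied with a constant majorant to bounded functions and with |f|^2 to truncations.\<close>

lemma trig_approx_limit:
  assumes f: "square_integrable f" and g: "\<And>n. trig_approx (g n)"
    and lim: "AE x in torus. (\<lambda>n. g n x) \<longlonglongrightarrow> f x"
    and w: "integrable torus w" "\<And>n x. x \<in> {-pi..pi} \<Longrightarrow> (cmod (f x - g n x))\<^sup>2 \<le> w x"
  shows "trig_approx f"
proof (rule trig_approx_closed[OF f])
  fix e :: real assume "e > 0"
  have "(\<lambda>n. integral\<^sup>L torus (\<lambda>x. (cmod (f x - g n x))\<^sup>2)) \<longlonglongrightarrow> integral\<^sup>L torus (\<lambda>x. 0)"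
  proof (rule integral_dominated_convergence[where w = w])
    show "(\<lambda>x. (cmod (f x - g n x))\<^sup>2) \<in> borel_measurable torus" for n
      using square_integrable_diff[OF f, of "g n"] g[of n] borel_measurable_integrable
      unfolding square_integrable_def trig_approx_def by blast
    show "AE x in torus. (\<lambda>n. (cmod (f x - g n x))\<^sup>2) \<longlonglongrightarrow> 0"
      using lim
    proof eventually_elim
      case (elim x)
      have "(\<lambda>n. (cmod (f x - g n x))\<^sup>2) \<longlonglongrightarrow> (cmod (f x - f x))\<^sup>2"
        by (intro tendsto_intros elim)
      then show ?case by simp
    qed
    show "AE x in torus. norm ((cmod (f x - g n x))\<^sup>2) \<le> w x" for n
      using w(2) by (intro AE_I2) auto
  qed (use w in auto)
  then have "(\<lambda>n. integral\<^sup>L torus (\<lambda>x. (cmod (f x - g n x))\<^sup>2)) \<longlonglongrightarrow> 0" by simp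
  from order_tendstoD(2)[OF this \<open>e > 0\<close>]
  obtain n where "integral\<^sup>L torus (\<lambda>x. (cmod (f x - g n x))\<^sup>2) < e"
    by (auto simp: eventually_sequentially)
  then show "\<exists>g. trig_approx g \<and> integral\<^sup>L torus (\<lambda>x. (cmod (f x - g x))\<^sup>2) < e"
    using g by blast
qed

text \<open>The cutoff vanishes at $\pm\pi$, so the function factors continuously through the circle.\<close>

lemma continuous_on_circle_cutoff:
  fixes g :: "real \<Rightarrow> complex"
  assumes g: "continuous_on UNIV g" "\<And>x. cmod (g x) \<le> B"
  shows "continuous_on (sphere 0 1) (\<lambda>z. g (Arg z) * complex_of_real (min 1 (n * (1 + Re z))))"
proof (rule continuous_at_imp_continuous_on, rule ballI)
  fix z :: complex assume z: "z \<in> sphere 0 1"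
  let ?p = "\<lambda>z. complex_of_real (min 1 (n * (1 + Re z)))"
  show "isCont (\<lambda>z. g (Arg z) * ?p z) z"
  proof (cases "z \<in> \<real>\<^sub>\<le>\<^sub>0")
    case False
    then have "isCont (\<lambda>z. g (Arg z)) z"
      using g(1) continuous_at_Arg[OF False]
      by (intro isCont_o2[of z Arg g]) (auto simp: continuous_on_eq_continuous_at)
    then show ?thesis by (intro continuous_intros bounded_linear.isCont[OF bounded_linear_Re])
  next
    case True
    \<comment> \<open>The branch cut meets the circle only here. \<open>Arg\<close> jumps, but
      \<open>g\<close> is bounded and the cutoff tends to 0.\<close>
    then have "z = -1" using z by (auto simp: complex_eq_iff complex_nonpos_Reals_iff cmod_eq_Re)
    have "((\<lambda>z. ?p z * g (Arg z)) \<longlongrightarrow> 0) (at z)"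
    proof (rule Lim_null_comparison)
      show "\<forall>\<^sub>F x in at z. cmod (?p x * g (Arg x)) \<le> cmod (?p x) * B"
        using g(2) by (auto simp: norm_mult intro!: mult_left_mono always_eventually)
      have "isCont (\<lambda>x. cmod (?p x) * B) z" by (intro continuous_intros bounded_linear.isCont[OF bounded_linear_Re])
      then show "((\<lambda>x. cmod (?p x) * B) \<longlongrightarrow> 0) (at z)"
        using \<open>z = -1\<close> by (simp add: isCont_def)
    qed
    then show ?thesis using \<open>z = -1\<close> by (simp add: isCont_def mult.commute)
  qed
qed

text \<open>Stone-Weierstrass on the circle gives uniform approximation by polynomials in
  \<open>cis x\<close>, which are trigonometric polynomials; on a space of finite measure this is
  stronger than approximation in L^2.\<close>

lemma trig_approx_cutoff:
  fixes g :: "real \<Rightarrow> complex"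
  assumes g: "continuous_on UNIV g" "\<And>x. cmod (g x) \<le> B"
  shows "trig_approx (\<lambda>x. g x * complex_of_real (min 1 (n * (1 + cos x))))"
proof -
  let ?h = "\<lambda>z. g (Arg z) * complex_of_real (min 1 (n * (1 + Re z)))"
  let ?f = "\<lambda>x. g x * complex_of_real (min 1 (n * (1 + cos x)))"
  have h: "?h (cis x) = ?f x" if "x \<in> {-pi..pi}" for x
  \<comment> \<open>At -pi the principal argument of \<open>cis x\<close> is pi instead of
    \<open>x\<close>, but the cutoff makes both sides zero.\<close>
  proof (cases "x = -pi")
    case False
    then have "Arg (cis x) = x" using that by (intro Arg_cis) auto
    then show ?thesis by simp
  qed simp
  have m: "?f \<in> borel_measurable torus"
    by (intro continuous_measurable_torus continuous_intros continuous_on_subset[OF g(1)]) auto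
  have bdd: "\<exists>q. is_trig q \<and> (\<forall>x\<in>{-pi..pi}. cmod (?f x - q x) < e)" if "e > 0" for e
  proof -
    obtain q where q: "polynomial_function q" "\<forall>z\<in>sphere 0 1. cmod (?h z - q z) < e"
      using Stone_Weierstrass_polynomial_function[OF _ continuous_on_circle_cutoff[OF g] \<open>e > 0\<close>, of n] by auto
    have "\<forall>x\<in>{-pi..pi}. cmod (?f x - q (cis x)) < e"
    proof
      fix x assume x: "x \<in> {-pi..pi}"
      have "cis x \<in> sphere 0 1" by simp
      with q(2) have "cmod (?h (cis x) - q (cis x)) < e" by (rule bspec)
      then show "cmod (?f x - q (cis x)) < e" unfolding h[OF x] .
    qed
    then show ?thesis using is_trig_polynomial[OF q(1)] by blast
  qed
  have sf: "square_integrable ?f"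
  proof -
    obtain q where q: "is_trig q" "\<forall>x\<in>{-pi..pi}. cmod (?f x - q x) < 1" using bdd[of 1] by auto
    then obtain J c where J: "finite J" "q = trig_poly J c" unfolding is_trig_def by blast
    have "square_integrable (\<lambda>x. ?f x - q x)"
      using q(2) m trig_poly_measurable[of J c] unfolding J
      by (intro bounded_square_integrable[of _ 1] borel_measurable_diff) (auto intro: less_imp_le)
    from square_integrable_add[OF this, of q] show ?thesis using J square_integrable_trig_poly by simp
  qed
  show ?thesis unfolding trig_approx_def
  proof (intro conjI sf allI impI)
    fix e :: real assume "e > 0"
    \<comment> \<open>A uniform error \<open>d\<close> on a torus of measure 2 pi contributes 2 pi
      d^2 = e/2.\<close>
    define d where "d = sqrt (e / (4 * pi))"
    have d: "d > 0" "d\<^sup>2 = e / (4 * pi)" using \<open>e > 0\<close> by (auto simp: d_def)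
    obtain J c where J: "finite J" "\<forall>x\<in>{-pi..pi}. cmod (?f x - trig_poly J c x) < d" 
      using bdd[OF d(1)] unfolding is_trig_def by blast
    have "integral\<^sup>L torus (\<lambda>x. (cmod (?f x - trig_poly J c x))\<^sup>2) \<le> integral\<^sup>L torus (\<lambda>x. d\<^sup>2)"
    proof (rule integral_mono)
      show "integrable torus (\<lambda>x. (cmod (?f x - trig_poly J c x))\<^sup>2)"
        using square_integrable_diff[OF sf square_integrable_trig_poly, of J c] by (simp add: square_integrable_def)
      show "(cmod (?f x - trig_poly J c x))\<^sup>2 \<le> d\<^sup>2" if "x \<in> space torus" for x
        using J(2) that by (intro power_mono) (auto intro: less_imp_le)
    qed simp
    also have "\<dots> = e / 2" using measure_torus d(2) by simp
    also have "\<dots> < e" using \<open>e > 0\<close> by simp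
    finally show "\<exists>J c. finite J \<and> integral\<^sup>L torus (\<lambda>x. (cmod (?f x - trig_poly J c x))\<^sup>2) < e"
      using J(1) by blast
  qed
qed

text \<open>A measurable function is almost everywhere a limit of continuous ones. Clipping restores
  the bound \<open>B\<close>, and a cutoff that widens with n enforces periodicity without
  disturbing the limit in the open interval.\<close>

lemma trig_approx_bounded:
  fixes f :: "real \<Rightarrow> complex"
  assumes f: "f \<in> borel_measurable torus" "\<And>x. cmod (f x) \<le> B" and B: "B > 0"
  shows "trig_approx f"
proof -
  have "f measurable_on {-pi..pi}"
    using f(1) by (subst measurable_on_iff_borel_measurable) auto
  then obtain N g where N: "negligible N" and g: "\<And>n::nat. continuous_on UNIV (g n)"
    and lim: "\<And>x. x \<notin> N \<Longrightarrow> (\<lambda>n. g n x) \<longlonglongrightarrow> (if x \<in> {-pi..pi} then f x else 0)"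
    unfolding measurable_on_def by blast
  \<comment> \<open>The radial retraction onto the disc of radius \<open>B\<close>: continuous, and
    the identity on the values of \<open>f\<close>.\<close>
  define clip :: "complex \<Rightarrow> complex" where "clip = (\<lambda>z. z / complex_of_real (max 1 (cmod z / B)))"
  have clip_c: "isCont clip z" for z
    unfolding clip_def using B by (intro continuous_intros) auto
  have clip_b: "cmod (clip z) \<le> B" for z
    using B by (auto simp: clip_def norm_divide max_def divide_simps)
  have clip_id: "clip z = z" if "cmod z \<le> B" for z
  proof -
    have "cmod z / B \<le> 1" using that B by simp
    then show ?thesis by (simp add: clip_def max_def)
  qed
  define h where "h = (\<lambda>n::nat. \<lambda>x. clip (g n x) * complex_of_real (min 1 (real n * (1 + cos x))))"
  have hb: "cmod (h n x) \<le> B" for n x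
  proof -
    have "0 \<le> 1 + cos x" using cos_ge_minus_one[of x] by linarith
    then have "0 \<le> real n * (1 + cos x)" by (rule mult_nonneg_nonneg[OF of_nat_0_le_iff])
    then have "cmod (complex_of_real (min 1 (real n * (1 + cos x)))) \<le> 1" by (simp only: norm_of_real)
    then have "cmod (h n x) \<le> B * 1" unfolding h_def norm_mult using clip_b B by (intro mult_mono) auto
    then show ?thesis by simp
  qed
  show ?thesis
  proof (rule trig_approx_limit[of f h "\<lambda>_. (B + B)\<^sup>2"])
    show "square_integrable f" using f by (intro bounded_square_integrable[of _ B]) auto
    show "trig_approx (h n)" for n
      unfolding h_def
    proof (rule trig_approx_cutoff[of _ B])
      show "continuous_on UNIV (\<lambda>x. clip (g n x))"
        by (rule continuous_on_compose2[OF _ g subset_UNIV])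
          (simp add: clip_c continuous_at_imp_continuous_on)
    qed (rule clip_b)
    show "(cmod (f x - h n x))\<^sup>2 \<le> (B + B)\<^sup>2" for n x
      by (intro power_mono order_trans[OF norm_triangle_ineq4] add_mono f hb) auto
    show "AE x in torus. (\<lambda>n. h n x) \<longlonglongrightarrow> f x"
    proof -
      \<comment> \<open>The endpoints, where the cutoff is 0 for every n, are absorbed into the null
        set.\<close>
      have null: "N \<union> {-pi, pi} \<in> null_sets lebesgue"
        using N by (metis negligible_iff_null_sets negligible_Un negligible_finite finite.emptyI finite_insert)
      have "(\<lambda>n. h n x) \<longlonglongrightarrow> f x" if x: "x \<in> {-pi..pi}" "x \<notin> N \<union> {-pi, pi}" for x
      proof -
        have "(\<lambda>n. clip (g n x)) \<longlonglongrightarrow> clip (f x)"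
          using lim[of x] x by (intro isCont_tendsto_compose[OF clip_c]) auto
        then have 1: "(\<lambda>n. clip (g n x)) \<longlonglongrightarrow> f x" using clip_id f(2) by simp
        have "cos x > -1" 
          using x cos_monotone_0_pi[of "\<bar>x\<bar>" pi] by auto
        then have pos: "1 + cos x > 0" by simp
        then obtain m where m: "real m * (1 + cos x) > 1" using reals_Archimedean3 by blast
        have "\<forall>\<^sub>F n in sequentially. 1 = min 1 (real n * (1 + cos x))"
          unfolding eventually_sequentially
        proof (intro exI[of _ m] allI impI)
          fix n assume "m \<le> n"
          then have "real m * (1 + cos x) \<le> real n * (1 + cos x)" using pos by (intro mult_right_mono) auto
          then show "1 = min 1 (real n * (1 + cos x))" using m by simp
        qed
        then have "(\<lambda>n. min 1 (real n * (1 + cos x))) \<longlonglongrightarrow> 1" by (rule tendsto_eventually[OF eventually_mono]) simp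
        from tendsto_mult[OF 1 tendsto_of_real[OF this]] show ?thesis by (simp add: h_def)
      qed
      then have "AE x in lebesgue. x \<in> {-pi..pi} \<longrightarrow> (\<lambda>n. h n x) \<longlonglongrightarrow> f x"
        by (intro AE_I'[OF null]) blast
      then show ?thesis by (subst AE_restrict_space_iff) auto
    qed
  qed simp
qed

lemma square_integrable_imp_trig_approx:
  assumes f: "square_integrable f"
  shows "trig_approx f"
proof (rule trig_approx_limit[of f "\<lambda>n x. if cmod (f x) \<le> real n then f x else 0" "\<lambda>x. (cmod (f x))\<^sup>2"])
  have m: "f \<in> borel_measurable torus" using f by (simp add: square_integrable_def)
  show "trig_approx (\<lambda>x. if cmod (f x) \<le> real n then f x else 0)" for n
    \<comment> \<open>The summand 1 keeps the bound positive for n = 0.\<close>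
    by (rule trig_approx_bounded[where B = "real n + 1"]) (use m in auto)
  show "AE x in torus. (\<lambda>n. if cmod (f x) \<le> real n then f x else 0) \<longlonglongrightarrow> f x"
  proof (rule AE_I2)
    fix x
    obtain m where "cmod (f x) \<le> real m" using real_arch_simple by blast
    then have "\<forall>\<^sub>F n in sequentially. (if cmod (f x) \<le> real n then f x else 0) = f x"
      unfolding eventually_sequentially by (intro exI[of _ m]) auto
    then show "(\<lambda>n. if cmod (f x) \<le> real n then f x else 0) \<longlonglongrightarrow> f x" by (rule tendsto_eventually)
  qed
qed (use f in \<open>auto simp: square_integrable_def\<close>)

section \<open>Parseval and the convolution formula\<close>

text \<open>Enlarging the frequency set only improves the best approximation. The uniformity over
  all finite \<open>K\<close> above \<open>J\<close> is convergence along the filter that underlies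
  \<open>has_sum\<close>.\<close>

lemma parseval_approx:
  assumes f: "square_integrable f" and e: "e > 0"
  shows "\<exists>J. finite J \<and>
    (\<forall>K. finite K \<and> J \<subseteq> K \<longrightarrow> integral\<^sup>L torus (\<lambda>x. (cmod (f x - trig_poly K (fourier_coeff f) x))\<^sup>2) < e)"
proof -
  obtain J c where J: "finite J" "integral\<^sup>L torus (\<lambda>x. (cmod (f x - trig_poly J c x))\<^sup>2) < e"
    using square_integrable_imp_trig_approx[OF f] e unfolding trig_approx_def by blast
  have "integral\<^sup>L torus (\<lambda>x. (cmod (f x - trig_poly K (fourier_coeff f) x))\<^sup>2) < e" if K: "finite K" "J \<subseteq> K" for K
  proof -
    have "(\<Sum>j\<in>J. (cmod (fourier_coeff f j))\<^sup>2) \<le> (\<Sum>j\<in>K. (cmod (fourier_coeff f j))\<^sup>2)"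
      using K by (intro sum_mono2) auto
    then have "2 * pi * (\<Sum>j\<in>J. (cmod (fourier_coeff f j))\<^sup>2) \<le> 2 * pi * (\<Sum>j\<in>K. (cmod (fourier_coeff f j))\<^sup>2)"
      by (intro mult_left_mono) auto
    moreover have "0 \<le> 2 * pi * (\<Sum>j\<in>J. (cmod (c j - fourier_coeff f j))\<^sup>2)" by (intro mult_nonneg_nonneg sum_nonneg) auto
    moreover have "2 * pi * (\<Sum>j\<in>K. (cmod (fourier_coeff f j - fourier_coeff f j))\<^sup>2) = 0" by simp
    ultimately show ?thesis
      using J(2) unfolding integral_norm_diff_trig_poly[OF f J(1)] integral_norm_diff_trig_poly[OF f K(1)]
      by linarith
  qed
  then show ?thesis using J(1) by (intro exI[of _ J]) simp
qed

text \<open>This is the half of Parseval that needs completeness; the other half is Bessel's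
  inequality.\<close>

lemma parseval_le:
  assumes f: "square_integrable f" and M: "\<And>J. finite J \<Longrightarrow> (\<Sum>j\<in>J. (cmod (fourier_coeff f j))\<^sup>2) \<le> M"
  shows "integral\<^sup>L torus (\<lambda>x. (cmod (f x))\<^sup>2) \<le> 2 * pi * M"
proof (rule field_le_epsilon)
  fix e :: real assume "e > 0"
  obtain J where J: "finite J" "integral\<^sup>L torus (\<lambda>x. (cmod (f x - trig_poly J (fourier_coeff f) x))\<^sup>2) < e"
    using parseval_approx[OF f \<open>e > 0\<close>] by (metis order_refl)
  have "2 * pi * (\<Sum>j\<in>J. (cmod (fourier_coeff f j))\<^sup>2) \<le> 2 * pi * M"
    by (intro mult_left_mono M J) auto
  moreover have "2 * pi * (\<Sum>j\<in>J. (cmod (fourier_coeff f j - fourier_coeff f j))\<^sup>2) = 0" by simp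
  ultimately show "integral\<^sup>L torus (\<lambda>x. (cmod (f x))\<^sup>2) \<le> 2 * pi * M + e"
    using J(2) unfolding integral_norm_diff_trig_poly[OF f J(1)] by linarith
qed

lemma norm_fourier_coeff_le:
  assumes "integrable torus f"
  shows "cmod (fourier_coeff f k) \<le> integral\<^sup>L torus (\<lambda>x. cmod (f x)) / (2 * pi)"
proof -
  have "cmod (integral\<^sup>L torus (\<lambda>x. f x * cis (- of_int k * x))) \<le> integral\<^sup>L torus (\<lambda>x. cmod (f x * cis (- of_int k * x)))"
    by (rule integral_norm_bound)
  then show ?thesis unfolding fourier_coeff_alt by (simp add: norm_mult norm_divide field_simps)
qed

text \<open>Replacing \<open>f\<close> by a partial Fourier sum makes the convolution finite, and
  the error in the product is small in L^1, which bounds every coefficient.\<close>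

lemma fourier_coeff_mult_has_sum:
  assumes f: "square_integrable f" and g: "square_integrable g"
  shows "((\<lambda>j. fourier_coeff g (k - j) * fourier_coeff f j) has_sum fourier_coeff (\<lambda>x. g x * f x) k) UNIV"
  unfolding has_sum_def tendsto_iff eventually_finite_subsets_at_top
proof (intro allI impI)
  fix e :: real assume e: "e > 0"
  define G where "G = integral\<^sup>L torus (\<lambda>x. (cmod (g x))\<^sup>2)"
  have G: "G \<ge> 0" by (simp add: G_def)
  \<comment> \<open>The parameter of the weighted inequality |a b| \<le> d |a|^2 + |b|^2 / d. The
    first part integrates to at most \<open>e\<close>; the second stays below \<open>e\<close>
    because the approximation is taken to accuracy \<open>d * e\<close>. The 1 in the denominator
    covers G = 0.\<close>
  define d where "d = e / (G + 1)"
  have d: "d > 0" "d * G \<le> e" using e G by (auto simp: d_def field_simps)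
  have "d * e > 0" using d e by simp
  then obtain J where J: "finite J" 
    "\<forall>K. finite K \<and> J \<subseteq> K \<longrightarrow> integral\<^sup>L torus (\<lambda>x. (cmod (f x - trig_poly K (fourier_coeff f) x))\<^sup>2) < d * e"
    using parseval_approx[OF f] by blast
  have "dist (\<Sum>j\<in>K. fourier_coeff g (k - j) * fourier_coeff f j) (fourier_coeff (\<lambda>x. g x * f x) k) < e"
    if K: "finite K" "J \<subseteq> K" for K
  proof -
    let ?p = "trig_poly K (fourier_coeff f)"
    have sd: "square_integrable (\<lambda>x. f x - ?p x)" 
      by (rule square_integrable_diff[OF f square_integrable_trig_poly])
    have id: "integrable torus (\<lambda>x. g x * (f x - ?p x))" by (rule square_integrable_mult[OF g sd])
    have "fourier_coeff (\<lambda>x. g x * f x) k - (\<Sum>j\<in>K. fourier_coeff g (k - j) * fourier_coeff f j)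
      = fourier_coeff (\<lambda>x. g x * f x) k - fourier_coeff (\<lambda>x. g x * ?p x) k"
      using fourier_coeff_mult_trig_poly[OF square_integrable_imp_integrable[OF g] K(1)] by simp
    also have "\<dots> = fourier_coeff (\<lambda>x. g x * (f x - ?p x)) k"
      using fourier_coeff_lincomb[OF square_integrable_mult[OF g f] square_integrable_mult[OF g square_integrable_trig_poly], of 1 "-1" K "fourier_coeff f" k]
      by (simp add: algebra_simps)
    finally have eq: "fourier_coeff (\<lambda>x. g x * f x) k - (\<Sum>j\<in>K. fourier_coeff g (k - j) * fourier_coeff f j)
      = fourier_coeff (\<lambda>x. g x * (f x - ?p x)) k" .
    have ig: "integrable torus (\<lambda>x. (cmod (g x))\<^sup>2)" using g by (simp add: square_integrable_def)
    have ip: "integrable torus (\<lambda>x. (cmod (f x - ?p x))\<^sup>2)" using sd by (simp add: square_integrable_def)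
    have "integral\<^sup>L torus (\<lambda>x. cmod (g x * (f x - ?p x))) \<le> 
      integral\<^sup>L torus (\<lambda>x. d * (cmod (g x))\<^sup>2 + (cmod (f x - ?p x))\<^sup>2 / d)"
    proof (rule integral_mono)
      show "integrable torus (\<lambda>x. cmod (g x * (f x - ?p x)))" by (rule integrable_norm[OF id])
      show "integrable torus (\<lambda>x. d * (cmod (g x))\<^sup>2 + (cmod (f x - ?p x))\<^sup>2 / d)" using ig ip by simp
      fix x
      let ?a = "cmod (g x)" and ?b = "cmod (f x - ?p x)"
      have "2 * (d * ?a) * ?b \<le> (d * ?a)\<^sup>2 + ?b\<^sup>2" by (rule sum_squares_bound)
      moreover have "0 \<le> (d * ?a) * ?b" using d by simp
      ultimately have "(d * ?a) * ?b \<le> (d * ?a)\<^sup>2 + ?b\<^sup>2" by linarith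
      also have "(d * ?a)\<^sup>2 + ?b\<^sup>2 = d * (d * ?a\<^sup>2 + ?b\<^sup>2 / d)"
        using d by (simp add: power2_eq_square distrib_left)
      finally have "d * (?a * ?b) \<le> d * (d * ?a\<^sup>2 + ?b\<^sup>2 / d)" by (simp only: mult.assoc)
      then show "cmod (g x * (f x - ?p x)) \<le> d * ?a\<^sup>2 + ?b\<^sup>2 / d" using d(1) unfolding norm_mult by (simp only: mult_le_cancel_left_pos)
    qed
    also have "\<dots> = d * G + integral\<^sup>L torus (\<lambda>x. (cmod (f x - ?p x))\<^sup>2) / d"
      using ig ip by (simp add: G_def)
    also have "integral\<^sup>L torus (\<lambda>x. (cmod (f x - ?p x))\<^sup>2) / d < e" using J(2) K d(1) by (simp add: divide_less_eq mult.commute)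
    finally have "integral\<^sup>L torus (\<lambda>x. cmod (g x * (f x - ?p x))) < 2 * e" using d(2) by simp
    then have "integral\<^sup>L torus (\<lambda>x. cmod (g x * (f x - ?p x))) / (2 * pi) < e" 
    proof -
      assume a: "integral\<^sup>L torus (\<lambda>x. cmod (g x * (f x - ?p x))) < 2 * e"
      have "1 * (2 * e) < pi * (2 * e)" using e pi_gt3 by (intro mult_strict_right_mono) auto
      with a show ?thesis by (simp add: divide_simps mult_ac)
    qed
    then have "cmod (fourier_coeff (\<lambda>x. g x * (f x - ?p x)) k) < e"
      using norm_fourier_coeff_le[OF id, of k] by simp
    then show ?thesis unfolding eq[symmetric] by (simp add: dist_norm norm_minus_commute)
  qed
  then show "\<exists>X. finite X \<and> X \<subseteq> UNIV \<and> (\<forall>Y. finite Y \<and> X \<subseteq> Y \<and> Y \<subseteq> UNIV \<longrightarrow>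
         dist (\<Sum>j\<in>Y. fourier_coeff g (k - j) * fourier_coeff f j) (fourier_coeff (\<lambda>x. g x * f x) k) < e)"
    using J(1) by (intro exI[of _ J]) auto
qed

section \<open>Weighted sequence spaces and multipliers\<close>

definition wt :: "int \<Rightarrow> real" where "wt k = 1 + \<bar>of_int k\<bar>"

lemma wt_ge_1: "1 \<le> wt k" and wt_pos: "0 < wt k" and wt_nonneg: "0 \<le> wt k"
  by (simp_all add: wt_def)

lemma wt_submult: "wt k \<le> wt (k - j) * wt j"
proof -
  have "\<bar>real_of_int k\<bar> \<le> \<bar>of_int (k - j)\<bar> + \<bar>of_int j\<bar>" by simp
  moreover have "0 \<le> \<bar>real_of_int (k - j)\<bar> * \<bar>of_int j\<bar>" by simp
  ultimately show ?thesis unfolding wt_def by (simp only: distrib_right distrib_left mult_1 mult_1_right)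
qed

lemma wt_powr_submult: "s \<ge> 0 \<Longrightarrow> wt k powr s \<le> wt (k - j) powr s * wt j powr s"
  using powr_mono2[OF _ wt_nonneg wt_submult] by (simp add: powr_mult wt_nonneg)

text \<open>Finer than submultiplicativity: each summand puts the weight on one factor only, as the
  critical kernel estimate requires.\<close>

lemma wt_powr_add_le:
  assumes "s \<ge> 0"
  shows "wt k powr s \<le> 2 powr s * (wt (k - j) powr s + wt j powr s)"
proof -
  have "\<bar>real_of_int k\<bar> \<le> \<bar>of_int (k - j)\<bar> + \<bar>of_int j\<bar>" by simp
  then have "wt k \<le> wt (k - j) + wt j" unfolding wt_def by linarith
  also have "\<dots> \<le> 2 * max (wt (k - j)) (wt j)" by simp
  finally have "wt k \<le> 2 * max (wt (k - j)) (wt j)" .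
  then have "wt k powr s \<le> (2 * max (wt (k - j)) (wt j)) powr s"
    using assms by (intro powr_mono2) (auto simp: wt_nonneg)
  also have "\<dots> = 2 powr s * max (wt (k - j)) (wt j) powr s"
    by (simp add: powr_mult wt_nonneg le_max_iff_disj)
  also have "\<dots> \<le> 2 powr s * (wt (k - j) powr s + wt j powr s)"
    by (intro mult_left_mono) (auto simp: max_def)
  finally show ?thesis .
qed

text \<open>The value of the lattice series, meaningful for p > 1, where the finite sums are
  bounded.\<close>

definition wt_sum :: "real \<Rightarrow> real" where
  "wt_sum p = (SUP F\<in>{F. finite F}. \<Sum>k\<in>F. wt k powr (- p))"

lemma sum_wt_powr_le:
  assumes p: "p > 1" and F: "finite F"
  shows "(\<Sum>k\<in>F. wt k powr (- p)) \<le> wt_sum p"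
proof -
  have sm: "summable (\<lambda>n. (real (Suc n)) powr (- p))"
    using p summable_real_powr_iff[of "- p"] summable_Suc_iff[of "\<lambda>n. real n powr (- p)"] by simp
  define Z where "Z = (\<Sum>n. (real (Suc n)) powr (- p))"
  have "(\<Sum>k\<in>G. wt k powr (- p)) \<le> 2 * Z" if G: "finite G" for G :: "int set"
  proof -
    let ?N = "nat ` abs ` G"
    have fin: "finite ?N" using G by simp
    \<comment> \<open>Each absolute value belongs to at most two integers, so two copies of the
      series over the naturals suffice; the frequency 0 lies in both images.\<close>
    have sub: "G \<subseteq> int ` ?N \<union> (\<lambda>n. - int n) ` ?N"
    proof
      fix k assume k: "k \<in> G"
      then have "nat \<bar>k\<bar> \<in> ?N" by blast
      moreover have "k = int (nat \<bar>k\<bar>) \<or> k = - int (nat \<bar>k\<bar>)" by auto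
      ultimately show "k \<in> int ` ?N \<union> (\<lambda>n. - int n) ` ?N" by blast
    qed
    have le: "(\<Sum>n\<in>?N. (real (Suc n)) powr (- p)) \<le> Z"
      unfolding Z_def by (rule sum_le_suminf[OF sm fin]) auto
    have "(\<Sum>k\<in>G. wt k powr (- p)) \<le> (\<Sum>k\<in>int ` ?N \<union> (\<lambda>n. - int n) ` ?N. wt k powr (- p))"
      using fin sub by (intro sum_mono2) auto
    also have "\<dots> \<le> (\<Sum>k\<in>int ` ?N. wt k powr (- p)) + (\<Sum>k\<in>(\<lambda>n. - int n) ` ?N. wt k powr (- p))"
      using fin by (subst sum.union_inter[symmetric]) (auto intro!: sum_nonneg)
    also have "\<dots> = (\<Sum>n\<in>?N. (real (Suc n)) powr (- p)) + (\<Sum>n\<in>?N. (real (Suc n)) powr (- p))"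
      by (subst (1 2) sum.reindex) (auto simp: inj_on_def wt_def add.commute)
    also have "\<dots> \<le> 2 * Z" using le by simp
    finally show ?thesis .
  qed
  then have "bdd_above ((\<lambda>F. \<Sum>k\<in>F. wt k powr (- p)) ` {F. finite F})" by (intro bdd_aboveI[of _ "2 * Z"]) auto
  then show ?thesis unfolding wt_sum_def using F by (intro cSUP_upper) auto
qed

lemma wt_sum_nonneg: "p > 1 \<Longrightarrow> 0 \<le> wt_sum p"
  using sum_wt_powr_le[of p "{}"] by simp

lemma sum_wt_powr_shift_le:
  assumes p: "p > 1" and F: "finite F"
  shows "(\<Sum>k\<in>F. wt (k - j) powr (- p)) \<le> wt_sum p" "(\<Sum>k\<in>F. wt (j - k) powr (- p)) \<le> wt_sum p"
proof -
  have "(\<Sum>k\<in>F. wt (k - j) powr (- p)) = (\<Sum>k\<in>(\<lambda>k. k - j) ` F. wt k powr (- p))"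
    by (subst sum.reindex) (auto simp: inj_on_def)
  then show "(\<Sum>k\<in>F. wt (k - j) powr (- p)) \<le> wt_sum p" using sum_wt_powr_le[OF p] F by simp
  have "(\<Sum>k\<in>F. wt (j - k) powr (- p)) = (\<Sum>k\<in>(\<lambda>k. j - k) ` F. wt k powr (- p))"
    by (subst sum.reindex) (auto simp: inj_on_def)
  then show "(\<Sum>k\<in>F. wt (j - k) powr (- p)) \<le> wt_sum p" using sum_wt_powr_le[OF p] F by simp
qed

text \<open>Phrased through finite partial sums, which makes summability part of the statement.\<close>

definition hbound :: "real \<Rightarrow> (int \<Rightarrow> complex) \<Rightarrow> real \<Rightarrow> bool" where
  "hbound s a C \<longleftrightarrow> (\<forall>F. finite F \<longrightarrow> L2_set (\<lambda>k. wt k powr s * cmod (a k)) F \<le> C)"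

lemma hboundI: "(\<And>F. finite F \<Longrightarrow> L2_set (\<lambda>k. wt k powr s * cmod (a k)) F \<le> C) \<Longrightarrow> hbound s a C"
  by (simp add: hbound_def)

lemma hboundD: "hbound s a C \<Longrightarrow> finite F \<Longrightarrow> L2_set (\<lambda>k. wt k powr s * cmod (a k)) F \<le> C"
  by (simp add: hbound_def)

lemma hbound_nonneg: "hbound s a C \<Longrightarrow> 0 \<le> C"
  using hboundD[of s a C "{}"] by simp

lemma hbound_mono: "hbound s a C \<Longrightarrow> C \<le> D \<Longrightarrow> hbound s a D"
  unfolding hbound_def by (meson order_trans)

lemma hbound_add:
  assumes "hbound s a A" "hbound s b B"
  shows "hbound s (\<lambda>k. a k + b k) (A + B)"
proof (rule hboundI)
  fix F :: "int set" assume F: "finite F"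
  have "L2_set (\<lambda>k. wt k powr s * cmod (a k + b k)) F \<le> L2_set (\<lambda>k. wt k powr s * cmod (a k) + wt k powr s * cmod (b k)) F"
    unfolding distrib_left[symmetric] by (intro L2_set_mono mult_left_mono norm_triangle_ineq) auto
  also have "\<dots> \<le> L2_set (\<lambda>k. wt k powr s * cmod (a k)) F + L2_set (\<lambda>k. wt k powr s * cmod (b k)) F"
    by (rule L2_set_triangle_ineq)
  also have "\<dots> \<le> A + B" using hboundD[OF assms(1) F] hboundD[OF assms(2) F] by simp
  finally show "L2_set (\<lambda>k. wt k powr s * cmod (a k + b k)) F \<le> A + B" .
qed

text \<open>Entrywise domination across two exponents. It serves for Fourier multipliers of any
  order and for the unimodular factors of the linear flow.\<close>

lemma hbound_multiplier:
  assumes b: "hbound t b B" and D: "D \<ge> 0"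
    and le: "\<And>k. wt k powr s * cmod (a k) \<le> D * (wt k powr t * cmod (b k))"
  shows "hbound s a (D * B)"
proof (rule hboundI)
  fix F :: "int set" assume F: "finite F"
  have "L2_set (\<lambda>k. wt k powr s * cmod (a k)) F \<le> L2_set (\<lambda>k. D * (wt k powr t * cmod (b k))) F"
    by (intro L2_set_mono le) auto
  also have "\<dots> \<le> D * B" 
    using hboundD[OF b F] D by (simp add: L2_set_right_distrib[symmetric] mult_left_mono)
  finally show "L2_set (\<lambda>k. wt k powr s * cmod (a k)) F \<le> D * B" .
qed

lemma hbound_exponent_mono:
  assumes "hbound t b B" "s \<le> t" shows "hbound s b B"
  using hbound_multiplier[OF assms(1), of 1 s b] assms(2) powr_mono[OF assms(2) wt_ge_1]
  by (simp add: mult_right_mono)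

text \<open>p > 1/2 makes the majorant square-summable. This recovers a Sobolev bound when only the
  size of each single coefficient is known, as for products.\<close>

lemma hbound_decay:
  assumes p: "p > 1/2" and D: "D \<ge> 0" and le: "\<And>k. wt k powr s * cmod (a k) \<le> D * wt k powr (- p)"
  shows "hbound s a (D * sqrt (wt_sum (2 * p)))"
proof (rule hboundI)
  fix F :: "int set" assume F: "finite F"
  have "L2_set (\<lambda>k. wt k powr s * cmod (a k)) F \<le> L2_set (\<lambda>k. D * wt k powr (- p)) F"
    by (intro L2_set_mono le) auto
  also have "\<dots> = D * L2_set (\<lambda>k. wt k powr (- p)) F"
    using D by (simp add: L2_set_right_distrib[symmetric])
  also have "L2_set (\<lambda>k. wt k powr (- p)) F = sqrt (\<Sum>k\<in>F. wt k powr (- (2 * p)))"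
    unfolding L2_set_def by (simp add: power2_eq_square powr_add[symmetric])
  also have "\<dots> \<le> sqrt (wt_sum (2 * p))" using sum_wt_powr_le[of "2 * p" F] p F by simp
  finally show "L2_set (\<lambda>k. wt k powr s * cmod (a k)) F \<le> D * sqrt (wt_sum (2 * p))" using D by (simp add: mult_left_mono)
qed

section \<open>Sobolev norms and coefficients of products\<close>

lemma sobolev_term: "(1 + \<bar>of_int k\<bar>) powr (2 * s) * (cmod z)\<^sup>2 = (wt k powr s * cmod z)\<^sup>2"
  by (simp add: wt_def power2_eq_square powr_add[symmetric] algebra_simps)

lemma sobolev_imp_hbound:
  assumes "f \<in> sobolev s"
  shows "hbound s (fourier_coeff f) (sobolev_norm s f)"
proof (rule hboundI)
  fix F :: "int set" assume F: "finite F"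
  have "(\<lambda>k. (wt k powr s * cmod (fourier_coeff f k))\<^sup>2) summable_on UNIV"
    using assms by (simp add: sobolev_def sobolev_term)
  then have "(\<Sum>k\<in>F. (wt k powr s * cmod (fourier_coeff f k))\<^sup>2) \<le> (\<Sum>\<^sub>\<infinity>k. (wt k powr s * cmod (fourier_coeff f k))\<^sup>2)"
    using F by (intro finite_sum_le_infsum) auto
  then show "L2_set (\<lambda>k. wt k powr s * cmod (fourier_coeff f k)) F \<le> sobolev_norm s f"
    unfolding L2_set_def sobolev_norm_def by (simp add: sobolev_term)
qed

lemma hbound_imp_sobolev:
  assumes f: "square_integrable f" and C: "hbound s (fourier_coeff f) C"
  shows "f \<in> sobolev s" "sobolev_norm s f \<le> C"
proof -
  have le: "(\<Sum>k\<in>F. (wt k powr s * cmod (fourier_coeff f k))\<^sup>2) \<le> C\<^sup>2" if "finite F" for F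
    using hboundD[OF C that] unfolding L2_set_def by (simp add: real_sqrt_le_iff' sqrt_le_D)
  then have sm: "(\<lambda>k. (wt k powr s * cmod (fourier_coeff f k))\<^sup>2) summable_on UNIV"
    by (intro nonneg_bdd_above_summable_on bdd_aboveI[of _ "C\<^sup>2"]) auto
  then show "f \<in> sobolev s" using f by (simp add: sobolev_def sobolev_term)
  have "(\<Sum>\<^sub>\<infinity>k. (wt k powr s * cmod (fourier_coeff f k))\<^sup>2) \<le> C\<^sup>2"
    using le sm by (intro infsum_le_finite_sums) auto
  then have "sqrt (\<Sum>\<^sub>\<infinity>k. (wt k powr s * cmod (fourier_coeff f k))\<^sup>2) \<le> C"
    using hbound_nonneg[OF C] by (intro real_le_lsqrt)
  then show "sobolev_norm s f \<le> C" unfolding sobolev_norm_def by (simp add: sobolev_term)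
qed

lemma has_sum_norm_bound:
  fixes f :: "'a \<Rightarrow> complex"
  assumes "(f has_sum S) UNIV" and "\<And>J. finite J \<Longrightarrow> cmod (sum f J) \<le> C"
  shows "cmod S \<le> C"
proof (rule tendsto_upperbound)
  show "((\<lambda>J. cmod (sum f J)) \<longlongrightarrow> cmod S) (finite_subsets_at_top UNIV)"
    using assms(1) unfolding has_sum_def by (rule tendsto_norm)
  show "\<forall>\<^sub>F J in finite_subsets_at_top UNIV. cmod (sum f J) \<le> C"
    using assms(2) eventually_finite_subsets_at_top_weakI by blast
qed simp

text \<open>The submultiplicative weight is distributed over the factors before Cauchy-Schwarz. For
  s \<le> 1/2 a product of two elements of H^s may leave H^s; this decay of single coefficients
  holds for every s \<ge> 0.\<close>

lemma fourier_coeff_mult_bound: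
  assumes f: "square_integrable f" and g: "square_integrable g" and s: "s \<ge> 0"
    and A: "hbound s (fourier_coeff f) A" and B: "hbound s (fourier_coeff g) B"
  shows "wt k powr s * cmod (fourier_coeff (\<lambda>x. g x * f x) k) \<le> A * B"
proof -
  have "((\<lambda>j. of_real (wt k powr s) * (fourier_coeff g (k - j) * fourier_coeff f j)) has_sum 
      (of_real (wt k powr s) * fourier_coeff (\<lambda>x. g x * f x) k)) UNIV"
    by (rule has_sum_cmult_right[OF fourier_coeff_mult_has_sum[OF f g]])
  then have "cmod (of_real (wt k powr s) * fourier_coeff (\<lambda>x. g x * f x) k) \<le> A * B"
  proof (rule has_sum_norm_bound)
    fix J :: "int set" assume J: "finite J"
    let ?g = "\<lambda>j. wt (k - j) powr s * cmod (fourier_coeff g (k - j))" and ?f = "\<lambda>j. wt j powr s * cmod (fourier_coeff f j)"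
    have "cmod (\<Sum>j\<in>J. of_real (wt k powr s) * (fourier_coeff g (k - j) * fourier_coeff f j)) 
      \<le> (\<Sum>j\<in>J. \<bar>?g j\<bar> * \<bar>?f j\<bar>)"
    proof (rule sum_norm_le)
      fix j
      have "wt k powr s * (cmod (fourier_coeff g (k - j)) * cmod (fourier_coeff f j)) \<le> 
         (wt (k - j) powr s * wt j powr s) * (cmod (fourier_coeff g (k - j)) * cmod (fourier_coeff f j))"
        by (intro mult_right_mono wt_powr_submult s) auto
      then show "cmod (of_real (wt k powr s) * (fourier_coeff g (k - j) * fourier_coeff f j)) \<le> \<bar>?g j\<bar> * \<bar>?f j\<bar>"
        by (simp add: norm_mult abs_mult mult_ac)
    qed
    also have "\<dots> \<le> L2_set ?g J * L2_set ?f J" by (rule L2_set_mult_ineq)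
    also have "L2_set ?g J = L2_set (\<lambda>j. wt j powr s * cmod (fourier_coeff g j)) ((\<lambda>j. k - j) ` J)"
      unfolding L2_set_def by (subst sum.reindex) (auto simp: inj_on_def)
    also have "\<dots> * L2_set ?f J \<le> B * A"
      using J hboundD[OF A J] hboundD[OF B] hbound_nonneg[OF B] by (intro mult_mono) auto
    finally show "cmod (\<Sum>j\<in>J. of_real (wt k powr s) * (fourier_coeff g (k - j) * fourier_coeff f j)) \<le> A * B"
      by (simp add: mult.commute)
  qed
  then show ?thesis by (simp add: norm_mult)
qed

text \<open>A sequence that convolves boundedly on the weighted space, i.e. the Fourier coefficients of
  a pointwise multiplier of $H^s$.\<close>

definition mult_bound :: "real \<Rightarrow> (int \<Rightarrow> complex) \<Rightarrow> real \<Rightarrow> bool" where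
  "mult_bound s b K \<longleftrightarrow> K \<ge> 0 \<and> (\<forall>F J f. finite F \<longrightarrow> finite J \<longrightarrow>
     L2_set (\<lambda>k. wt k powr s * cmod (\<Sum>j\<in>J. b (k - j) * f j)) F \<le> K * L2_set (\<lambda>j. wt j powr s * cmod (f j)) J)"

lemma mult_boundI: 
  "K \<ge> 0 \<Longrightarrow> (\<And>F J f. finite F \<Longrightarrow> finite J \<Longrightarrow>
     L2_set (\<lambda>k. wt k powr s * cmod (\<Sum>j\<in>J. b (k - j) * f j)) F \<le> K * L2_set (\<lambda>j. wt j powr s * cmod (f j)) J) \<Longrightarrow> mult_bound s b K"
  by (simp add: mult_bound_def)

lemma mult_boundD: 
  "mult_bound s b K \<Longrightarrow> finite F \<Longrightarrow> finite J \<Longrightarrow>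
     L2_set (\<lambda>k. wt k powr s * cmod (\<Sum>j\<in>J. b (k - j) * f j)) F \<le> K * L2_set (\<lambda>j. wt j powr s * cmod (f j)) J"
  by (simp add: mult_bound_def)

lemma mult_bound_nonneg: "mult_bound s b K \<Longrightarrow> K \<ge> 0"
  by (simp add: mult_bound_def)

lemma mult_bound_mono: "mult_bound s b K \<Longrightarrow> K \<le> L \<Longrightarrow> mult_bound s b L"
  unfolding mult_bound_def by (meson L2_set_nonneg mult_right_mono order_trans)

lemma mult_bound_add:
  assumes "mult_bound s a A" "mult_bound s b B"
  shows "mult_bound s (\<lambda>k. a k + b k) (A + B)"
proof (rule mult_boundI)
  show "A + B \<ge> 0" using assms by (simp add: mult_bound_def)
  fix F J :: "int set" and f assume F: "finite F" and J: "finite J"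
  let ?S = "\<lambda>b k. wt k powr s * cmod (\<Sum>j\<in>J. b (k - j) * f j)"
  have "L2_set (?S (\<lambda>k. a k + b k)) F \<le> L2_set (\<lambda>k. ?S a k + ?S b k) F"
    unfolding distrib_left[symmetric] distrib_right sum.distrib
    by (intro L2_set_mono mult_left_mono norm_triangle_ineq) auto
  also have "\<dots> \<le> L2_set (?S a) F + L2_set (?S b) F" by (rule L2_set_triangle_ineq)
  also have "\<dots> \<le> A * L2_set (\<lambda>j. wt j powr s * cmod (f j)) J + B * L2_set (\<lambda>j. wt j powr s * cmod (f j)) J"
    by (intro add_mono mult_boundD assms F J)
  finally show "L2_set (?S (\<lambda>k. a k + b k)) F \<le> (A + B) * L2_set (\<lambda>j. wt j powr s * cmod (f j)) J"
    by (simp add: distrib_right)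
qed

lemma mult_bound_scale:
  assumes "mult_bound s b B"
  shows "mult_bound s (\<lambda>k. c * b k) (cmod c * B)"
proof (rule mult_boundI)
  show "cmod c * B \<ge> 0" using assms by (simp add: mult_bound_def)
  fix F J :: "int set" and f assume F: "finite F" and J: "finite J"
  have "L2_set (\<lambda>k. wt k powr s * cmod (\<Sum>j\<in>J. c * b (k - j) * f j)) F = cmod c * L2_set (\<lambda>k. wt k powr s * cmod (\<Sum>j\<in>J. b (k - j) * f j)) F"
    by (simp add: L2_set_right_distrib mult.assoc sum_distrib_left[symmetric] norm_mult mult.left_commute)
  also have "\<dots> \<le> cmod c * (B * L2_set (\<lambda>j. wt j powr s * cmod (f j)) J)"
    by (intro mult_left_mono mult_boundD assms F J) auto
  finally show "L2_set (\<lambda>k. wt k powr s * cmod (\<Sum>j\<in>J. c * b (k - j) * f j)) F \<le> cmod c * B * L2_set (\<lambda>j. wt j powr s * cmod (f j)) J"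
    by (simp add: mult.assoc)
qed

text \<open>For fixed finite \<open>F\<close> the norm depends continuously on finitely many
  convolution sums, so the bound for finite \<open>J\<close> passes to the limit. This is why
  \<open>mult_bound\<close> can be tested on finite sums.\<close>

lemma hbound_mult:
  assumes f: "square_integrable f" and g: "square_integrable g"
    and C: "hbound s (fourier_coeff f) C" and K: "mult_bound s (fourier_coeff g) K"
  shows "hbound s (fourier_coeff (\<lambda>x. g x * f x)) (K * C)"
proof (rule hboundI)
  fix F :: "int set" assume F: "finite F"
  show "L2_set (\<lambda>k. wt k powr s * cmod (fourier_coeff (\<lambda>x. g x * f x) k)) F \<le> K * C"
  proof (rule tendsto_upperbound)
    show "((\<lambda>J. L2_set (\<lambda>k. wt k powr s * cmod (\<Sum>j\<in>J. fourier_coeff g (k - j) * fourier_coeff f j)) F) 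
      \<longlongrightarrow> L2_set (\<lambda>k. wt k powr s * cmod (fourier_coeff (\<lambda>x. g x * f x) k)) F) (finite_subsets_at_top UNIV)"
      unfolding L2_set_def
      by (intro tendsto_intros fourier_coeff_mult_has_sum[OF f g, unfolded has_sum_def])
    show "\<forall>\<^sub>F J in finite_subsets_at_top UNIV. 
      L2_set (\<lambda>k. wt k powr s * cmod (\<Sum>j\<in>J. fourier_coeff g (k - j) * fourier_coeff f j)) F \<le> K * C"
    proof (rule eventually_finite_subsets_at_top_weakI)
      fix J :: "int set" assume J: "finite J"
      show "L2_set (\<lambda>k. wt k powr s * cmod (\<Sum>j\<in>J. fourier_coeff g (k - j) * fourier_coeff f j)) F \<le> K * C"
        by (rule order_trans[OF mult_boundD[OF K F J]])
          (intro mult_left_mono hboundD[OF C J] mult_bound_nonneg[OF K])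
    qed
  qed simp
qed

section \<open>Schur's test and Wiener algebras\<close>

text \<open>Cauchy-Schwarz against sqrt P and sqrt Q, then exchange of the sums. Only the rows of
  \<open>P\<close> and the columns of \<open>Q\<close> are summed, so a kernel whose own row sums
  diverge may still be admissible.\<close>

lemma schur_test:
  fixes \<kappa> P Q :: "int \<Rightarrow> int \<Rightarrow> real"
  assumes F: "finite F" and J: "finite J" and AB: "A \<ge> 0" "B \<ge> 0"
    and \<kappa>: "\<And>k j. 0 \<le> \<kappa> k j" "\<And>k j. 0 \<le> P k j" "\<And>k j. 0 \<le> Q k j" "\<And>k j. (\<kappa> k j)\<^sup>2 \<le> P k j * Q k j"
    and P: "\<And>k. (\<Sum>j\<in>J. P k j) \<le> A" and Q: "\<And>j. (\<Sum>k\<in>F. Q k j) \<le> B"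
    and \<phi>: "\<And>j. 0 \<le> \<phi> j"
  shows "L2_set (\<lambda>k. \<Sum>j\<in>J. \<kappa> k j * \<phi> j) F \<le> sqrt (A * B) * L2_set \<phi> J"
proof -
  have "(\<Sum>j\<in>J. \<kappa> k j * \<phi> j)\<^sup>2 \<le> A * (\<Sum>j\<in>J. Q k j * (\<phi> j)\<^sup>2)" for k
  proof -
    have "(\<Sum>j\<in>J. \<kappa> k j * \<phi> j) \<le> (\<Sum>j\<in>J. sqrt (P k j) * (sqrt (Q k j) * \<phi> j))"
    proof (rule sum_mono)
      fix j
      have "\<kappa> k j \<le> sqrt (P k j * Q k j)" by (rule real_le_rsqrt[OF \<kappa>(4)])
      then show "\<kappa> k j * \<phi> j \<le> sqrt (P k j) * (sqrt (Q k j) * \<phi> j)"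
        using mult_right_mono[OF _ \<phi>[of j]] by (simp add: real_sqrt_mult mult.assoc[symmetric])
    qed
    then have "(\<Sum>j\<in>J. \<kappa> k j * \<phi> j)\<^sup>2 \<le> (\<Sum>j\<in>J. sqrt (P k j) * (sqrt (Q k j) * \<phi> j))\<^sup>2"
      by (intro power_mono sum_nonneg) (auto simp: \<kappa> \<phi>)
    also have "\<dots> \<le> (\<Sum>j\<in>J. (sqrt (P k j))\<^sup>2) * (\<Sum>j\<in>J. (sqrt (Q k j) * \<phi> j)\<^sup>2)"
      by (rule Cauchy_Schwarz_ineq_sum)
    also have "\<dots> = (\<Sum>j\<in>J. P k j) * (\<Sum>j\<in>J. Q k j * (\<phi> j)\<^sup>2)"
      by (simp add: \<kappa> power_mult_distrib)
    also have "\<dots> \<le> A * (\<Sum>j\<in>J. Q k j * (\<phi> j)\<^sup>2)"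
      by (intro mult_right_mono P sum_nonneg) (simp add: \<kappa>)
    finally show ?thesis .
  qed
  then have "(\<Sum>k\<in>F. (\<Sum>j\<in>J. \<kappa> k j * \<phi> j)\<^sup>2) \<le> (\<Sum>k\<in>F. A * (\<Sum>j\<in>J. Q k j * (\<phi> j)\<^sup>2))"
    by (intro sum_mono)
  also have "\<dots> = A * (\<Sum>j\<in>J. (\<Sum>k\<in>F. Q k j) * (\<phi> j)\<^sup>2)"
    unfolding sum_distrib_left[symmetric] sum_distrib_right by (subst sum.swap) (rule refl)
  also have "\<dots> \<le> A * (\<Sum>j\<in>J. B * (\<phi> j)\<^sup>2)"
    by (intro mult_left_mono sum_mono mult_right_mono Q AB) auto
  also have "\<dots> = (A * B) * (\<Sum>j\<in>J. (\<phi> j)\<^sup>2)" by (simp add: sum_distrib_left mult.assoc)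
  finally show ?thesis unfolding L2_set_def real_sqrt_mult[symmetric] by simp
qed

text \<open>Absolute values are taken inside the convolution, so oscillation is lost. Hilbert's
  kernel is out of reach this way and is treated through a bounded function instead.\<close>

lemma mult_boundI_kernel:
  assumes W: "W \<ge> 0" 
    and le: "\<And>k j. wt k powr s * cmod (b (k - j)) \<le> \<kappa> k j * wt j powr s"
    and \<kappa>: "\<And>F J \<phi>. finite F \<Longrightarrow> finite J \<Longrightarrow> (\<And>j. 0 \<le> \<phi> j) \<Longrightarrow> L2_set (\<lambda>k. \<Sum>j\<in>J. \<kappa> k j * \<phi> j) F \<le> W * L2_set \<phi> J"
  shows "mult_bound s b W"
proof (rule mult_boundI[OF W])
  fix F J :: "int set" and f assume F: "finite F" and J: "finite J"
  let ?\<phi> = "\<lambda>j. wt j powr s * cmod (f j)"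
  have "L2_set (\<lambda>k. wt k powr s * cmod (\<Sum>j\<in>J. b (k - j) * f j)) F \<le> L2_set (\<lambda>k. \<Sum>j\<in>J. \<kappa> k j * ?\<phi> j) F"
  proof (rule L2_set_mono)
    fix k
    have "wt k powr s * cmod (\<Sum>j\<in>J. b (k - j) * f j) \<le> wt k powr s * (\<Sum>j\<in>J. cmod (b (k - j) * f j))"
      by (intro mult_left_mono norm_sum) auto
    also have "\<dots> = (\<Sum>j\<in>J. (wt k powr s * cmod (b (k - j))) * cmod (f j))"
      by (simp add: sum_distrib_left norm_mult mult.assoc)
    also have "\<dots> \<le> (\<Sum>j\<in>J. (\<kappa> k j * wt j powr s) * cmod (f j))"
      by (intro sum_mono mult_right_mono le) auto
    finally show "wt k powr s * cmod (\<Sum>j\<in>J. b (k - j) * f j) \<le> (\<Sum>j\<in>J. \<kappa> k j * ?\<phi> j)" by (simp add: mult.assoc)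
  qed auto
  also have "\<dots> \<le> W * L2_set ?\<phi> J" by (rule \<kappa>[OF F J]) auto
  finally show "L2_set (\<lambda>k. wt k powr s * cmod (\<Sum>j\<in>J. b (k - j) * f j)) F \<le> W * L2_set ?\<phi> J" .
qed

text \<open>Young's inequality for l^1 and l^2, with the weight distributed by
  submultiplicativity.\<close>

lemma mult_bound_wiener:
  assumes s: "s \<ge> 0" and W: "\<And>F. finite F \<Longrightarrow> (\<Sum>j\<in>F. wt j powr s * cmod (b j)) \<le> W"
  shows "mult_bound s b W"
proof -
  let ?\<beta> = "\<lambda>j. wt j powr s * cmod (b j)"
  have W0: "W \<ge> 0" using W[of "{}"] by simp
  show ?thesis
  proof (rule mult_boundI_kernel[where \<kappa> = "\<lambda>k j. ?\<beta> (k - j)", OF W0])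
    show "wt k powr s * cmod (b (k - j)) \<le> ?\<beta> (k - j) * wt j powr s" for k j
      using mult_right_mono[OF wt_powr_submult[OF s, of k j], of "cmod (b (k - j))"] by (simp add: mult_ac)
    fix F J :: "int set" and \<phi> :: "int \<Rightarrow> real" assume F: "finite F" and J: "finite J" and \<phi>: "\<And>j. 0 \<le> \<phi> j"
    have "L2_set (\<lambda>k. \<Sum>j\<in>J. ?\<beta> (k - j) * \<phi> j) F \<le> sqrt (W * W) * L2_set \<phi> J"
    proof (rule schur_test[where P = "\<lambda>k j. ?\<beta> (k - j)" and Q = "\<lambda>k j. ?\<beta> (k - j)", OF F J W0 W0])
      show "(\<Sum>j\<in>J. ?\<beta> (k - j)) \<le> W" for k
        using W[of "(\<lambda>j. k - j) ` J"] J by (simp add: sum.reindex inj_on_def)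
      show "(\<Sum>k\<in>F. ?\<beta> (k - j)) \<le> W" for j
        using W[of "(\<lambda>k. k - j) ` F"] F by (simp add: sum.reindex inj_on_def)
    qed (auto simp: power2_eq_square \<phi>)
    then show "L2_set (\<lambda>k. \<Sum>j\<in>J. ?\<beta> (k - j) * \<phi> j) F \<le> W * L2_set \<phi> J" using W0 by simp
  qed
qed

lemma mult_bound_wiener_decay:
  assumes s: "s \<ge> 0" and p: "p > 1" and D: "D \<ge> 0" and le: "\<And>j. wt j powr s * cmod (b j) \<le> D * wt j powr (- p)"
  shows "mult_bound s b (D * wt_sum p)"
proof (rule mult_bound_wiener[OF s])
  fix F :: "int set" assume F: "finite F"
  have "(\<Sum>j\<in>F. wt j powr s * cmod (b j)) \<le> (\<Sum>j\<in>F. D * wt j powr (- p))" by (intro sum_mono le)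
  also have "\<dots> \<le> D * wt_sum p" unfolding sum_distrib_left[symmetric] by (intro mult_left_mono sum_wt_powr_le p F D)
  finally show "(\<Sum>j\<in>F. wt j powr s * cmod (b j)) \<le> D * wt_sum p" .
qed

text \<open>Cauchy--Schwarz: \<open>H\<^sup>r\<close> embeds into the weighted Wiener algebra.\<close>

lemma mult_bound_hbound:
  assumes s: "s \<ge> 0" and r: "r - s > 1/2" and b: "hbound r b C"
  shows "mult_bound s b (sqrt (wt_sum (2 * (r - s))) * C)"
proof (rule mult_bound_wiener[OF s])
  fix F :: "int set" assume F: "finite F"
  have "(\<Sum>j\<in>F. wt j powr s * cmod (b j)) = (\<Sum>j\<in>F. \<bar>wt j powr (- (r - s))\<bar> * \<bar>wt j powr r * cmod (b j)\<bar>)"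
    by (intro sum.cong) (auto simp: abs_mult mult.assoc[symmetric] powr_add[symmetric])
  also have "\<dots> \<le> L2_set (\<lambda>j. wt j powr (- (r - s))) F * L2_set (\<lambda>j. wt j powr r * cmod (b j)) F"
    by (rule L2_set_mult_ineq)
  also have "L2_set (\<lambda>j. wt j powr (- (r - s))) F = sqrt (\<Sum>j\<in>F. wt j powr (- (2 * (r - s))))"
    unfolding L2_set_def by (simp add: power2_eq_square powr_add[symmetric])
  also have "\<dots> * L2_set (\<lambda>j. wt j powr r * cmod (b j)) F \<le> sqrt (wt_sum (2 * (r - s))) * C"
    using sum_wt_powr_le[of "2 * (r - s)" F] r F wt_sum_nonneg[of "2 * (r - s)"] by (intro mult_mono hboundD[OF b]) auto
  finally show "(\<Sum>j\<in>F. wt j powr s * cmod (b j)) \<le> sqrt (wt_sum (2 * (r - s))) * C" .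
qed

section \<open>Criteria for multipliers\<close>

text \<open>Both exponents on the left are nonpositive and add up to
  \<open>- (1 + \<theta>)\<close>, so replacing the larger of the two bases by the smaller one only
  increases the product.\<close>

lemma powr_interpolation:
  fixes x y :: real
  assumes "x \<ge> 1" "y \<ge> 1" "0 \<le> \<theta>" "\<theta> \<le> 1/2"
  shows "x powr (\<theta> - 1) * y powr (- 2 * \<theta>) \<le> x powr (- (1 + \<theta>)) + y powr (- (1 + \<theta>))"
proof (cases "x \<le> y")
  case True
  then have "y powr (- 2 * \<theta>) \<le> x powr (- 2 * \<theta>)" using assms by (intro powr_mono2') auto
  then have "x powr (\<theta> - 1) * y powr (- 2 * \<theta>) \<le> x powr (\<theta> - 1) * x powr (- 2 * \<theta>)" by (intro mult_left_mono) auto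
  also have "\<dots> = x powr (- (1 + \<theta>))" by (simp add: powr_add[symmetric] algebra_simps)
  also have "\<dots> \<le> x powr (- (1 + \<theta>)) + y powr (- (1 + \<theta>))" by simp
  finally show ?thesis .
next
  case False
  then have "x powr (\<theta> - 1) \<le> y powr (\<theta> - 1)" using assms by (intro powr_mono2') auto
  then have "x powr (\<theta> - 1) * y powr (- 2 * \<theta>) \<le> y powr (\<theta> - 1) * y powr (- 2 * \<theta>)" by (intro mult_right_mono) auto
  also have "\<dots> = y powr (- (1 + \<theta>))" by (simp add: powr_add[symmetric] algebra_simps)
  also have "\<dots> \<le> x powr (- (1 + \<theta>)) + y powr (- (1 + \<theta>))" by simp
  finally show ?thesis .
qed

text \<open>Collects the Schur constants of the two kernels in the next proof: the root belongs to
  the asymmetric splitting with parameter \<open>min s (1/2)\<close>, the last term to the summable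
  kernel, and \<open>2 powr s\<close> comes from \<open>wt_powr_add_le\<close>.\<close>

definition critical_const :: "real \<Rightarrow> real" where
  "critical_const s = 2 powr s * (sqrt (2 * wt_sum (1 + min s (1/2)) * wt_sum (1 + min s (1/2))) + wt_sum (1 + s))"

text \<open>The decay $|b_j| \lesssim \langle j\rangle^{-1-s}$ is just too weak for the weighted Wiener algebra,
  but the kernel still passes Schur's test with an asymmetric splitting.\<close>

lemma mult_bound_critical_decay:
  assumes s: "s > 0" and D: "D \<ge> 0" and le: "\<And>j. wt j powr s * cmod (b j) \<le> D * wt j powr (- 1)"
  shows "mult_bound s b (D * critical_const s)"
proof -
  define \<theta> where "\<theta> = min s (1/2)"
  have \<theta>: "0 < \<theta>" "\<theta> \<le> 1/2" "\<theta> \<le> s" using s by (auto simp: \<theta>_def)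
  define S where "S = wt_sum (1 + \<theta>)"
  have S: "S \<ge> 0" unfolding S_def using \<theta> by (intro wt_sum_nonneg) auto
  define R where "R = wt_sum (1 + s)"
  have R: "R \<ge> 0" unfolding R_def using s by (intro wt_sum_nonneg) auto
  \<comment> \<open>In the first kernel the weight has fallen on \<open>b\<close>; normalising the
    other factor leaves the decay \<open>wt j powr (- s)\<close>. In the second the weight stays
    with the other factor and \<open>b\<close> alone is summable.\<close>
  define \<kappa>1 where "\<kappa>1 = (\<lambda>k j. wt (k - j) powr (- 1) * wt j powr (- s))"
  define \<kappa>2 where "\<kappa>2 = (\<lambda>k j. wt (k - j) powr (- (1 + s)))"
  have le': "cmod (b j) \<le> D * wt j powr (- (1 + s))" for j
  proof -
    have "cmod (b j) = wt j powr (- s) * (wt j powr s * cmod (b j))" 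
      using wt_pos[of j] by (simp add: mult.assoc[symmetric] powr_add[symmetric])
    also have "\<dots> \<le> wt j powr (- s) * (D * wt j powr (- 1))" by (intro mult_left_mono le) auto
    also have "\<dots> = D * (wt j powr (- s) * wt j powr (- 1))" by (simp only: mult.left_commute)
    also have "wt j powr (- s) * wt j powr (- 1) = wt j powr (- (1 + s))" by (subst powr_add[symmetric]) (simp add: algebra_simps)
    finally show ?thesis .
  qed
  have "mult_bound s b (2 powr s * D * (sqrt (2 * S * S) + R))"
  proof (rule mult_boundI_kernel[where \<kappa> = "\<lambda>k j. 2 powr s * D * (\<kappa>1 k j + \<kappa>2 k j)"])
    show "0 \<le> 2 powr s * D * (sqrt (2 * S * S) + R)" using D S R by simp
    fix k j
    have "wt k powr s * cmod (b (k - j)) \<le> 2 powr s * (wt (k - j) powr s + wt j powr s) * cmod (b (k - j))"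
      using s by (intro mult_right_mono wt_powr_add_le) auto
    also have "\<dots> = 2 powr s * (wt (k - j) powr s * cmod (b (k - j)) + cmod (b (k - j)) * wt j powr s)"
      by (simp add: algebra_simps)
    also have "\<dots> \<le> 2 powr s * (D * wt (k - j) powr (- 1) + (D * wt (k - j) powr (- (1 + s))) * wt j powr s)"
      by (intro mult_left_mono add_mono le mult_right_mono le') auto
    also have "wt (k - j) powr (- 1) = \<kappa>1 k j * wt j powr s" 
      using wt_pos[of j] by (simp add: \<kappa>1_def mult.assoc powr_add[symmetric])
    also have "2 powr s * (D * (\<kappa>1 k j * wt j powr s) + D * wt (k - j) powr (- (1 + s)) * wt j powr s) =
       2 powr s * D * (\<kappa>1 k j + \<kappa>2 k j) * wt j powr s"
      by (simp add: \<kappa>2_def algebra_simps)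
    finally show "wt k powr s * cmod (b (k - j)) \<le> 2 powr s * D * (\<kappa>1 k j + \<kappa>2 k j) * wt j powr s" .
  next
    fix F J :: "int set" and \<phi> :: "int \<Rightarrow> real" assume F: "finite F" and J: "finite J" and \<phi>: "\<And>j. 0 \<le> \<phi> j"
    have 1: "L2_set (\<lambda>k. \<Sum>j\<in>J. \<kappa>1 k j * \<phi> j) F \<le> sqrt ((2 * S) * S) * L2_set \<phi> J"
    \<comment> \<open>The square of the first kernel has exponent -2 in \<open>wt (k - j)\<close>,
      split as (\<theta> - 1) + (-1 - \<theta>). The columns of \<open>Q\<close> converge by
      themselves; the rows of \<open>P\<close> converge only with the help of the decay in
      \<open>j\<close>, through \<open>powr_interpolation\<close>.\<close>
    proof (rule schur_test[OF F J, where P = "\<lambda>k j. wt (k - j) powr (\<theta> - 1) * wt j powr (- 2 * \<theta>)" and Q = "\<lambda>k j. wt (k - j) powr (- (1 + \<theta>))"])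
      show "(\<kappa>1 k j)\<^sup>2 \<le> wt (k - j) powr (\<theta> - 1) * wt j powr (- 2 * \<theta>) * wt (k - j) powr (- (1 + \<theta>))" for k j
      proof -
        have "(\<kappa>1 k j)\<^sup>2 = wt (k - j) powr (- 2) * wt j powr (- 2 * s)"
          unfolding \<kappa>1_def power_mult_distrib by (simp only: power2_eq_square powr_add[symmetric]) simp
        also have "\<dots> \<le> wt (k - j) powr (- 2) * wt j powr (- 2 * \<theta>)"
          using \<theta> wt_ge_1[of j] by (intro mult_left_mono[OF powr_mono]) auto
        also have "wt (k - j) powr (- 2) = wt (k - j) powr (\<theta> - 1) * wt (k - j) powr (- (1 + \<theta>))"
          by (simp add: powr_add[symmetric])
        finally show ?thesis by (simp add: mult_ac)
      qed
      show "(\<Sum>j\<in>J. wt (k - j) powr (\<theta> - 1) * wt j powr (- 2 * \<theta>)) \<le> 2 * S" for k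
      proof -
        have "(\<Sum>j\<in>J. wt (k - j) powr (\<theta> - 1) * wt j powr (- 2 * \<theta>)) \<le> (\<Sum>j\<in>J. wt (k - j) powr (- (1 + \<theta>)) + wt j powr (- (1 + \<theta>)))"
          using \<theta> by (intro sum_mono powr_interpolation wt_ge_1) auto
        also have "\<dots> \<le> S + S" unfolding sum.distrib S_def
          using \<theta> J by (intro add_mono sum_wt_powr_le sum_wt_powr_shift_le) auto
        finally show ?thesis by simp
      qed
      show "(\<Sum>k\<in>F. wt (k - j) powr (- (1 + \<theta>))) \<le> S" for j
        unfolding S_def using \<theta> F by (intro sum_wt_powr_shift_le) auto
    qed (use S \<phi> in \<open>auto simp: \<kappa>1_def\<close>)
    have 2: "L2_set (\<lambda>k. \<Sum>j\<in>J. \<kappa>2 k j * \<phi> j) F \<le> sqrt (R * R) * L2_set \<phi> J"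
    proof (rule schur_test[OF F J, where P = \<kappa>2 and Q = \<kappa>2])
      show "(\<Sum>j\<in>J. \<kappa>2 k j) \<le> R" for k
        unfolding R_def \<kappa>2_def using s J by (intro sum_wt_powr_shift_le) auto
      show "(\<Sum>k\<in>F. \<kappa>2 k j) \<le> R" for j
        unfolding R_def \<kappa>2_def using s F by (intro sum_wt_powr_shift_le) auto
    qed (use R \<phi> in \<open>auto simp: \<kappa>2_def power2_eq_square\<close>)
    have "L2_set (\<lambda>k. \<Sum>j\<in>J. 2 powr s * D * (\<kappa>1 k j + \<kappa>2 k j) * \<phi> j) F = 
      2 powr s * D * L2_set (\<lambda>k. (\<Sum>j\<in>J. \<kappa>1 k j * \<phi> j) + (\<Sum>j\<in>J. \<kappa>2 k j * \<phi> j)) F"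
      using D by (simp add: L2_set_right_distrib sum.distrib[symmetric] distrib_right[symmetric] sum_distrib_left mult.assoc)
    also have "\<dots> \<le> 2 powr s * D * (L2_set (\<lambda>k. \<Sum>j\<in>J. \<kappa>1 k j * \<phi> j) F + L2_set (\<lambda>k. \<Sum>j\<in>J. \<kappa>2 k j * \<phi> j) F)"
      using D by (intro mult_left_mono L2_set_triangle_ineq) auto
    also have "\<dots> \<le> 2 powr s * D * (sqrt ((2 * S) * S) * L2_set \<phi> J + sqrt (R * R) * L2_set \<phi> J)"
      using D by (intro mult_left_mono add_mono 1 2) auto
    also have "\<dots> = 2 powr s * D * (sqrt (2 * S * S) + R) * L2_set \<phi> J" using R by (simp add: distrib_right mult.assoc)
    finally show "L2_set (\<lambda>k. \<Sum>j\<in>J. 2 powr s * D * (\<kappa>1 k j + \<kappa>2 k j) * \<phi> j) F \<le> 2 powr s * D * (sqrt (2 * S * S) + R) * L2_set \<phi> J" .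
  qed
  then show ?thesis by (simp add: critical_const_def S_def R_def \<theta>_def mult_ac)
qed

section \<open>Duality and mean value inequalities\<close>

text \<open>Testing with the weighted conjugate of \<open>g\<close> gives the square of the norm.
  Bounds of l^2 norms are thereby reduced to complex-valued functionals, which can be differentiated
  or integrated directly.\<close>

lemma L2_set_le_dual:
  fixes g :: "'a \<Rightarrow> complex"
  assumes F: "finite F" and C: "C \<ge> 0" and w: "\<And>k. w k \<ge> 0"
    and le: "\<And>z. cmod (\<Sum>k\<in>F. z k * (complex_of_real (w k) * g k)) \<le> C * L2_set (\<lambda>k. cmod (z k)) F"
  shows "L2_set (\<lambda>k. w k * cmod (g k)) F \<le> C"
proof -
  let ?N = "L2_set (\<lambda>k. w k * cmod (g k)) F"
  define z where "z = (\<lambda>k. complex_of_real (w k) * cnj (g k))"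
  have z: "cmod (z k) = w k * cmod (g k)" for k using w[of k] by (simp add: z_def norm_mult)
  have e: "z k * (complex_of_real (w k) * g k) = complex_of_real ((w k * cmod (g k))\<^sup>2)" for k
  proof -
    have "z k * (complex_of_real (w k) * g k) = complex_of_real ((w k)\<^sup>2) * (g k * cnj (g k))"
      by (simp add: z_def power2_eq_square)
    then show ?thesis unfolding complex_norm_square[symmetric] by (simp add: power_mult_distrib)
  qed
  have "?N\<^sup>2 = (\<Sum>k\<in>F. (w k * cmod (g k))\<^sup>2)"
    unfolding L2_set_def by (intro real_sqrt_pow2 sum_nonneg) auto
  also have "\<dots> = cmod (complex_of_real (\<Sum>k\<in>F. (w k * cmod (g k))\<^sup>2))"
    by (simp only: norm_of_real) (simp add: sum_nonneg)
  also have "\<dots> \<le> C * ?N" using le[of z] by (simp only: z e of_real_sum)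
  finally have "?N * ?N \<le> C * ?N" by (simp add: power2_eq_square)
  then show ?thesis using C L2_set_nonneg[of "\<lambda>k. w k * cmod (g k)" F]
    by (cases "?N = 0") (auto simp: mult_le_cancel_right)
qed

lemma L2_set_mult_ineq_cmod:
  "cmod (\<Sum>k\<in>F. z k * (complex_of_real (w k) * g k)) \<le> L2_set (\<lambda>k. cmod (z k)) F * L2_set (\<lambda>k. w k * cmod (g k)) F"
proof -
  have "cmod (\<Sum>k\<in>F. z k * (complex_of_real (w k) * g k)) \<le> (\<Sum>k\<in>F. \<bar>cmod (z k)\<bar> * \<bar>w k * cmod (g k)\<bar>)"
    by (rule sum_norm_le) (simp add: norm_mult abs_mult)
  also have "\<dots> \<le> L2_set (\<lambda>k. cmod (z k)) F * L2_set (\<lambda>k. w k * cmod (g k)) F" by (rule L2_set_mult_ineq)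
  finally show ?thesis .
qed

lemma norm_diff_le_vector_derivative:
  fixes \<phi> :: "real \<Rightarrow> complex"
  assumes "a \<le> b" and d: "\<And>t. t \<in> {a..b} \<Longrightarrow> (\<phi> has_vector_derivative \<phi>' t) (at t within {a..b})"
    and K: "\<And>t. t \<in> {a..b} \<Longrightarrow> cmod (\<phi>' t) \<le> K"
  shows "cmod (\<phi> b - \<phi> a) \<le> K * (b - a)"
proof -
  have "cmod (\<phi> b - \<phi> a) \<le> K * norm (b - a)"
  proof (rule differentiable_bound[where S = "{a..b}" and f' = "\<lambda>t x. x *\<^sub>R \<phi>' t"])
    show "onorm (\<lambda>x. x *\<^sub>R \<phi>' t) \<le> K" if "t \<in> {a..b}" for t
      using K[OF that] by (intro onorm_le) (simp add: mult.commute[of K] mult_left_mono)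
  qed (use assms in \<open>auto simp: has_vector_derivative_def\<close>)
  then show ?thesis using assms(1) by simp
qed

text \<open>Pairing with a fixed \<open>z\<close> leaves a finite sum of modes, for which the
  complex mean value inequality holds with a constant proportional to the norm of
  \<open>z\<close>.\<close>

lemma L2_set_mean_value:
  fixes h :: "'a \<Rightarrow> real \<Rightarrow> complex"
  assumes F: "finite F" and ab: "a \<le> b" and w: "\<And>k. w k \<ge> 0"
    and d: "\<And>k t. k \<in> F \<Longrightarrow> t \<in> {a..b} \<Longrightarrow> (h k has_vector_derivative h' k t) (at t within {a..b})"
    and K: "\<And>t. t \<in> {a..b} \<Longrightarrow> L2_set (\<lambda>k. w k * cmod (h' k t)) F \<le> K"
  shows "L2_set (\<lambda>k. w k * cmod (h k b - h k a)) F \<le> K * (b - a)"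
proof (rule L2_set_le_dual[OF F _ w])
  have "0 \<le> K" using ab by (intro order_trans[OF L2_set_nonneg K[of a]]) simp
  then show "0 \<le> K * (b - a)" using ab by simp
  fix z :: "'a \<Rightarrow> complex"
  let ?\<phi> = "\<lambda>t. \<Sum>k\<in>F. z k * (complex_of_real (w k) * h k t)"
  have "cmod (?\<phi> b - ?\<phi> a) \<le> (L2_set (\<lambda>k. cmod (z k)) F * K) * (b - a)"
  proof (rule norm_diff_le_vector_derivative[OF ab])
    fix t assume t: "t \<in> {a..b}"
    show "(?\<phi> has_vector_derivative (\<Sum>k\<in>F. z k * (complex_of_real (w k) * h' k t))) (at t within {a..b})"
      by (intro has_vector_derivative_sum has_vector_derivative_mult_right d t)
    show "cmod (\<Sum>k\<in>F. z k * (complex_of_real (w k) * h' k t)) \<le> L2_set (\<lambda>k. cmod (z k)) F * K"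
      by (rule order_trans[OF L2_set_mult_ineq_cmod]) (intro mult_left_mono K t L2_set_nonneg)
  qed
  also have "?\<phi> b - ?\<phi> a = (\<Sum>k\<in>F. z k * (complex_of_real (w k) * (h k b - h k a)))"
    by (simp add: sum_subtractf[symmetric] algebra_simps)
  finally show "cmod (\<Sum>k\<in>F. z k * (complex_of_real (w k) * (h k b - h k a))) \<le> K * (b - a) * L2_set (\<lambda>k. cmod (z k)) F"
    by (simp add: mult_ac)
qed

text \<open>For a fixed finite \<open>f\<close> the convolution is differentiable mode by mode, so a
  bound of the operator norm of the velocity integrates to one of the increment.\<close>

lemma mult_bound_mean_value:
  fixes \<beta> :: "int \<Rightarrow> real \<Rightarrow> complex"
  assumes ab: "a \<le> b"
    and d: "\<And>k t. t \<in> {a..b} \<Longrightarrow> (\<beta> k has_vector_derivative \<beta>' k t) (at t within {a..b})"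
    and K: "\<And>t. t \<in> {a..b} \<Longrightarrow> mult_bound s (\<lambda>k. \<beta>' k t) K"
  shows "mult_bound s (\<lambda>k. \<beta> k b - \<beta> k a) (K * (b - a))"
proof (rule mult_boundI)
  show "0 \<le> K * (b - a)" using mult_bound_nonneg[OF K[of a]] ab by simp
  fix F J :: "int set" and f assume F: "finite F" and J: "finite J"
  let ?N = "L2_set (\<lambda>j. wt j powr s * cmod (f j)) J"
  have "L2_set (\<lambda>k. wt k powr s * cmod ((\<Sum>j\<in>J. \<beta> (k - j) b * f j) - (\<Sum>j\<in>J. \<beta> (k - j) a * f j))) F \<le> (K * ?N) * (b - a)"
  proof (rule L2_set_mean_value[OF F ab, where w = "\<lambda>k. wt k powr s"])
    fix k t assume t: "t \<in> {a..b}"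
    show "((\<lambda>t. \<Sum>j\<in>J. \<beta> (k - j) t * f j) has_vector_derivative (\<Sum>j\<in>J. \<beta>' (k - j) t * f j)) (at t within {a..b})"
      by (intro has_vector_derivative_sum has_vector_derivative_mult_left d t)
  next
    fix t assume t: "t \<in> {a..b}"
    show "L2_set (\<lambda>k. wt k powr s * cmod (\<Sum>j\<in>J. \<beta>' (k - j) t * f j)) F \<le> K * ?N"
      by (rule mult_boundD[OF K[OF t] F J])
  qed simp
  then show "L2_set (\<lambda>k. wt k powr s * cmod (\<Sum>j\<in>J. (\<beta> (k - j) b - \<beta> (k - j) a) * f j)) F \<le> K * (b - a) * ?N"
    unfolding left_diff_distrib sum_subtractf by (simp only: mult_ac)
qed

section \<open>Multipliers of L^2 beyond absolute summability\<close>

lemma integral_norm_trig_poly: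
  assumes "finite J"
  shows "integral\<^sup>L torus (\<lambda>x. (cmod (trig_poly J c x))\<^sup>2) = 2 * pi * (\<Sum>j\<in>J. (cmod (c j))\<^sup>2)"
  using integral_norm_diff_trig_poly[OF square_integrable_trig_poly assms, of J c c] assms
  by (simp add: fourier_coeff_trig_poly)

text \<open>On trigonometric polynomials the convolution is pointwise multiplication by
  \<open>B\<close>. Bessel bounds the left side, and the exact norm of the polynomial gives the
  right side.\<close>

lemma mult_bound_bounded_function:
  assumes B: "B \<in> borel_measurable torus" "\<And>x. x \<in> {-pi..pi} \<Longrightarrow> cmod (B x) \<le> K" 
  shows "mult_bound 0 (fourier_coeff B) K"
proof (rule mult_boundI)
  show K: "0 \<le> K" by (rule order_trans[OF norm_ge_zero B(2)[of 0]]) simp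
  fix F J :: "int set" and f assume F: "finite F" and J: "finite J"
  let ?p = "trig_poly J f"
  have iB: "integrable torus B" using bounded_square_integrable[OF B] by (rule square_integrable_imp_integrable)
  note sp = square_integrable_trig_poly[of J f]
  note Bp = bounded_square_integrable_mult[OF B sp]
  have "2 * pi * (\<Sum>k\<in>F. (cmod (\<Sum>j\<in>J. fourier_coeff B (k - j) * f j))\<^sup>2) \<le> K\<^sup>2 * (2 * pi * (\<Sum>j\<in>J. (cmod (f j))\<^sup>2))"
    using order_trans[OF bessel_inequality[OF Bp(1) F] Bp(2)]
    unfolding fourier_coeff_mult_trig_poly[OF iB J] integral_norm_trig_poly[OF J] .
  then have "(\<Sum>k\<in>F. (cmod (\<Sum>j\<in>J. fourier_coeff B (k - j) * f j))\<^sup>2) \<le> K\<^sup>2 * (\<Sum>j\<in>J. (cmod (f j))\<^sup>2)"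
    by (simp add: mult.left_commute[of "K\<^sup>2"])
  then have "sqrt (\<Sum>k\<in>F. (cmod (\<Sum>j\<in>J. fourier_coeff B (k - j) * f j))\<^sup>2) \<le> sqrt (K\<^sup>2 * (\<Sum>j\<in>J. (cmod (f j))\<^sup>2))"
    by (rule real_sqrt_le_mono)
  then show "L2_set (\<lambda>k. wt k powr 0 * cmod (\<Sum>j\<in>J. fourier_coeff B (k - j) * f j)) F \<le> K * L2_set (\<lambda>j. wt j powr 0 * cmod (f j)) J"
    unfolding L2_set_def using K wt_pos by (simp add: real_sqrt_mult less_imp_neq[THEN not_sym])
qed

text \<open>Modulating the coefficients translates the function. The character of
  \<open>k - j\<close> splits into a unimodular factor in \<open>k\<close>, which the norm ignores,
  and one in \<open>j\<close>, which is absorbed into \<open>f\<close>.\<close>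

lemma mult_bound_modulate:
  assumes "mult_bound s b K"
  shows "mult_bound s (\<lambda>k. cis (of_int k * y) * b k) K"
proof (rule mult_boundI[OF mult_bound_nonneg[OF assms]])
  fix F J :: "int set" and f assume F: "finite F" and J: "finite J"
  have c: "cis (of_int (k - j) * y) = cis (of_int k * y) * cis (- of_int j * y)" for k j
    by (simp add: cis_mult left_diff_distrib)
  have "(\<Sum>j\<in>J. cis (of_int (k - j) * y) * b (k - j) * f j) = cis (of_int k * y) * (\<Sum>j\<in>J. b (k - j) * (cis (- of_int j * y) * f j))" for k
    unfolding c sum_distrib_left by (simp only: mult_ac)
  then show "L2_set (\<lambda>k. wt k powr s * cmod (\<Sum>j\<in>J. cis (of_int (k - j) * y) * b (k - j) * f j)) F \<le> K * L2_set (\<lambda>j. wt j powr s * cmod (f j)) J"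
    using mult_boundD[OF assms F J, of "\<lambda>j. cis (- of_int j * y) * f j"] by (simp add: norm_mult)
qed

text \<open>The coefficients of \<open>h\<close> are an average, with weight \<open>h\<close>, of the characters, and modulation by
  a character preserves multiplier bounds.\<close>

lemma mult_bound_fourier_coeff_mult:
  assumes m: "mult_bound 0 m K" and h: "integrable torus h"
  shows "mult_bound 0 (\<lambda>k. fourier_coeff h k * m k) (K * (integral\<^sup>L torus (\<lambda>x. cmod (h x)) / (2 * pi)))"
proof (rule mult_boundI)
  let ?I = "integral\<^sup>L torus (\<lambda>x. cmod (h x))"
  have K: "K \<ge> 0" by (rule mult_bound_nonneg[OF m])
  show K': "0 \<le> K * (?I / (2 * pi))" using K by simp
  fix F J :: "int set" and f assume F: "finite F" and J: "finite J"
  have w0: "wt k powr 0 = 1" for k using wt_pos[of k] by simp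
  let ?N = "L2_set (\<lambda>j. cmod (f j)) J"
  have "L2_set (\<lambda>k. wt k powr 0 * cmod (\<Sum>j\<in>J. fourier_coeff h (k - j) * m (k - j) * f j)) F \<le> K * (?I / (2 * pi)) * ?N"
  proof (rule L2_set_le_dual[OF F])
    fix z :: "int \<Rightarrow> complex"
    let ?Z = "L2_set (\<lambda>k. cmod (z k)) F"
    \<comment> \<open>The pairing for \<open>m\<close> modulated by \<open>- y\<close>, bounded
      uniformly in y. Its integral against \<open>h\<close> is, up to 2 pi, the pairing for the
      product sequence; all sums are finite, so exchanging them with the integral is
      linearity.\<close>
    define G where "G = (\<lambda>y. \<Sum>k\<in>F. z k * (\<Sum>j\<in>J. cis (- of_int (k - j) * y) * m (k - j) * f j))"
    have G: "cmod (G y) \<le> ?Z * (K * ?N)" for y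
    proof -
      have "cmod (G y) \<le> ?Z * L2_set (\<lambda>k. 1 * cmod (\<Sum>j\<in>J. cis (- of_int (k - j) * y) * m (k - j) * f j)) F"
        using L2_set_mult_ineq_cmod[of z "\<lambda>_. 1"] by (simp add: G_def)
      also have "\<dots> \<le> ?Z * (K * ?N)"
        using mult_boundD[OF mult_bound_modulate[OF m, of "- y"] F J, of f]
        unfolding w0 mult_minus_right mult_minus_left
        by (intro mult_left_mono) auto
      finally show ?thesis .
    qed
    have Gm: "G \<in> borel_measurable torus"
      unfolding G_def by (intro continuous_measurable_torus continuous_intros)
    have hG: "integrable torus (\<lambda>y. h y * G y)"
    proof (rule Bochner_Integration.integrable_bound)
      show "integrable torus (\<lambda>y. (?Z * (K * ?N)) * h y)" using h by simp
      show "(\<lambda>y. h y * G y) \<in> borel_measurable torus" using h Gm by (auto intro: borel_measurable_times)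
      show "AE y in torus. norm (h y * G y) \<le> norm (complex_of_real (?Z * (K * ?N)) * h y)"
        using G K by (intro AE_I2) (simp add: norm_mult mult.commute[of "cmod (h _)"] mult_right_mono)
    qed
    have "(\<Sum>k\<in>F. z k * (complex_of_real (wt k powr 0) * (\<Sum>j\<in>J. fourier_coeff h (k - j) * m (k - j) * f j)))
       = (\<Sum>k\<in>F. \<Sum>j\<in>J. (z k * m (k - j) * f j / (2 * pi)) * integral\<^sup>L torus (\<lambda>y. h y * cis (- of_int (k - j) * y)))"
      unfolding w0 fourier_coeff_alt sum_distrib_left by (intro sum.cong refl) (simp add: field_simps)
    also have "\<dots> = (\<Sum>k\<in>F. \<Sum>j\<in>J. integral\<^sup>L torus (\<lambda>y. (z k * m (k - j) * f j / (2 * pi)) * (h y * cis (- of_int (k - j) * y))))"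
      by (simp only: Bochner_Integration.integral_mult_right_zero)
    also have "\<dots> = integral\<^sup>L torus (\<lambda>y. \<Sum>k\<in>F. \<Sum>j\<in>J. (z k * m (k - j) * f j / (2 * pi)) * (h y * cis (- of_int (k - j) * y)))"
      by (subst Bochner_Integration.integral_sum, intro Bochner_Integration.integrable_sum integrable_mult_right integrable_mult_cis h,
          subst Bochner_Integration.integral_sum, intro Bochner_Integration.integrable_sum integrable_mult_right integrable_mult_cis h, rule refl)
    also have "\<dots> = integral\<^sup>L torus (\<lambda>y. (h y * G y) * (1 / (2 * pi)))"
      by (intro Bochner_Integration.integral_cong refl) (simp add: G_def sum_distrib_left sum_distrib_right mult_ac)
    also have "\<dots> = integral\<^sup>L torus (\<lambda>y. h y * G y) * (1 / (2 * pi))"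
      by (simp only: Bochner_Integration.integral_mult_left_zero of_real_divide of_real_1 of_real_mult)
    finally have "cmod (\<Sum>k\<in>F. z k * (complex_of_real (wt k powr 0) * (\<Sum>j\<in>J. fourier_coeff h (k - j) * m (k - j) * f j)))
       = cmod (integral\<^sup>L torus (\<lambda>y. h y * G y)) / (2 * pi)" by (simp add: norm_mult norm_divide)
    also have "\<dots> \<le> integral\<^sup>L torus (\<lambda>y. cmod (h y * G y)) / (2 * pi)"
      by (intro divide_right_mono integral_norm_bound) simp
    also have "\<dots> \<le> integral\<^sup>L torus (\<lambda>y. (?Z * (K * ?N)) * cmod (h y)) / (2 * pi)"
    proof (intro divide_right_mono integral_mono)
      show "cmod (h y * G y) \<le> (?Z * (K * ?N)) * cmod (h y)" for y
        using mult_right_mono[OF G[of y], of "cmod (h y)"] by (simp add: norm_mult mult.commute)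
    qed (use h hG in \<open>auto intro: integrable_norm\<close>)
    also have "\<dots> = K * (?I / (2 * pi)) * ?N * ?Z" by simp
    finally show "cmod (\<Sum>k\<in>F. z k * (complex_of_real (wt k powr 0) * (\<Sum>j\<in>J. fourier_coeff h (k - j) * m (k - j) * f j)))
      \<le> K * (?I / (2 * pi)) * ?N * ?Z" .
  next
    show "0 \<le> K * (?I / (2 * pi)) * ?N" by (rule mult_nonneg_nonneg[OF K' L2_set_nonneg])
  qed simp
  then show "L2_set (\<lambda>k. wt k powr 0 * cmod (\<Sum>j\<in>J. fourier_coeff h (k - j) * m (k - j) * f j)) F
     \<le> K * (?I / (2 * pi)) * L2_set (\<lambda>j. wt j powr 0 * cmod (f j)) J" by (simp only: w0 mult_1)
qed

text \<open>Hilbert's inequality; the sequence consists, up to modulation, of the Fourier coefficients of the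
  bounded function \<open>x\<close>.\<close>

lemma mult_bound_hilbert: "mult_bound 0 (\<lambda>k. if k = 0 then 0 else \<i> / of_int k) pi"
proof -
  have "mult_bound 0 (fourier_coeff complex_of_real) pi"
    by (rule mult_bound_bounded_function) (auto intro!: continuous_measurable_torus continuous_intros)
  from mult_bound_modulate[OF this, of "- pi"]
  have "mult_bound 0 (\<lambda>k. cis (of_int k * (- pi)) * fourier_coeff complex_of_real k) pi" .
  also have "(\<lambda>k. cis (of_int k * (- pi)) * fourier_coeff complex_of_real k) = (\<lambda>k. if k = 0 then 0 else \<i> / of_int k)"
    by (rule ext) (auto simp: fourier_coeff_x cis_mult)
  finally show ?thesis .
qed

section \<open>The symbols of the equation\<close>

lemma hbound_uminus: "hbound s a C \<Longrightarrow> hbound s (\<lambda>k. - a k) C"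
  by (simp add: hbound_def)

lemma hbound_diff: "hbound s a A \<Longrightarrow> hbound s b B \<Longrightarrow> hbound s (\<lambda>k. a k - b k) (A + B)"
  using hbound_add[OF _ hbound_uminus, of s a A b B] by simp

lemma fourier_coeff_add:
  "square_integrable f \<Longrightarrow> square_integrable g \<Longrightarrow> fourier_coeff (\<lambda>x. f x + g x) k = fourier_coeff f k + fourier_coeff g k"
  using fourier_coeff_lincomb[OF square_integrable_imp_integrable square_integrable_imp_integrable, of f g 1 1] by simp

lemma fourier_coeff_diff:
  "square_integrable f \<Longrightarrow> square_integrable g \<Longrightarrow> fourier_coeff (\<lambda>x. f x - g x) k = fourier_coeff f k - fourier_coeff g k"
  using fourier_coeff_lincomb[OF square_integrable_imp_integrable square_integrable_imp_integrable, of f g 1 "-1"] by simp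

text \<open>The difference is written first because \<open>hbound_mult\<close> expects the
  multiplier as the left factor.\<close>

lemma fourier_coeff_square_diff:
  assumes f: "square_integrable f" and g: "square_integrable g"
  shows "fourier_coeff (\<lambda>x. (f x)\<^sup>2) k - fourier_coeff (\<lambda>x. (g x)\<^sup>2) k = fourier_coeff (\<lambda>x. (f x - g x) * (f x + g x)) k"
  using fourier_coeff_lincomb[OF square_integrable_mult[OF f f] square_integrable_mult[OF g g], of 1 "-1" k]
  by (simp add: power2_eq_square algebra_simps)

lemma fourier_coeff_square_bound:
  assumes "square_integrable f" "s \<ge> 0" "hbound s (fourier_coeff f) A"
  shows "wt k powr s * cmod (fourier_coeff (\<lambda>x. (f x)\<^sup>2) k) \<le> A\<^sup>2"
  using fourier_coeff_mult_bound[OF assms(1) assms(1) assms(2) assms(3) assms(3), of k] by (simp add: power2_eq_square)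

section \<open>Uniform and eps-dependent symbol bounds\<close>

definition eps_symbol :: "real \<Rightarrow> int \<Rightarrow> complex" where
  "eps_symbol eps k = complex_of_real eps * symbol_L eps k"

lemma norm_eps_symbol:
  assumes "eps > 0"
  shows "cmod (eps_symbol eps k) = eps * \<bar>of_int k\<bar> / (1 + eps * (of_int k)\<^sup>2)"
proof -
  have "1 + eps * (real_of_int k)\<^sup>2 > 0" using assms by (simp add: add_pos_nonneg)
  then show ?thesis using assms unfolding eps_symbol_def symbol_L_def norm_mult norm_divide norm_of_real by simp
qed

text \<open>With y = |k| the claim reduces to eps y + eps y^2 \<le> 2 (1 + eps y^2), which follows
  from 2 y \<le> 1 + y^2 and eps \<le> 1.\<close>

lemma norm_eps_symbol_le:
  assumes "0 < eps" "eps \<le> 1"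
  shows "cmod (eps_symbol eps k) \<le> 2 * wt k powr (- 1)"
proof -
  define y where "y = \<bar>real_of_int k\<bar>"
  have y: "(real_of_int k)\<^sup>2 = y\<^sup>2" "y \<ge> 0" by (simp_all add: y_def)
  have pos: "1 + eps * y\<^sup>2 > 0" using assms by (simp add: add_pos_nonneg)
  have "2 * y * 1 \<le> y\<^sup>2 + 1\<^sup>2" by (rule sum_squares_bound)
  then have "2 * y \<le> 1 + y\<^sup>2" by simp
  then have "eps * (2 * y) \<le> eps * (1 + y\<^sup>2)" using assms by (intro mult_left_mono) auto
  also have "\<dots> \<le> 1 + eps * y\<^sup>2" using assms by (simp add: distrib_left)
  finally have le: "2 * (eps * y) \<le> 1 + eps * y\<^sup>2" by simp
  have "0 \<le> eps * y" "0 \<le> eps * y\<^sup>2" using assms y by simp_all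
  then have "eps * y + eps * y\<^sup>2 \<le> 2 + 2 * (eps * y\<^sup>2)"
    using le by linarith
  moreover have "eps * y * (1 + y) = eps * y + eps * y\<^sup>2" by (simp add: distrib_left power2_eq_square mult.assoc)
  ultimately have "eps * y * (1 + y) \<le> 2 * (1 + eps * y\<^sup>2)" by simp
  then have "eps * y / (1 + eps * y\<^sup>2) \<le> 2 / (1 + y)" using pos y by (simp add: divide_simps mult_ac)
  then show ?thesis unfolding norm_eps_symbol[OF assms(1)] y using y(2) by (simp add: wt_def y_def powr_minus divide_inverse)
qed

text \<open>Geometric interpolation between the bounds eps^(1/2) and 2 <k>^(-1) with weights 1/4 and
  3/4. The remaining decay 3/4 exceeds 1/2, hence is square-summable, and a positive power of eps is
  kept.\<close>

lemma norm_eps_symbol_le_powr: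
  assumes "0 < eps" "eps \<le> 1"
  shows "cmod (eps_symbol eps k) \<le> 2 * eps powr (1/8) * wt k powr (- 3/4)"
proof -
  let ?q = "cmod (eps_symbol eps k)"
  define y where "y = sqrt eps * \<bar>real_of_int k\<bar>"
  have y: "eps * (real_of_int k)\<^sup>2 = y\<^sup>2" "y \<ge> 0" "eps * \<bar>real_of_int k\<bar> = sqrt eps * y"
    using assms by (simp_all add: y_def power_mult_distrib mult.assoc[symmetric])
  have "2 * y * 1 \<le> y\<^sup>2 + 1\<^sup>2" by (rule sum_squares_bound)
  then have "y \<le> 1 + y\<^sup>2" using y(2) by simp
  moreover have "1 + y\<^sup>2 > 0" by (simp add: add_pos_nonneg)
  ultimately have "sqrt eps * y / (1 + y\<^sup>2) \<le> sqrt eps * 1"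
    using assms by (simp add: pos_divide_le_eq mult_left_mono)
  then have "?q \<le> eps powr (1/2)" using assms unfolding norm_eps_symbol[OF assms(1)] y by (simp add: powr_half_sqrt)
  then have 1: "?q powr (1/4) \<le> (eps powr (1/2)) powr (1/4)" by (intro powr_mono2) auto
  have 2: "?q powr (3/4) \<le> (2 * wt k powr (- 1)) powr (3/4)" by (intro powr_mono2 norm_eps_symbol_le assms) auto
  have "?q = ?q powr (1/4 + 3/4)" by simp
  also have "\<dots> = ?q powr (1/4) * ?q powr (3/4)" by (rule powr_add)
  also have "\<dots> \<le> (eps powr (1/2)) powr (1/4) * (2 * wt k powr (- 1)) powr (3/4)" by (intro mult_mono 1 2) auto
  also have "\<dots> = 2 powr (3/4) * (eps powr (1/8) * wt k powr (- 3/4))" by (simp only: powr_powr powr_mult) simp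
  also have "\<dots> \<le> 2 * (eps powr (1/8) * wt k powr (- 3/4))"
    using powr_mono[of "3/4" 1 "2::real"] by (intro mult_right_mono) auto
  finally show ?thesis by (simp add: mult.assoc)
qed

lemma eps_wt_square_le:
  assumes "0 < eps" "eps \<le> 1"
  shows "eps * (wt k)\<^sup>2 \<le> 2 * (1 + eps * (of_int k)\<^sup>2)"
proof -
  define y where "y = \<bar>real_of_int k\<bar>"
  have y: "(real_of_int k)\<^sup>2 = y\<^sup>2" "y \<ge> 0" by (simp_all add: y_def)
  have "2 * y * 1 \<le> y\<^sup>2 + 1\<^sup>2" by (rule sum_squares_bound)
  then have "(1 + y)\<^sup>2 \<le> 2 * (1 + y\<^sup>2)" by (simp add: power2_sum)
  then have "eps * (1 + y)\<^sup>2 \<le> eps * (2 * (1 + y\<^sup>2))" using assms by (intro mult_left_mono) auto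
  also have "\<dots> \<le> 2 * (1 + eps * y\<^sup>2)" using assms by (simp add: distrib_left)
  finally show ?thesis unfolding y by (simp add: wt_def y_def)
qed

text \<open>The two derivatives gained from the denominator cost a factor 1/eps; this is the origin
  of the 1/eps in the error estimate.\<close>

lemma inverse_one_plus_eps_le:
  assumes "0 < eps" "eps \<le> 1"
  shows "1 / (1 + eps * (of_int k)\<^sup>2) \<le> 2 / eps * wt k powr (- 2)"
proof -
  have pos: "1 + eps * (real_of_int k)\<^sup>2 > 0" using assms by (simp add: add_pos_nonneg)
  have "1 / (1 + eps * (of_int k)\<^sup>2) \<le> 2 / (eps * (wt k)\<^sup>2)"
    using eps_wt_square_le[OF assms, of k] pos assms wt_pos[of k] by (simp add: divide_simps mult_ac)
  also have "\<dots> = 2 / eps * wt k powr (- 2)" using wt_pos[of k] by (simp add: powr_minus powr_numeral divide_inverse)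
  finally show ?thesis .
qed

lemma norm_symbol_LP_le:
  "\<exists>C\<ge>0. \<forall>eps k. 0 < eps \<and> eps \<le> 1 \<longrightarrow> cmod (symbol_LP P eps k) \<le> C / eps * wt k powr (real (degree P) - 2)"
proof -
  define A where "A = (\<Sum>i\<le>degree P. cmod (coeff P i))"
  have A: "A \<ge> 0" by (simp add: A_def sum_nonneg)
  have P: "cmod (poly P (\<i> * of_int k)) \<le> A * wt k ^ degree P" for k
  proof -
    have "cmod (poly P (\<i> * of_int k)) \<le> (\<Sum>i\<le>degree P. cmod (coeff P i) * wt k ^ degree P)"
      unfolding poly_altdef
    proof (rule sum_norm_le)
      fix i assume "i \<in> {..degree P}"
      have "\<bar>real_of_int k\<bar> ^ i \<le> wt k ^ i" by (intro power_mono) (auto simp: wt_def)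
      also have "\<dots> \<le> wt k ^ degree P" using \<open>i \<in> {..degree P}\<close> by (intro power_increasing wt_ge_1) auto
      finally show "cmod (coeff P i * (\<i> * of_int k) ^ i) \<le> cmod (coeff P i) * wt k ^ degree P"
        by (simp add: norm_mult norm_power mult_left_mono)
    qed
    then show ?thesis by (simp add: A_def sum_distrib_right)
  qed
  have "cmod (symbol_LP P eps k) \<le> (2 * A) / eps * wt k powr (real (degree P) - 2)" if eps: "0 < eps" "eps \<le> 1" for eps k
  proof -
    have pos: "1 + eps * (real_of_int k)\<^sup>2 > 0" using eps by (simp add: add_pos_nonneg)
    have "cmod (symbol_LP P eps k) = cmod (poly P (\<i> * of_int k)) * (1 / (1 + eps * (of_int k)\<^sup>2))"
      unfolding symbol_LP_def norm_divide norm_of_real using pos by simp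
    also have "\<dots> \<le> (A * wt k ^ degree P) * (2 / eps * wt k powr (- 2))"
      using A pos wt_pos[of k] by (intro mult_mono P inverse_one_plus_eps_le eps) auto
    also have "\<dots> = (2 * A) / eps * (wt k powr real (degree P) * wt k powr (- 2))"
      using wt_pos[of k] by (simp add: powr_realpow)
    also have "wt k powr real (degree P) * wt k powr (- 2) = wt k powr (real (degree P) - 2)"
      by (subst powr_add[symmetric]) simp
    finally show ?thesis .
  qed
  then show ?thesis using A by (intro exI[of _ "2 * A"]) auto
qed

text \<open>Along the segment from 0 to an imaginary \<open>z\<close> the exponential stays on the
  unit circle, so its speed is |z|.\<close>

lemma norm_exp_imaginary_minus_1_le:
  fixes z :: complex
  assumes "Re z = 0"
  shows "cmod (exp z - 1) \<le> cmod z"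
proof -
  have "cmod (exp (complex_of_real 1 * z) - exp (complex_of_real 0 * z)) \<le> cmod z * (1 - 0)"
  proof (rule norm_diff_le_vector_derivative)
    fix t :: real
    show "((\<lambda>t. exp (complex_of_real t * z)) has_vector_derivative z * exp (complex_of_real t * z)) (at t within {0..1})"
      using exp_scaleR_has_vector_derivative_right[of z t] by (simp add: scaleR_conv_of_real mult.commute)
    show "cmod (z * exp (complex_of_real t * z)) \<le> cmod z" using assms by (simp add: norm_mult)
  qed simp
  then show ?thesis by simp
qed

lemma lie_step_fourier_coeff:
  assumes "lie_step P eps tau f f'" "square_integrable f"
  shows "square_integrable f'"
    "fourier_coeff f' k = exp (- complex_of_real tau * symbol_LP P eps k) *
       (fourier_coeff f k - complex_of_real tau * (eps_symbol eps k * fourier_coeff (\<lambda>x. (f x)\<^sup>2) k))"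
proof -
  obtain g where g: "is_multiplier_image (symbol_L eps) (\<lambda>x. (f x)\<^sup>2) g"
    "is_multiplier_image (\<lambda>k. exp (- complex_of_real tau * symbol_LP P eps k))
            (\<lambda>x. f x - complex_of_real (tau * eps) * g x) f'"
    using assms(1) unfolding lie_step_def by blast
  have sg: "square_integrable g" using g(1) by (simp add: is_multiplier_image_def)
  show "square_integrable f'" using g(2) by (simp add: is_multiplier_image_def)
  have "fourier_coeff f' k = exp (- complex_of_real tau * symbol_LP P eps k) * 
     fourier_coeff (\<lambda>x. f x - complex_of_real (tau * eps) * g x) k"
    using g(2) by (simp add: is_multiplier_image_def)
  also have "fourier_coeff (\<lambda>x. f x - complex_of_real (tau * eps) * g x) k = fourier_coeff f k - complex_of_real (tau * eps) * fourier_coeff g k"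
    using fourier_coeff_lincomb[OF assms(2)[THEN square_integrable_imp_integrable] sg[THEN square_integrable_imp_integrable], of 1 "- complex_of_real (tau * eps)"]
    by simp
  also have "fourier_coeff g k = symbol_L eps k * fourier_coeff (\<lambda>x. (f x)\<^sup>2) k"
    using g(1) by (simp add: is_multiplier_image_def)
  finally show "fourier_coeff f' k = exp (- complex_of_real tau * symbol_LP P eps k) *
       (fourier_coeff f k - complex_of_real tau * (eps_symbol eps k * fourier_coeff (\<lambda>x. (f x)\<^sup>2) k))"
    by (simp add: eps_symbol_def mult_ac)
qed

locale bbm_splitting =
  fixes P :: "complex poly" and lam :: nat and r :: real
  assumes degree_P: "degree P = lam" and lam_ge_1: "lam \<ge> 1"
    and Re_poly: "\<forall>x::real. Re (poly P (\<i> * complex_of_real x)) = 0"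
    and r_gt_half: "r > 1 / 2"
begin

text \<open>The low regularity \<open>s\<close> in which the factors of the quadratic term are measured: \<open>\<epsilon> L\<^sub>\<epsilon>\<close>
  gains one derivative, hence maps \<open>H\<^sup>s\<close> into \<open>H\<^sup>r\<close>.\<close>

definition s :: real where "s = max 0 (r - 1)"

abbreviation \<sigma> :: real where "\<sigma> \<equiv> solution_regularity r lam"

text \<open>\<open>r - s > 1/2\<close> makes elements of H^r multipliers of H^s,
  \<open>r - 1 \<le> s\<close> lets the gained derivative lead from H^s to H^r, and
  \<open>r - 2 + real lam \<le> \<sigma>\<close> puts the linear part of the velocity into
  H^r.\<close>

lemma exponents: "0 \<le> s" "r - s > 1/2" "r - 1 \<le> s" "s \<le> r" "s \<le> \<sigma>" "0 \<le> \<sigma>" "r - 2 + real lam \<le> \<sigma>"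
  using r_gt_half lam_ge_1 by (auto simp: s_def solution_regularity_def max_def)

lemma Re_symbol: "Re (symbol_LP P eps k) = 0"
  using Re_poly[rule_format, of "of_int k"] by (simp add: symbol_LP_def)

lemma norm_exp_symbol: "cmod (exp (- complex_of_real t * symbol_LP P eps k)) = 1"
  by (simp add: Re_symbol)

lemma hbound_eps_symbol:
  assumes eps: "0 < eps" "eps \<le> 1" and a: "hbound s a A"
  shows "hbound r (\<lambda>k. eps_symbol eps k * a k) (2 * A)"
proof (rule hbound_multiplier[OF a])
  fix k
  have "wt k powr r * (cmod (eps_symbol eps k) * cmod (a k)) \<le> wt k powr r * ((2 * wt k powr (- 1)) * cmod (a k))"
    by (intro mult_left_mono mult_right_mono norm_eps_symbol_le eps) auto
  also have "\<dots> = 2 * ((wt k powr r * wt k powr (- 1)) * cmod (a k))" by (simp only: mult_ac)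
  also have "wt k powr r * wt k powr (- 1) = wt k powr (r - 1)" by (subst powr_add[symmetric]) simp
  also have "2 * (wt k powr (r - 1) * cmod (a k)) \<le> 2 * (wt k powr s * cmod (a k))"
    using exponents by (intro mult_left_mono mult_right_mono powr_mono wt_ge_1) auto
  finally show "wt k powr r * cmod (eps_symbol eps k * a k) \<le> 2 * (wt k powr s * cmod (a k))" by (simp add: norm_mult)
qed simp

definition velocity :: "real \<Rightarrow> (real \<Rightarrow> complex) \<Rightarrow> int \<Rightarrow> complex" where
  "velocity eps f k = - (symbol_LP P eps k * fourier_coeff f k) - eps_symbol eps k * fourier_coeff (\<lambda>x. (f x)\<^sup>2) k"

text \<open>For nonzero k, eps k / (1 + eps k^2) = 1/k - 1/(k (1 + eps k^2)). The first term carries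
  Hilbert's kernel, and Parseval bounds the L^1 norm of the square; the second is at most of order
  <k>^(-2) / eps and therefore summable.\<close>

lemma mult_bound_eps_symbol_square_low:
  assumes eps: "0 < eps" "eps \<le> 1" and f: "square_integrable f" and M: "hbound 0 (fourier_coeff f) M"
  shows "mult_bound 0 (\<lambda>k. eps_symbol eps k * fourier_coeff (\<lambda>x. (f x)\<^sup>2) k) ((pi + 2 * wt_sum 2) * (M\<^sup>2 / eps))"
proof -
  let ?h = "fourier_coeff (\<lambda>x. (f x)\<^sup>2)" and ?m = "\<lambda>k. if k = 0 then 0 else \<i> / of_int k"
  have ih: "integrable torus (\<lambda>x. (f x)\<^sup>2)" using square_integrable_mult[OF f f] by (simp add: power2_eq_square)
  have w0: "wt k powr 0 = 1" for k using wt_pos[of k] by simp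
  have "(\<Sum>j\<in>J. (cmod (fourier_coeff f j))\<^sup>2) \<le> M\<^sup>2" if "finite J" for J
    using hboundD[OF M that] unfolding L2_set_def w0 by (simp add: sqrt_le_D)
  then have "integral\<^sup>L torus (\<lambda>x. (cmod (f x))\<^sup>2) \<le> 2 * pi * M\<^sup>2" by (rule parseval_le[OF f])
  then have "pi * (integral\<^sup>L torus (\<lambda>x. cmod ((f x)\<^sup>2)) / (2 * pi)) \<le> pi * M\<^sup>2" by (simp add: norm_power field_simps)
  also have "\<dots> \<le> pi * (M\<^sup>2 / eps)" using eps by (intro mult_left_mono) (simp_all add: le_divide_eq mult_left_le)
  finally have 1: "mult_bound 0 (\<lambda>k. ?h k * ?m k) (pi * (M\<^sup>2 / eps))"
    by (rule mult_bound_mono[OF mult_bound_fourier_coeff_mult[OF mult_bound_hilbert ih]])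
  have 2: "mult_bound 0 (\<lambda>k. - (?h k * ?m k / complex_of_real (1 + eps * (of_int k)\<^sup>2))) ((2 * M\<^sup>2 / eps) * wt_sum 2)"
  proof (rule mult_bound_wiener_decay)
    fix k :: int
    have pos: "1 + eps * (real_of_int k)\<^sup>2 > 0" using eps by (simp add: add_pos_nonneg)
    have h: "cmod (?h k) \<le> M\<^sup>2" using fourier_coeff_square_bound[OF f order_refl M, of k] by (simp only: w0 mult_1)
    have m: "cmod (?m k) \<le> 1" by (auto simp: norm_divide divide_le_eq)
    have "cmod (- (?h k * ?m k / complex_of_real (1 + eps * (of_int k)\<^sup>2))) = (cmod (?h k) * cmod (?m k)) * (1 / (1 + eps * (of_int k)\<^sup>2))"
      unfolding norm_minus_cancel norm_divide norm_mult norm_of_real using pos by simp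
    also have "\<dots> \<le> (M\<^sup>2 * 1) * (2 / eps * wt k powr (- 2))"
      using pos by (intro mult_mono h m inverse_one_plus_eps_le eps) auto
    finally show "wt k powr 0 * cmod (- (?h k * ?m k / complex_of_real (1 + eps * (of_int k)\<^sup>2))) \<le> 2 * M\<^sup>2 / eps * wt k powr (- 2)"
      unfolding w0 mult_1 by (simp add: mult_ac)
  qed (use eps in auto)
  have "eps_symbol eps k * ?h k = ?h k * ?m k + - (?h k * ?m k / complex_of_real (1 + eps * (of_int k)\<^sup>2))" for k
  proof (cases "k = 0")
    case True then show ?thesis by (simp add: eps_symbol_def symbol_L_def)
  next
    case False
    define d where "d = complex_of_real (1 + eps * (of_int k)\<^sup>2)"
    have "1 + eps * (real_of_int k)\<^sup>2 > 0" using eps by (simp add: add_pos_nonneg)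
    then have d0: "d \<noteq> 0" unfolding d_def of_real_eq_0_iff by simp
    have d: "complex_of_real eps * (of_int k * of_int k) = d - 1" by (simp add: d_def power2_eq_square)
    have "eps_symbol eps k = \<i> * (complex_of_real eps * (of_int k * of_int k)) / (of_int k * d)"
      unfolding eps_symbol_def symbol_L_def d_def[symmetric] using False d0 by (simp add: field_simps)
    also have "\<dots> = \<i> / of_int k - \<i> / of_int k / d" unfolding d using False d0 by (simp add: field_simps)
    finally have e: "eps_symbol eps k = \<i> / of_int k - \<i> / of_int k / d" .
    show ?thesis unfolding d_def[symmetric] e using False by (simp add: left_diff_distrib right_diff_distrib mult.commute)
  qed
  then have "mult_bound 0 (\<lambda>k. eps_symbol eps k * ?h k) (pi * (M\<^sup>2 / eps) + (2 * M\<^sup>2 / eps) * wt_sum 2)"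
    using mult_bound_add[OF 1 2] by simp
  then show ?thesis by (simp add: algebra_simps add_divide_distrib)
qed

text \<open>For s > 0 the coefficient bound for the square and the gained derivative give exactly
  the decay of \<open>mult_bound_critical_decay\<close>. At s = 0 this decay alone is insufficient,
  and integrability of the square is used.\<close>

lemma mult_bound_eps_symbol_square:
  "\<exists>C\<ge>0. \<forall>eps f M. 0 < eps \<and> eps \<le> 1 \<and> square_integrable f \<and> hbound \<sigma> (fourier_coeff f) M \<longrightarrow>
    mult_bound s (\<lambda>k. eps_symbol eps k * fourier_coeff (\<lambda>x. (f x)\<^sup>2) k) (C * (M\<^sup>2 / eps))"
proof (cases "r \<le> 1")
  case True
  then have "s = 0" by (simp add: s_def)
  then show ?thesis using wt_sum_nonneg[of 2] mult_bound_eps_symbol_square_low hbound_exponent_mono[OF _ exponents(6)]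
    by (intro exI[of _ "pi + 2 * wt_sum 2"]) auto
next
  case False
  then have s: "s > 0" by (simp add: s_def)
  have C0: "critical_const s \<ge> 0"
    unfolding critical_const_def using s by (intro mult_nonneg_nonneg add_nonneg_nonneg wt_sum_nonneg real_sqrt_ge_zero) auto
  show ?thesis
  proof (intro exI[of _ "2 * critical_const s"] conjI allI impI, goal_cases)
    case 1 then show ?case using C0 by simp
  next
    case (2 eps f M)
    then have eps: "0 < eps" "eps \<le> 1" and f: "square_integrable f" and M: "hbound s (fourier_coeff f) M"
      using hbound_exponent_mono[OF _ exponents(5)] by auto
    have "mult_bound s (\<lambda>k. eps_symbol eps k * fourier_coeff (\<lambda>x. (f x)\<^sup>2) k) ((2 * M\<^sup>2) * critical_const s)"
    proof (rule mult_bound_critical_decay[OF s])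
      fix k
      have "wt k powr s * cmod (eps_symbol eps k * fourier_coeff (\<lambda>x. (f x)\<^sup>2) k) =
        cmod (eps_symbol eps k) * (wt k powr s * cmod (fourier_coeff (\<lambda>x. (f x)\<^sup>2) k))" by (simp add: norm_mult)
      also have "\<dots> \<le> (2 * wt k powr (- 1)) * M\<^sup>2"
        by (intro mult_mono norm_eps_symbol_le fourier_coeff_square_bound eps f M exponents) auto
      finally show "wt k powr s * cmod (eps_symbol eps k * fourier_coeff (\<lambda>x. (f x)\<^sup>2) k) \<le> 2 * M\<^sup>2 * wt k powr (- 1)"
        by (simp only: mult_ac)
    qed simp
    then show ?case
    proof (rule mult_bound_mono)
      have "M\<^sup>2 \<le> M\<^sup>2 / eps" using eps by (simp add: le_divide_eq mult_left_le)
      then show "2 * M\<^sup>2 * critical_const s \<le> 2 * critical_const s * (M\<^sup>2 / eps)"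
        using mult_left_mono[of "M\<^sup>2" "M\<^sup>2 / eps" "2 * critical_const s"] C0 by (simp only: mult_ac)
    qed
  qed
qed

lemma velocity_mult_bound:
  "\<exists>C\<ge>0. \<forall>eps f M. 0 < eps \<and> eps \<le> 1 \<and> square_integrable f \<and> hbound \<sigma> (fourier_coeff f) M \<longrightarrow>
    mult_bound s (velocity eps f) (C * (M + M\<^sup>2) / eps)"
proof -
  obtain C1 where C1: "C1 \<ge> 0" "\<And>eps k. 0 < eps \<and> eps \<le> 1 \<Longrightarrow> cmod (symbol_LP P eps k) \<le> C1 / eps * wt k powr (real lam - 2)"
    using norm_symbol_LP_le[of P] degree_P by auto
  obtain C2 where C2: "C2 \<ge> 0" "\<And>eps f M. 0 < eps \<and> eps \<le> 1 \<and> square_integrable f \<and> hbound \<sigma> (fourier_coeff f) M \<Longrightarrow>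
    mult_bound s (\<lambda>k. eps_symbol eps k * fourier_coeff (\<lambda>x. (f x)\<^sup>2) k) (C2 * (M\<^sup>2 / eps))"
    using mult_bound_eps_symbol_square by blast
  define W where "W = sqrt (wt_sum (2 * (r - s)))"
  have W: "W \<ge> 0" unfolding W_def using exponents by (intro real_sqrt_ge_zero wt_sum_nonneg) auto
  show ?thesis
  proof (intro exI[of _ "W * C1 + C2"] conjI allI impI, goal_cases)
    case 1 then show ?case using C1 C2 W by simp
  next
    case (2 eps f M)
    then have eps: "0 < eps" "eps \<le> 1" and f: "square_integrable f" and M: "hbound \<sigma> (fourier_coeff f) M" by auto
    have M0: "M \<ge> 0" by (rule hbound_nonneg[OF M])
    have "hbound r (\<lambda>k. symbol_LP P eps k * fourier_coeff f k) ((C1 / eps) * M)"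
    proof (rule hbound_multiplier[OF M])
      fix k
      have "wt k powr r * (cmod (symbol_LP P eps k) * cmod (fourier_coeff f k)) \<le> 
        wt k powr r * ((C1 / eps * wt k powr (real lam - 2)) * cmod (fourier_coeff f k))"
        using eps by (intro mult_left_mono mult_right_mono C1) auto
      also have "\<dots> = C1 / eps * ((wt k powr r * wt k powr (real lam - 2)) * cmod (fourier_coeff f k))" by (simp only: mult_ac)
      also have "wt k powr r * wt k powr (real lam - 2) = wt k powr (r - 2 + real lam)"
        by (subst powr_add[symmetric]) (simp add: algebra_simps)
      also have "C1 / eps * (wt k powr (r - 2 + real lam) * cmod (fourier_coeff f k)) \<le> C1 / eps * (wt k powr \<sigma> * cmod (fourier_coeff f k))"
        using C1(1) eps exponents(7) by (intro mult_left_mono mult_right_mono powr_mono wt_ge_1) auto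
      finally show "wt k powr r * cmod (symbol_LP P eps k * fourier_coeff f k) \<le> C1 / eps * (wt k powr \<sigma> * cmod (fourier_coeff f k))"
        by (simp add: norm_mult)
    qed (use C1(1) eps in auto)
    from mult_bound_hbound[OF exponents(1,2) hbound_uminus[OF this]]
    have 1: "mult_bound s (\<lambda>k. - (symbol_LP P eps k * fourier_coeff f k)) (W * ((C1 / eps) * M))" by (simp add: W_def)
    have 2: "mult_bound s (\<lambda>k. (- 1) * (eps_symbol eps k * fourier_coeff (\<lambda>x. (f x)\<^sup>2) k)) (cmod (- 1) * (C2 * (M\<^sup>2 / eps)))"
      using eps f M by (intro mult_bound_scale C2) auto
    have "mult_bound s (velocity eps f) (W * ((C1 / eps) * M) + C2 * (M\<^sup>2 / eps))"
      using mult_bound_add[OF 1 2] unfolding velocity_def by simp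
    then show ?case
    proof (rule mult_bound_mono)
      have "W * C1 * M + C2 * M\<^sup>2 \<le> (W * C1 + C2) * (M + M\<^sup>2)"
        using W C1(1) C2(1) M0 by (simp add: algebra_simps)
      then have "(W * C1 * M + C2 * M\<^sup>2) / eps \<le> (W * C1 + C2) * (M + M\<^sup>2) / eps" using eps by (intro divide_right_mono) auto
      then show "W * ((C1 / eps) * M) + C2 * (M\<^sup>2 / eps) \<le> (W * C1 + C2) * (M + M\<^sup>2) / eps" by (simp add: add_divide_distrib)
    qed
  qed
qed

end

section \<open>Local error and stability\<close>

context bbm_splitting begin

text \<open>Undoing the linear flow turns the local error into the increment of a function of time
  whose derivative vanishes at \<open>t0\<close> and is O(tau) in H^r; one more integration gives
  tau^2.\<close>

lemma local_error:
  "\<exists>C\<ge>0. \<forall>eps tau t0 T u M. 0 < eps \<and> eps \<le> 1 \<and> 0 \<le> tau \<and> 0 \<le> t0 \<and> t0 + tau \<le> T \<and>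
     exact_solution P eps \<sigma> T u \<and> (\<forall>t\<in>{0..T}. hbound \<sigma> (fourier_coeff (u t)) M) \<longrightarrow>
     hbound r (\<lambda>k. fourier_coeff (u (t0 + tau)) k - exp (- complex_of_real tau * symbol_LP P eps k) *
       (fourier_coeff (u t0) k - complex_of_real tau * (eps_symbol eps k * fourier_coeff (\<lambda>x. (u t0 x)\<^sup>2) k)))
      (C * (M\<^sup>2 + M ^ 3) / eps * tau\<^sup>2)"
proof -
  obtain C1 where C1: "C1 \<ge> 0" "\<And>eps k. 0 < eps \<and> eps \<le> 1 \<Longrightarrow> cmod (symbol_LP P eps k) \<le> C1 / eps * wt k powr (real lam - 2)"
    using norm_symbol_LP_le[of P] degree_P by auto
  obtain C2 where C2: "C2 \<ge> 0" "\<And>eps f M. 0 < eps \<and> eps \<le> 1 \<and> square_integrable f \<and> hbound \<sigma> (fourier_coeff f) M \<Longrightarrow>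
    mult_bound s (velocity eps f) (C2 * (M + M\<^sup>2) / eps)"
    using velocity_mult_bound by blast
  define W where "W = sqrt (wt_sum 2)"
  have W: "W \<ge> 0" unfolding W_def by (intro real_sqrt_ge_zero wt_sum_nonneg) auto
  show ?thesis
  proof (intro exI[of _ "2 * C1 * W + 4 * C2"] conjI allI impI, goal_cases)
    case 1 then show ?case using C1(1) C2(1) W by simp
  next
    case (2 eps tau t0 T u M)
    then have eps: "0 < eps" "eps \<le> 1" and tau: "0 \<le> tau" and t0: "0 \<le> t0" "t0 + tau \<le> T"
      and u: "exact_solution P eps \<sigma> T u" and M: "\<And>t. t \<in> {0..T} \<Longrightarrow> hbound \<sigma> (fourier_coeff (u t)) M" by auto
    have T: "{t0..t0 + tau} \<subseteq> {0..T}" using t0 by auto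
    have M0: "M \<ge> 0" using M[of t0] t0 tau by (intro hbound_nonneg) auto
    have su: "square_integrable (u t)" if "t \<in> {0..T}" for t
      using u that by (auto simp: exact_solution_def sobolev_def)
    let ?a = "\<lambda>t. fourier_coeff (u t)" and ?n = "\<lambda>t. fourier_coeff (\<lambda>x. (u t x)\<^sup>2)"
    let ?q = "eps_symbol eps" and ?\<phi> = "symbol_LP P eps"
    have da: "((\<lambda>t. ?a t k) has_vector_derivative velocity eps (u t) k) (at t within {t0..t0 + tau})"
      if "t \<in> {t0..t0 + tau}" for t k
    proof -
      have "t \<in> {0..T}" using that T by blast
      then have "((\<lambda>t'. ?a t' k) has_vector_derivative
           - (symbol_LP P eps k * ?a t k) - complex_of_real eps * (symbol_L eps k * ?n t k)) (at t within {0..T})"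
        using u unfolding exact_solution_def by blast
      then have "((\<lambda>t'. ?a t' k) has_vector_derivative velocity eps (u t) k) (at t within {0..T})"
        by (simp add: velocity_def eps_symbol_def mult.assoc)
      then show ?thesis by (rule has_vector_derivative_within_subset[OF _ T])
    qed
    define h where "h = (\<lambda>k t. exp (complex_of_real (t - t0) * ?\<phi> k) * ?a t k + complex_of_real (t - t0) * (?q k * ?n t0 k))"
    define h' where "h' = (\<lambda>k t. ?q k * ?n t0 k - exp (complex_of_real (t - t0) * ?\<phi> k) * (?q k * ?n t k))"
    \<comment> \<open>The factor 4 is the 2 of \<open>hbound_eps_symbol\<close> times the 2 from the
      sum of two values of u.\<close>
    define K where "K = (2 * C1 * W * M\<^sup>2 + 4 * C2 * (M\<^sup>2 + M ^ 3)) / eps"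
    have dh: "(h k has_vector_derivative h' k t) (at t within {t0..t0 + tau})" if t: "t \<in> {t0..t0 + tau}" for t k
    proof -
      have "((\<lambda>t. exp ((t - t0) *\<^sub>R ?\<phi> k)) has_vector_derivative 1 *\<^sub>R (exp ((t - t0) *\<^sub>R ?\<phi> k) * ?\<phi> k)) (at t within {t0..t0 + tau})"
      proof (rule vector_diff_chain_within[unfolded o_def])
        show "((\<lambda>t. t - t0) has_vector_derivative 1) (at t within {t0..t0 + tau})" 
          by (auto intro!: derivative_eq_intros simp: has_vector_derivative_def)
      qed (rule exp_scaleR_has_vector_derivative_right)
      then have e: "((\<lambda>t. exp (complex_of_real (t - t0) * ?\<phi> k)) has_vector_derivative exp (complex_of_real (t - t0) * ?\<phi> k) * ?\<phi> k) (at t within {t0..t0 + tau})"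
        by (simp add: scaleR_conv_of_real)
      have l: "((\<lambda>t. complex_of_real (t - t0)) has_vector_derivative 1) (at t within {t0..t0 + tau})"
        by (auto intro!: derivative_eq_intros simp: has_vector_derivative_def scaleR_conv_of_real)
      have "(h k has_vector_derivative (exp (complex_of_real (t - t0) * ?\<phi> k) * velocity eps (u t) k + 
         exp (complex_of_real (t - t0) * ?\<phi> k) * ?\<phi> k * ?a t k) + 1 * (?q k * ?n t0 k)) (at t within {t0..t0 + tau})"
        unfolding h_def by (intro has_vector_derivative_add has_vector_derivative_mult has_vector_derivative_mult_left e l da t)
      then show ?thesis by (simp add: h'_def velocity_def algebra_simps)
    qed
    have h'b: "hbound r (\<lambda>k. h' k t) (K * tau)" if t: "t \<in> {t0..t0 + tau}" for t
    proof -
      have t': "t \<in> {0..T}" "t0 \<in> {0..T}" using t T t0 tau by auto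
      define \<delta> where "\<delta> = t - t0"
      have \<delta>: "0 \<le> \<delta>" "\<delta> \<le> tau" using t by (auto simp: \<delta>_def)
      let ?d = "\<lambda>x. u t x - u t0 x" and ?w = "\<lambda>x. u t x + u t0 x"
      have sd: "square_integrable ?d" and sw: "square_integrable ?w"
        by (intro square_integrable_diff square_integrable_add su t')+
      \<comment> \<open>The phase difference has order lam - 2 and \<open>?q\<close> order -1. One
        power of decay is left over beyond \<open>wt k powr \<sigma>\<close>, so the bound for
        single coefficients of the square suffices.\<close>
      have 1: "hbound r (\<lambda>k. ?q k * (1 - exp (complex_of_real \<delta> * ?\<phi> k)) * ?n t k) (2 * (C1 / eps) * tau * M\<^sup>2 * sqrt (wt_sum (2 * 1)))"
      proof (rule hbound_decay)
        fix k
        have "cmod (1 - exp (complex_of_real \<delta> * ?\<phi> k)) \<le> cmod (complex_of_real \<delta> * ?\<phi> k)"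
          using norm_exp_imaginary_minus_1_le[of "complex_of_real \<delta> * ?\<phi> k"] Re_symbol by (simp add: norm_minus_commute)
        also have "\<dots> \<le> tau * (C1 / eps * wt k powr (real lam - 2))"
          unfolding norm_mult using \<delta> eps tau by (intro mult_mono C1) auto
        finally have e: "cmod (1 - exp (complex_of_real \<delta> * ?\<phi> k)) \<le> tau * (C1 / eps * wt k powr (real lam - 2))" .
        have w1: "wt k powr r * wt k powr (- 1) * wt k powr (real lam - 2) = wt k powr (r - 2 + real lam) * wt k powr (- 1)"
          unfolding powr_add[symmetric] by (simp add: algebra_simps)
        have "wt k powr r * cmod (?q k * (1 - exp (complex_of_real \<delta> * ?\<phi> k)) * ?n t k) =
          wt k powr r * (cmod (?q k) * cmod (1 - exp (complex_of_real \<delta> * ?\<phi> k)) * cmod (?n t k))"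
          unfolding norm_mult by simp
        also have "\<dots> \<le> wt k powr r * ((2 * wt k powr (- 1)) * (tau * (C1 / eps * wt k powr (real lam - 2))) * cmod (?n t k))"
          by (intro mult_left_mono mult_right_mono mult_mono norm_eps_symbol_le eps e) auto
        also have "\<dots> = 2 * (C1 / eps) * tau * ((wt k powr r * wt k powr (- 1) * wt k powr (real lam - 2)) * cmod (?n t k))"
          by (simp only: mult_ac)
        also have "\<dots> = 2 * (C1 / eps) * tau * ((wt k powr (r - 2 + real lam) * cmod (?n t k)) * wt k powr (- 1))"
          unfolding w1 by (simp only: mult_ac)
        also have "\<dots> \<le> 2 * (C1 / eps) * tau * ((wt k powr \<sigma> * cmod (?n t k)) * wt k powr (- 1))"
          using C1(1) eps tau exponents by (intro mult_left_mono mult_right_mono powr_mono wt_ge_1) auto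
        also have "\<dots> \<le> 2 * (C1 / eps) * tau * (M\<^sup>2 * wt k powr (- 1))"
          using C1(1) eps tau by (intro mult_left_mono mult_right_mono fourier_coeff_square_bound su M t' exponents) auto
        finally show "wt k powr r * cmod (?q k * (1 - exp (complex_of_real \<delta> * ?\<phi> k)) * ?n t k) \<le> 2 * (C1 / eps) * tau * M\<^sup>2 * wt k powr (- 1)"
          by (simp only: mult_ac)
      qed (use C1(1) eps tau in auto)
      have "mult_bound s (\<lambda>k. ?a t k - ?a t0 k) (C2 * (M + M\<^sup>2) / eps * (t - t0))"
      proof (rule mult_bound_mean_value[where \<beta> = "\<lambda>k t. ?a t k" and \<beta>' = "\<lambda>k t. velocity eps (u t) k"])
        have sub: "{t0..t} \<subseteq> {t0..t0 + tau}" using t by auto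
        show "((\<lambda>t. ?a t k) has_vector_derivative velocity eps (u t1) k) (at t1 within {t0..t})" if "t1 \<in> {t0..t}" for k t1
          by (rule has_vector_derivative_within_subset[OF da sub]) (use that sub in auto)
        show "mult_bound s (velocity eps (u t1)) (C2 * (M + M\<^sup>2) / eps)" if "t1 \<in> {t0..t}" for t1
        proof -
          have "t1 \<in> {0..T}" using that sub T by blast
          then show ?thesis using eps su M by (intro C2) auto
        qed
      qed (use t in auto)
      then have "mult_bound s (fourier_coeff ?d) (C2 * (M + M\<^sup>2) / eps * (t - t0))"
        using fourier_coeff_diff[OF su[OF t'(1)] su[OF t'(2)], abs_def] t' by simp
      moreover have "C2 * (M + M\<^sup>2) / eps * (t - t0) \<le> C2 * (M + M\<^sup>2) / eps * tau"
        using t C2(1) M0 eps by (intro mult_left_mono) auto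
      ultimately have md: "mult_bound s (fourier_coeff ?d) (C2 * (M + M\<^sup>2) / eps * tau)" by (rule mult_bound_mono)
      have hw: "hbound s (fourier_coeff ?w) (M + M)"
        using hbound_add[OF M[OF t'(1)] M[OF t'(2)]] fourier_coeff_add[OF su[OF t'(1)] su[OF t'(2)], abs_def] t'
        by (intro hbound_exponent_mono[OF _ exponents(5)]) simp
      have "hbound s (\<lambda>k. ?n t k - ?n t0 k) (C2 * (M + M\<^sup>2) / eps * tau * (M + M))"
        using hbound_mult[OF sw sd hw md] fourier_coeff_square_diff[OF su su, of t t0] t' by simp
      then have 2: "hbound r (\<lambda>k. - (?q k * (?n t k - ?n t0 k))) (2 * (C2 * (M + M\<^sup>2) / eps * tau * (M + M)))"
        by (intro hbound_uminus hbound_eps_symbol eps)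
      have "h' k t = ?q k * (1 - exp (complex_of_real \<delta> * ?\<phi> k)) * ?n t k + - (?q k * (?n t k - ?n t0 k))" for k
        by (simp add: h'_def \<delta>_def algebra_simps)
      then have "hbound r (\<lambda>k. h' k t) (2 * (C1 / eps) * tau * M\<^sup>2 * sqrt (wt_sum (2 * 1)) + 2 * (C2 * (M + M\<^sup>2) / eps * tau * (M + M)))"
        using hbound_add[OF 1 2] by simp
      also have "2 * (C1 / eps) * tau * M\<^sup>2 * sqrt (wt_sum (2 * 1)) + 2 * (C2 * (M + M\<^sup>2) / eps * tau * (M + M)) = K * tau"
        using eps by (simp add: K_def W_def field_simps power2_eq_square power3_eq_cube)
      finally show ?thesis .
    qed
    have main: "hbound r (\<lambda>k. h k (t0 + tau) - h k t0) (K * tau * tau)"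
    proof (rule hboundI)
      fix F :: "int set" assume F: "finite F"
      have "L2_set (\<lambda>k. wt k powr r * cmod (h k (t0 + tau) - h k t0)) F \<le> K * tau * (t0 + tau - t0)"
        by (rule L2_set_mean_value[OF F _ _ dh]) (use tau h'b hboundD[OF _ F] in auto)
      then show "L2_set (\<lambda>k. wt k powr r * cmod (h k (t0 + tau) - h k t0)) F \<le> K * tau * tau" by simp
    qed
    have "hbound r (\<lambda>k. ?a (t0 + tau) k - exp (- complex_of_real tau * ?\<phi> k) * (?a t0 k - complex_of_real tau * (?q k * ?n t0 k))) (1 * (K * tau * tau))"
    proof (rule hbound_multiplier[OF main])
      fix k
      have "?a (t0 + tau) k - exp (- complex_of_real tau * ?\<phi> k) * (?a t0 k - complex_of_real tau * (?q k * ?n t0 k)) =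
        exp (- complex_of_real tau * ?\<phi> k) * (h k (t0 + tau) - h k t0)"
        by (simp add: h_def algebra_simps exp_minus)
      then show "wt k powr r * cmod (?a (t0 + tau) k - exp (- complex_of_real tau * ?\<phi> k) * (?a t0 k - complex_of_real tau * (?q k * ?n t0 k)))
         \<le> 1 * (wt k powr r * cmod (h k (t0 + tau) - h k t0))"
        using norm_exp_symbol by (simp only: norm_mult)
    qed simp
    then show ?case
    proof (rule hbound_mono)
      have "2 * C1 * W * M\<^sup>2 + 4 * C2 * (M\<^sup>2 + M ^ 3) \<le> (2 * C1 * W + 4 * C2) * (M\<^sup>2 + M ^ 3)"
        using C1(1) W M0 by (simp add: algebra_simps)
      then have "K \<le> (2 * C1 * W + 4 * C2) * (M\<^sup>2 + M ^ 3) / eps" unfolding K_def using eps by (intro divide_right_mono) auto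
      then have "K * tau\<^sup>2 \<le> (2 * C1 * W + 4 * C2) * (M\<^sup>2 + M ^ 3) / eps * tau\<^sup>2" by (intro mult_right_mono) auto
      then show "1 * (K * tau * tau) \<le> (2 * C1 * W + 4 * C2) * (M\<^sup>2 + M ^ 3) / eps * tau\<^sup>2" by (simp add: power2_eq_square mult.assoc)
    qed
  qed
qed

text \<open>The difference lies in H^r and acts as a multiplier on the sum, which needs to be only
  in H^s; the gained derivative then returns the product to H^r. No 1/eps appears, which keeps the
  Gronwall exponential uniform in eps.\<close>

lemma stability:
  "\<exists>C\<ge>0. \<forall>eps tau f g A B E. 0 < eps \<and> eps \<le> 1 \<and> 0 \<le> tau \<and> square_integrable f \<and> square_integrable g \<and>
     hbound s (fourier_coeff f) A \<and> hbound s (fourier_coeff g) B \<and> hbound r (\<lambda>k. fourier_coeff f k - fourier_coeff g k) E \<longrightarrow>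
     hbound r (\<lambda>k. exp (- complex_of_real tau * symbol_LP P eps k) *
         (fourier_coeff f k - complex_of_real tau * (eps_symbol eps k * fourier_coeff (\<lambda>x. (f x)\<^sup>2) k)) -
       exp (- complex_of_real tau * symbol_LP P eps k) *
         (fourier_coeff g k - complex_of_real tau * (eps_symbol eps k * fourier_coeff (\<lambda>x. (g x)\<^sup>2) k)))
      ((1 + tau * (C * (A + B))) * E)"
proof -
  define W where "W = sqrt (wt_sum (2 * (r - s)))"
  have W: "W \<ge> 0" unfolding W_def using exponents by (intro real_sqrt_ge_zero wt_sum_nonneg) auto
  show ?thesis
  proof (intro exI[of _ "2 * W"] conjI allI impI, goal_cases)
    case 1 then show ?case using W by simp
  next
    case (2 eps tau f g A B E)
    then have eps: "0 < eps" "eps \<le> 1" and tau: "0 \<le> tau" and f: "square_integrable f" and g: "square_integrable g"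
      and A: "hbound s (fourier_coeff f) A" and B: "hbound s (fourier_coeff g) B"
      and E: "hbound r (\<lambda>k. fourier_coeff f k - fourier_coeff g k) E" by auto
    let ?n = "\<lambda>f. fourier_coeff (\<lambda>x. (f x)\<^sup>2)" and ?q = "eps_symbol eps" and ?e = "\<lambda>k. exp (- complex_of_real tau * symbol_LP P eps k)"
    have md: "mult_bound s (fourier_coeff (\<lambda>x. f x - g x)) (W * E)"
      using mult_bound_hbound[OF exponents(1,2) E] fourier_coeff_diff[OF f g, abs_def] by (simp add: W_def)
    have hw: "hbound s (fourier_coeff (\<lambda>x. f x + g x)) (A + B)"
      using hbound_add[OF A B] fourier_coeff_add[OF f g, abs_def] by simp
    have "hbound s (\<lambda>k. ?n f k - ?n g k) (W * E * (A + B))"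
      using hbound_mult[OF square_integrable_add[OF f g] square_integrable_diff[OF f g] hw md] fourier_coeff_square_diff[OF f g] by simp
    from hbound_eps_symbol[OF eps this]
    have q: "hbound r (\<lambda>k. ?q k * (?n f k - ?n g k)) (2 * (W * E * (A + B)))" .
    have "hbound r (\<lambda>k. - (complex_of_real tau * (?q k * (?n f k - ?n g k)))) (tau * (2 * (W * E * (A + B))))"
      using tau by (intro hbound_uminus hbound_multiplier[OF q]) (auto simp: norm_mult)
    from hbound_add[OF E this]
    have D: "hbound r (\<lambda>k. fourier_coeff f k - fourier_coeff g k + - (complex_of_real tau * (?q k * (?n f k - ?n g k)))) (E + tau * (2 * (W * E * (A + B))))" .
    have "hbound r (\<lambda>k. ?e k * (fourier_coeff f k - complex_of_real tau * (?q k * ?n f k)) - ?e k * (fourier_coeff g k - complex_of_real tau * (?q k * ?n g k)))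
      (1 * (E + tau * (2 * (W * E * (A + B)))))"
    proof (rule hbound_multiplier[OF D])
      fix k
      have "?e k * (fourier_coeff f k - complex_of_real tau * (?q k * ?n f k)) - ?e k * (fourier_coeff g k - complex_of_real tau * (?q k * ?n g k)) =
         ?e k * (fourier_coeff f k - fourier_coeff g k + - (complex_of_real tau * (?q k * (?n f k - ?n g k))))"
        by (simp add: algebra_simps)
      then show "wt k powr r * cmod (?e k * (fourier_coeff f k - complex_of_real tau * (?q k * ?n f k)) - ?e k * (fourier_coeff g k - complex_of_real tau * (?q k * ?n g k)))
        \<le> 1 * (wt k powr r * cmod (fourier_coeff f k - fourier_coeff g k + - (complex_of_real tau * (?q k * (?n f k - ?n g k)))))"
        using norm_exp_symbol by (simp only: norm_mult)
    qed simp
    then show ?case by (simp add: algebra_simps)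
  qed
qed

text \<open>The linear flow preserves H^s, and the decay 3/4 of the interpolated symbol makes the
  coefficient bound for the square summable. The recursion is quadratic, so only the factor
  eps^(1/8) can prevent blow-up.\<close>

lemma low_norm_growth:
  "\<exists>C\<ge>0. \<forall>eps tau f f' y. 0 < eps \<and> eps \<le> 1 \<and> 0 \<le> tau \<and> square_integrable f \<and> lie_step P eps tau f f' \<and>
     hbound s (fourier_coeff f) y \<longrightarrow> hbound s (fourier_coeff f') (y + C * eps powr (1/8) * tau * y\<^sup>2)"
proof -
  define W where "W = sqrt (wt_sum (2 * (3/4)))"
  have W: "W \<ge> 0" unfolding W_def by (intro real_sqrt_ge_zero wt_sum_nonneg) auto
  show ?thesis
  proof (intro exI[of _ "2 * W"] conjI allI impI, goal_cases)
    case 1 then show ?case using W by simp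
  next
    case (2 eps tau f f' y)
    then have eps: "0 < eps" "eps \<le> 1" and tau: "0 \<le> tau" and f: "square_integrable f" and l: "lie_step P eps tau f f'"
      and y: "hbound s (fourier_coeff f) y" by auto
    let ?n = "fourier_coeff (\<lambda>x. (f x)\<^sup>2)" and ?q = "eps_symbol eps" and ?e = "\<lambda>k. exp (- complex_of_real tau * symbol_LP P eps k)"
    have "hbound s (\<lambda>k. ?q k * ?n k) (2 * eps powr (1/8) * y\<^sup>2 * sqrt (wt_sum (2 * (3/4))))"
    proof (rule hbound_decay)
      fix k
      have "wt k powr s * cmod (?q k * ?n k) = cmod (?q k) * (wt k powr s * cmod (?n k))" by (simp add: norm_mult)
      also have "\<dots> \<le> (2 * eps powr (1/8) * wt k powr (- 3/4)) * y\<^sup>2"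
        by (intro mult_mono norm_eps_symbol_le_powr fourier_coeff_square_bound eps f y exponents) auto
      finally show "wt k powr s * cmod (?q k * ?n k) \<le> 2 * eps powr (1/8) * y\<^sup>2 * wt k powr (- (3/4))" by (simp add: mult_ac)
    qed auto
    then have q: "hbound s (\<lambda>k. ?q k * ?n k) (2 * eps powr (1/8) * y\<^sup>2 * W)" by (simp only: W_def)
    have "hbound s (\<lambda>k. complex_of_real tau * (?q k * ?n k)) (tau * (2 * eps powr (1/8) * y\<^sup>2 * W))"
      using tau by (intro hbound_multiplier[OF q]) (auto simp: norm_mult)
    from hbound_diff[OF y this]
    have D: "hbound s (\<lambda>k. fourier_coeff f k - complex_of_real tau * (?q k * ?n k)) (y + tau * (2 * eps powr (1/8) * y\<^sup>2 * W))" .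
    have "hbound s (fourier_coeff f') (1 * (y + tau * (2 * eps powr (1/8) * y\<^sup>2 * W)))"
      unfolding lie_step_fourier_coeff(2)[OF l f, abs_def]
    proof (rule hbound_multiplier[OF D])
      show "wt k powr s * cmod (?e k * (fourier_coeff f k - complex_of_real tau * (?q k * ?n k)))
        \<le> 1 * (wt k powr s * cmod (fourier_coeff f k - complex_of_real tau * (?q k * ?n k)))" for k
        unfolding norm_mult[of "?e k"] norm_exp_symbol by simp
    qed simp
    then show ?case by (simp add: mult_ac)
  qed
qed

end

section \<open>Global error\<close>

text \<open>Since $\tau^{9/8} = o(\tau)$, small steps let the sequence grow by at most 1 over the time \<open>T\<close>,
  whereas of the remaining large steps only boundedly many fit into \<open>T\<close>.\<close>

lemma superlinear_step_growth:
  fixes A M T :: real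
  assumes A: "A \<ge> 0" and M: "M \<ge> 0" and T: "T \<ge> 0"
  shows "\<exists>B. \<forall>tau n y. 0 < tau \<and> real n * tau \<le> T \<and> y 0 \<le> M \<and> (\<forall>k. 0 \<le> y k) \<and>
    (\<forall>k. y (Suc k) \<le> y k + A * tau powr (1/8) * tau * (y k)\<^sup>2) \<longrightarrow> (\<forall>k\<le>n. y k \<le> B)"
proof -
  define Y where "Y = M + 1"
  \<comment> \<open>Chosen so that tau^(1/8) \<rho> \<le> 1 limits the growth over time
    \<open>T\<close> to 1 as long as the sequence stays below \<open>Y\<close>. In the opposite case
    tau \<rho>^8 > 1, so at most \<open>N\<close> steps fit into \<open>T\<close>.\<close>
  define \<rho> where "\<rho> = A * T * Y\<^sup>2 + 1"
  have \<rho>: "\<rho> \<ge> 1" using A T by (simp add: \<rho>_def)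
  define N where "N = nat \<lceil>T * \<rho> ^ 8\<rceil>"
  \<comment> \<open>One step with tau replaced by \<open>T\<close>: a majorant independent of tau
    that is iterated at most \<open>N\<close> times.\<close>
  define g where "g = (\<lambda>x. x + A * T powr (1/8) * T * x\<^sup>2)"
  define G where "G = (\<lambda>k. (g ^^ k) M)"
  have G0: "0 \<le> G k" and Gs: "G k \<le> G (Suc k)" for k
  proof -
    have g: "x \<le> g x" for x using A T by (simp add: g_def)
    show "G k \<le> G (Suc k)" using g by (simp add: G_def)
    show "0 \<le> G k" by (induction k) (use M g in \<open>auto simp: G_def intro: order_trans\<close>)
  qed
  have G_mono: "G j \<le> G k" if "j \<le> k" for j k
    using lift_Suc_mono_le[of G, OF Gs that] .
  show ?thesis
  proof (intro exI[of _ "max Y (G N)"] allI impI)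
    fix tau :: real and n :: nat and y :: "nat \<Rightarrow> real" and k
    assume *: "0 < tau \<and> real n * tau \<le> T \<and> y 0 \<le> M \<and> (\<forall>k. 0 \<le> y k) \<and>
      (\<forall>k. y (Suc k) \<le> y k + A * tau powr (1/8) * tau * (y k)\<^sup>2)" and kn: "k \<le> n"
    then have tau: "0 < tau" and nT: "real n * tau \<le> T" and y0: "y 0 \<le> M" and y: "\<And>k. 0 \<le> y k"
      and step: "\<And>k. y (Suc k) \<le> y k + A * tau powr (1/8) * tau * (y k)\<^sup>2" by auto
    show "y k \<le> max Y (G N)"
    proof (cases "tau powr (1/8) * \<rho> \<le> 1")
      case True
      have small: "A * tau powr (1/8) * Y\<^sup>2 * T \<le> 1"
      proof -
        have "A * tau powr (1/8) * Y\<^sup>2 * T = tau powr (1/8) * (A * T * Y\<^sup>2)" by (simp only: mult_ac)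
        also have "\<dots> \<le> tau powr (1/8) * \<rho>" by (intro mult_left_mono) (auto simp: \<rho>_def)
        finally show ?thesis using True by simp
      qed
      have "y k \<le> M + real k * tau * (A * tau powr (1/8) * Y\<^sup>2)" using kn
      proof (induction k)
        case 0 then show ?case using y0 by simp
      next
        case (Suc k)
        then have IH: "y k \<le> M + real k * tau * (A * tau powr (1/8) * Y\<^sup>2)" by simp
        have "real k * tau \<le> real n * tau" using Suc.prems tau by (intro mult_right_mono) auto
        then have "real k * tau * (A * tau powr (1/8) * Y\<^sup>2) \<le> T * (A * tau powr (1/8) * Y\<^sup>2)"
          using A nT by (intro mult_right_mono) auto
        also have "\<dots> \<le> 1" using small by (simp add: mult.commute)
        \<comment> \<open>The bootstrap: the linear bound of the induction hypothesis justifies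
          replacing the square by \<open>Y\<^sup>2\<close> in the next step.\<close>
        finally have "y k \<le> Y" using IH by (simp add: Y_def)
        then have "(y k)\<^sup>2 \<le> Y\<^sup>2" using y by (intro power_mono) auto
        then have "A * tau powr (1/8) * tau * (y k)\<^sup>2 \<le> A * tau powr (1/8) * tau * Y\<^sup>2"
          using A tau by (intro mult_left_mono) auto
        then have "y (Suc k) \<le> M + real k * tau * (A * tau powr (1/8) * Y\<^sup>2) + A * tau powr (1/8) * tau * Y\<^sup>2"
          using step[of k] IH by linarith
        then show ?case by (simp add: algebra_simps)
      qed
      moreover have "real k * tau * (A * tau powr (1/8) * Y\<^sup>2) \<le> 1"
      proof -
        have "real k * tau \<le> real n * tau" using kn tau by (intro mult_right_mono) auto
        then have "real k * tau * (A * tau powr (1/8) * Y\<^sup>2) \<le> T * (A * tau powr (1/8) * Y\<^sup>2)"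
          using A nT by (intro mult_right_mono) auto
        then show ?thesis using small by (simp add: mult.commute)
      qed
      ultimately show ?thesis by (simp add: Y_def)
    next
      case False
      have "1 < (tau powr (1/8) * \<rho>) ^ 8" using False by (intro one_less_power) auto
      also have "\<dots> = tau * \<rho> ^ 8" using tau by (simp add: power_mult_distrib powr_realpow[symmetric] powr_powr)
      finally have big: "1 < tau * \<rho> ^ 8" .
      have "real n \<le> real n * (tau * \<rho> ^ 8)" using big by (simp add: mult_le_cancel_left1)
      also have "\<dots> = (real n * tau) * \<rho> ^ 8" by simp
      also have "\<dots> \<le> T * \<rho> ^ 8" using nT \<rho> by (intro mult_right_mono) auto
      finally have "n \<le> N" unfolding N_def by linarith
      have "y k \<le> G k" using kn
      proof (induction k)
        case 0 then show ?case using y0 by (simp add: G_def)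
      next
        case (Suc k)
        then have IH: "y k \<le> G k" by simp
        \<comment> \<open>Since a step is being taken, n \<ge> 1, and hence tau \<le> T.\<close>
        have "1 * tau \<le> real n * tau" using Suc.prems tau by (intro mult_right_mono) auto
        then have tT: "tau \<le> T" using nT by simp
        have "A * tau powr (1/8) * tau * (y k)\<^sup>2 \<le> A * T powr (1/8) * T * (G k)\<^sup>2"
          using A tau tT T IH y[of k] by (intro mult_mono power_mono powr_mono2) auto
        then have "y (Suc k) \<le> G k + A * T powr (1/8) * T * (G k)\<^sup>2" using step[of k] IH by linarith
        then show ?case by (simp add: G_def g_def)
      qed
      also have "\<dots> \<le> G N" using kn \<open>n \<le> N\<close> by (intro G_mono) simp
      finally show ?thesis by simp
    qed
  qed
qed

context bbm_splitting begin

lemma global_error: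
  fixes T M :: real
  assumes T: "T \<ge> 0" and M: "M \<ge> 0"
  shows "\<exists>C. \<forall>eps tau n u v. 0 < eps \<and> eps \<le> 1 \<and> 0 < tau \<and> real n * tau \<le> T \<and>
     exact_solution P eps \<sigma> (real n * tau) u \<and> (\<forall>t\<in>{0..real n * tau}. hbound \<sigma> (fourier_coeff (u t)) M) \<and>
     lie_splitting P eps tau (u 0) v \<longrightarrow>
     square_integrable (v n) \<and>
     hbound r (\<lambda>k. fourier_coeff (u (real n * tau)) k - fourier_coeff (v n) k) (tau * (1 / eps) * C)"
proof -
  obtain CL where CL: "CL \<ge> 0" "\<And>eps tau t0 T u M. 0 < eps \<and> eps \<le> 1 \<and> 0 \<le> tau \<and> 0 \<le> t0 \<and> t0 + tau \<le> T \<and>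
     exact_solution P eps \<sigma> T u \<and> (\<forall>t\<in>{0..T}. hbound \<sigma> (fourier_coeff (u t)) M) \<Longrightarrow>
     hbound r (\<lambda>k. fourier_coeff (u (t0 + tau)) k - exp (- complex_of_real tau * symbol_LP P eps k) *
       (fourier_coeff (u t0) k - complex_of_real tau * (eps_symbol eps k * fourier_coeff (\<lambda>x. (u t0 x)\<^sup>2) k)))
      (CL * (M\<^sup>2 + M ^ 3) / eps * tau\<^sup>2)"
    using local_error by blast
  obtain CS where CS: "CS \<ge> 0" "\<And>eps tau f g A B E. 0 < eps \<and> eps \<le> 1 \<and> 0 \<le> tau \<and> square_integrable f \<and> square_integrable g \<and>
     hbound s (fourier_coeff f) A \<and> hbound s (fourier_coeff g) B \<and> hbound r (\<lambda>k. fourier_coeff f k - fourier_coeff g k) E \<Longrightarrow>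
     hbound r (\<lambda>k. exp (- complex_of_real tau * symbol_LP P eps k) *
         (fourier_coeff f k - complex_of_real tau * (eps_symbol eps k * fourier_coeff (\<lambda>x. (f x)\<^sup>2) k)) -
       exp (- complex_of_real tau * symbol_LP P eps k) *
         (fourier_coeff g k - complex_of_real tau * (eps_symbol eps k * fourier_coeff (\<lambda>x. (g x)\<^sup>2) k)))
      ((1 + tau * (CS * (A + B))) * E)"
    using stability by blast
  obtain CA where CA: "CA \<ge> 0" "\<And>eps tau f f' y. 0 < eps \<and> eps \<le> 1 \<and> 0 \<le> tau \<and> square_integrable f \<and> lie_step P eps tau f f' \<and>
     hbound s (fourier_coeff f) y \<Longrightarrow> hbound s (fourier_coeff f') (y + CA * eps powr (1/8) * tau * y\<^sup>2)"
    using low_norm_growth by blast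
  define D where "D = CL * (M\<^sup>2 + M ^ 3)"
  have D: "D \<ge> 0" using CL(1) M by (simp add: D_def)
  \<comment> \<open>The error constant from discrete Gronwall, given an H^s bound \<open>B\<close>
    of the numerical solution.\<close>
  define bound where "bound = (\<lambda>B. D * T * exp (CS * (M + B) * T))"
  have bound0: "bound B \<ge> 0" for B using D T by (simp add: bound_def)
  \<comment> \<open>The error constant while the numerical solution stays within distance 1 of u. It
    sets the threshold tau G \<le> eps between the regimes, so it has to be fixed before
    \<open>B0\<close>.\<close>
  define G where "G = bound (M + 1)"
  obtain B0 where B0: "\<And>tau n y. 0 < tau \<and> real n * tau \<le> T \<and> y 0 \<le> M \<and> (\<forall>k. 0 \<le> y k) \<and>
    (\<forall>k. y (Suc k) \<le> y k + CA * G powr (1/8) * tau powr (1/8) * tau * (y k)\<^sup>2) \<Longrightarrow> (\<forall>k\<le>n. y k \<le> B0)"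
    using superlinear_step_growth[of "CA * G powr (1/8)" M T] CA(1) M T by auto
  define B where "B = max (M + 1) B0"
  show ?thesis
  proof (intro exI[of _ "bound B"] allI impI)
    fix eps tau :: real and n :: nat and u :: "real \<Rightarrow> real \<Rightarrow> complex" and v :: "nat \<Rightarrow> real \<Rightarrow> complex"
    assume "0 < eps \<and> eps \<le> 1 \<and> 0 < tau \<and> real n * tau \<le> T \<and>
     exact_solution P eps \<sigma> (real n * tau) u \<and> (\<forall>t\<in>{0..real n * tau}. hbound \<sigma> (fourier_coeff (u t)) M) \<and>
     lie_splitting P eps tau (u 0) v"
    then have eps: "0 < eps" "eps \<le> 1" and tau: "0 < tau" and nT: "real n * tau \<le> T"
      and u: "exact_solution P eps \<sigma> (real n * tau) u" and uM: "\<forall>t\<in>{0..real n * tau}. hbound \<sigma> (fourier_coeff (u t)) M"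
      and v0: "v 0 = u 0" and v: "\<And>k. lie_step P eps tau (v k) (v (Suc k))"
      by (auto simp: lie_splitting_def)
    have tn: "real k * tau \<in> {0..real n * tau}" if "k \<le> n" for k
      using that tau by (auto intro!: mult_right_mono)
    have su: "square_integrable (u (real k * tau))" if "k \<le> n" for k
      using u tn[OF that] by (auto simp: exact_solution_def sobolev_def)
    have us: "hbound s (fourier_coeff (u (real k * tau))) M" if "k \<le> n" for k
      using uM tn[OF that] by (intro hbound_exponent_mono[OF _ exponents(5)]) auto
    have sv: "square_integrable (v k)" for k
    proof (induction k)
      case 0 then show ?case using su[of 0] by (simp add: v0)
    next
      case (Suc k) then show ?case using lie_step_fourier_coeff(1)[OF v] by blast
    qed
    define err where "err = (\<lambda>k j. fourier_coeff (u (real k * tau)) j - fourier_coeff (v k) j)"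
    define b where "b = D / eps * tau\<^sup>2"
    have b: "b \<ge> 0" using D eps by (simp add: b_def)
    have step: "hbound r (err (Suc k)) ((1 + tau * (CS * (M + B'))) * E + b)"
      if k: "Suc k \<le> n" and B': "hbound s (fourier_coeff (v k)) B'" and E: "hbound r (err k) E" for k B' E
    proof -
      have t: "real k * tau + tau = real (Suc k) * tau" by (simp add: algebra_simps)
      have 1: "hbound r (\<lambda>j. fourier_coeff (u (real k * tau + tau)) j - exp (- complex_of_real tau * symbol_LP P eps j) *
       (fourier_coeff (u (real k * tau)) j - complex_of_real tau * (eps_symbol eps j * fourier_coeff (\<lambda>x. (u (real k * tau) x)\<^sup>2) j))) b"
        unfolding b_def D_def
        by (rule CL(2)[where T = "real n * tau"]) (use eps tau u uM tn[OF k] t in auto)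
      have 2: "hbound r (\<lambda>j. exp (- complex_of_real tau * symbol_LP P eps j) *
         (fourier_coeff (u (real k * tau)) j - complex_of_real tau * (eps_symbol eps j * fourier_coeff (\<lambda>x. (u (real k * tau) x)\<^sup>2) j)) -
         exp (- complex_of_real tau * symbol_LP P eps j) *
         (fourier_coeff (v k) j - complex_of_real tau * (eps_symbol eps j * fourier_coeff (\<lambda>x. (v k x)\<^sup>2) j))) ((1 + tau * (CS * (M + B'))) * E)"
        by (rule CS(2)) (use eps tau su[of k] sv us[of k] B' E k in \<open>auto simp: err_def\<close>)
      show ?thesis using hbound_add[OF 2 1] unfolding t lie_step_fourier_coeff(2)[OF v sv, symmetric]
        by (simp add: err_def[abs_def])
    qed
    \<comment> \<open>Only the iterates before \<open>k\<close> have to be bounded; this lets the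
      bootstrap conclude about \<open>v k\<close> itself.\<close>
    have err_bound: "hbound r (err k) (tau * (1 / eps) * bound B')"
      if "k \<le> n" and B': "\<And>j. j < k \<Longrightarrow> hbound s (fourier_coeff (v j)) B'" and B'0: "B' \<ge> 0" for k B'
    proof -
      define L where "L = CS * (M + B')"
      have L: "L \<ge> 0" using CS(1) M B'0 by (simp add: L_def)
      have x1: "1 \<le> 1 + tau * L" using tau L by simp
      have "hbound r (err j) (real j * b * (1 + tau * L) ^ j)" if "j \<le> k" for j using that
      proof (induction j)
        case 0
        have "err 0 = (\<lambda>_. 0)" by (simp add: err_def[abs_def] v0)
        then show ?case by (simp add: hbound_def L2_set_def)
      next
        case (Suc j)
        have "hbound r (err (Suc j)) ((1 + tau * L) * (real j * b * (1 + tau * L) ^ j) + b)"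
          unfolding L_def using Suc \<open>k \<le> n\<close> by (intro step B' Suc.IH[unfolded L_def]) auto
        then show ?case
        proof (rule hbound_mono)
          have "b * 1 \<le> b * (1 + tau * L) ^ Suc j" using b x1 by (intro mult_left_mono one_le_power) auto
          then show "(1 + tau * L) * (real j * b * (1 + tau * L) ^ j) + b \<le> real (Suc j) * b * (1 + tau * L) ^ Suc j"
            by (simp add: algebra_simps)
        qed
      qed
      then have "hbound r (err k) (real k * b * (1 + tau * L) ^ k)" by simp
      then show ?thesis
      proof (rule hbound_mono)
        have kT: "real k * tau \<le> T" using tn[OF \<open>k \<le> n\<close>] nT by auto
        have "(1 + tau * L) ^ k \<le> exp (tau * L) ^ k" using x1 by (intro power_mono exp_ge_add_one_self) auto
        also have "\<dots> = exp (L * (real k * tau))" by (simp add: exp_of_nat_mult[symmetric] mult_ac)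
        also have "\<dots> \<le> exp (L * T)" using L kT by (simp add: mult_left_mono)
        finally have e: "(1 + tau * L) ^ k \<le> exp (L * T)" .
        have "real k * b * (1 + tau * L) ^ k = (tau * (1 / eps)) * (D * (real k * tau) * (1 + tau * L) ^ k)"
          by (simp add: b_def power2_eq_square)
        also have "\<dots> \<le> (tau * (1 / eps)) * (D * T * exp (L * T))"
          using tau eps D kT e T x1 by (intro mult_left_mono mult_mono) auto
        finally show "real k * b * (1 + tau * L) ^ k \<le> tau * (1 / eps) * bound B'"
          by (simp add: bound_def L_def)
      qed
    qed
    have low: "hbound s (fourier_coeff (v k)) B" if "k \<le> n" for k
    proof (cases "tau * (1 / eps) * G \<le> 1")
      case True
      have "hbound s (fourier_coeff (v k)) (M + 1)" using that
      proof (induction k rule: less_induct)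
        case (less k)
        have e: "hbound r (err k) (tau * (1 / eps) * G)"
          \<comment> \<open>Bounds by M + 1 for the earlier iterates give an error at most 1 in H^r,
            hence in H^s, and so the same bound for \<open>v k\<close>.\<close>
          unfolding G_def using less M by (intro err_bound) auto
        have "hbound s (err k) 1"
          by (rule hbound_exponent_mono[OF hbound_mono[OF e True] exponents(4)])
        from hbound_diff[OF us[OF less.prems] this] show ?case by (simp add: err_def)
      qed
      then show ?thesis by (rule hbound_mono) (simp add: B_def)
    next
      case False
      then have epsG: "eps < G * tau" using eps by (simp add: field_simps)
      \<comment> \<open>A scalar majorant obeying the growth bound with equality. As eps < G tau,
        its factor eps^(1/8) is at most G^(1/8) tau^(1/8).\<close>
      define y where "y = rec_nat M (\<lambda>_ x. x + CA * eps powr (1/8) * tau * x\<^sup>2)"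
      have y0: "y 0 = M" and ys: "y (Suc k) = y k + CA * eps powr (1/8) * tau * (y k)\<^sup>2" for k
        by (simp_all add: y_def)
      have y: "hbound s (fourier_coeff (v k)) (y k)" for k
      proof (induction k)
        case 0 then show ?case using us[of 0] by (simp add: v0 y0)
      next
        case (Suc k) then show ?case unfolding ys using eps tau sv v by (intro CA(2)) auto
      qed
      have "\<forall>k\<le>n. y k \<le> B0"
      proof (rule B0[of tau n], intro conjI allI)
        show "y 0 \<le> M" by (simp add: y0)
        show "0 \<le> y k" for k by (rule hbound_nonneg[OF y])
        show "y (Suc k) \<le> y k + CA * G powr (1/8) * tau powr (1/8) * tau * (y k)\<^sup>2" for k
        proof -
          have "eps powr (1/8) \<le> (G * tau) powr (1/8)" using eps epsG by (intro powr_mono2) auto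
          also have "\<dots> = G powr (1/8) * tau powr (1/8)" using bound0 tau by (simp add: G_def powr_mult)
          finally have "CA * eps powr (1/8) * tau * (y k)\<^sup>2 \<le> CA * (G powr (1/8) * tau powr (1/8)) * tau * (y k)\<^sup>2"
            using CA(1) tau by (intro mult_right_mono mult_left_mono) auto
          then show ?thesis by (simp add: ys mult.assoc)
        qed
      qed (fact tau nT)+
      then have "y k \<le> B" using that by (auto simp: B_def)
      with y[of k] show ?thesis by (rule hbound_mono)
    qed
    have "hbound r (err n) (tau * (1 / eps) * bound B)"
      using low M by (intro err_bound) (auto simp: B_def)
    then show "square_integrable (v n) \<and>
      hbound r (\<lambda>k. fourier_coeff (u (real n * tau)) k - fourier_coeff (v n) k) (tau * (1 / eps) * bound B)"
      using sv by (simp add: err_def[abs_def])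
  qed
qed

end

section \<open>Return to Sobolev norms\<close>

theorem mainTheorem5:
  fixes P :: "complex poly" and lam :: nat and r T :: real
  assumes "degree P = lam" and "lam \<ge> 1"
    and "\<forall>x::real. Re (poly P (\<i> * complex_of_real x)) = 0"
    and "r > 1 / 2"
  shows "\<exists>c :: real \<Rightarrow> real.
    \<forall>(eps::real) (tau::real) (n::nat) (u :: real \<Rightarrow> real \<Rightarrow> complex) (v :: nat \<Rightarrow> real \<Rightarrow> complex).
      0 < eps \<and> eps \<le> 1 \<and> 0 < tau \<and> real n * tau \<le> T \<and>
      exact_solution P eps (solution_regularity r lam) (real n * tau) u \<and>
      bdd_above ((\<lambda>t. sobolev_norm (solution_regularity r lam) (u t)) ` {0..real n * tau}) \<and>
      lie_splitting P eps tau (u 0) v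
      \<longrightarrow>
      (\<lambda>x. u (real n * tau) x - v n x) \<in> sobolev r \<and>
      sobolev_norm r (\<lambda>x. u (real n * tau) x - v n x)
        \<le> tau * (1 / eps) *
           c (SUP t\<in>{0..real n * tau}. sobolev_norm (solution_regularity r lam) (u t))"
proof -
  interpret bbm_splitting P lam r by unfold_locales (use assms in auto)
  define bounded_by where "bounded_by = (\<lambda>M C. \<forall>eps tau n u v. 0 < eps \<and> eps \<le> 1 \<and> 0 < tau \<and> real n * tau \<le> T \<and>
     exact_solution P eps \<sigma> (real n * tau) u \<and> (\<forall>t\<in>{0..real n * tau}. hbound \<sigma> (fourier_coeff (u t)) M) \<and>
     lie_splitting P eps tau (u 0) v \<longrightarrow>
     square_integrable (v n) \<and>
     hbound r (\<lambda>k. fourier_coeff (u (real n * tau)) k - fourier_coeff (v n) k) (tau * (1 / eps) * C))"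
  \<comment> \<open>The sign conditions stand inside the existential, so that choice yields a total
    function \<open>c\<close> of M.\<close>
  have "\<exists>C. 0 \<le> T \<and> 0 \<le> M \<longrightarrow> bounded_by M C" for M
  proof (cases "0 \<le> T \<and> 0 \<le> M")
    case True
    then have "\<exists>C. bounded_by M C" unfolding bounded_by_def by (intro global_error) auto
    then show ?thesis by blast
  qed blast
  then obtain c where c: "0 \<le> T \<Longrightarrow> 0 \<le> M \<Longrightarrow> bounded_by M (c M)" for M
    by metis
  show ?thesis
  proof (rule exI[of _ c], intro allI impI)
    fix eps tau :: real and n :: nat and u :: "real \<Rightarrow> real \<Rightarrow> complex" and v :: "nat \<Rightarrow> real \<Rightarrow> complex"
    let ?I = "{0..real n * tau}"
    let ?M = "SUP t\<in>?I. sobolev_norm \<sigma> (u t)"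
    assume *: "0 < eps \<and> eps \<le> 1 \<and> 0 < tau \<and> real n * tau \<le> T \<and>
      exact_solution P eps \<sigma> (real n * tau) u \<and>
      bdd_above ((\<lambda>t. sobolev_norm \<sigma> (u t)) ` ?I) \<and> lie_splitting P eps tau (u 0) v"
    have sob: "u t \<in> sobolev \<sigma>" if "t \<in> ?I" for t using * that by (simp add: exact_solution_def)
    have hb: "hbound \<sigma> (fourier_coeff (u t)) ?M" if "t \<in> ?I" for t
    proof (rule hbound_mono[OF sobolev_imp_hbound[OF sob[OF that]]])
      show "sobolev_norm \<sigma> (u t) \<le> ?M" using * that by (intro cSUP_upper) auto
    qed
    have nt: "0 \<le> real n * tau" using * by simp
    then have M: "0 \<le> ?M" using hbound_nonneg[OF hb[of 0]] by simp
    have T: "0 \<le> T" using nt * by linarith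
    have res: "square_integrable (v n)" "hbound r (\<lambda>k. fourier_coeff (u (real n * tau)) k - fourier_coeff (v n) k) (tau * (1 / eps) * c ?M)"
      using c[OF T M, unfolded bounded_by_def, rule_format, of eps tau n u v] * hb by simp_all
    have su: "square_integrable (u (real n * tau))" using sob[of "real n * tau"] nt by (simp add: sobolev_def)
    have "hbound r (fourier_coeff (\<lambda>x. u (real n * tau) x - v n x)) (tau * (1 / eps) * c ?M)"
      using res(2) fourier_coeff_diff[OF su res(1), abs_def] by simp
    from hbound_imp_sobolev[OF square_integrable_diff[OF su res(1)] this]
    show "(\<lambda>x. u (real n * tau) x - v n x) \<in> sobolev r \<and>
      sobolev_norm r (\<lambda>x. u (real n * tau) x - v n x) \<le> tau * (1 / eps) * c ?M" by blast
  qed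
qed

end
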